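(* For non-negative integers $n,m,k,l$ with $m,k\le n$, $m+k-n\le l\le \min(m,k)$, $m\le n-m$, and $x=0,1,\dots,m$, we have \[ p(x\mid n,m,k,l\mid q)=\begin{bmatrix}n-k\\ m-l\end{bmatrix}_q\frac{\begin{bmatrix}n\\ x\end{bmatrix}_q}{\begin{bmatrix}n\\ m\end{bmatrix}_q}\, q^x\frac{[n-2x+1]_q}{[n-x+1]_q}\;{}_4\phi_3\!\left(\begin{matrix}q^{-x},\ q^{x-n-1},\ q^{-M},\ q^{-N}\\ q^{-m},\ q^{m-n},\ q^{-M-N}\end{matrix};q,q\right), \] where $M:=m-l$, $N:=n-m-k+l$.
   Context: Let $q$ be a prime power, $\mathcal{V}$ an $n$-dimensional $\mathbb{F}_q$-space with basis $v_1,\dots,v_n$, $\mathcal{V}_i:=\mathrm{span}(v_1,\dots,v_i)$, $\mathcal{V}_k^c:=\mathrm{span}(v_{k+1},\dots,v_n)$. Let $G=\mathrm{GL}(\mathcal{V})$, $K=\{g\in G: g\mathcal{V}_m=\mathcal{V}_m\}$; $\mathrm{Ind}_K^G 1=\bigoplus_{x=0}^m\mathcal{V}_x$ multiplicity-free, with $\mathcal{V}_x$ the irreducible character $\chi_x$ corresponding (under the characteristic map) to the Schur function $s_{(n-x,x)}$, and $\dim\mathcal{V}_x=q^x\frac{[n-2x+1]_q}{[n-x+1]_q}\begin{bmatrix}n\\ x\end{bmatrix}_q$. Let $\mathcal{T}=(\mathbb{C}^2)^{\otimes\mathbb{P}^1(\mathcal{V})}$ (tensor factors indexed by lines in $\mathcal{V}$),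 with $G$ acting by $\varphi$ permuting lines; for a subspace $\mathcal{W}$ let $|e_{\mathcal{W}}\rangle$ have factor $|1\rangle$ at lines $L\subset\mathcal{W}$ and $|0\rangle$ elsewhere. Set $|\Xi_{n,m|k,l|q}\rangle:=\begin{bmatrix}n-k\\ m-l\end{bmatrix}_q^{-1/2}\sum_{\mathcal{W}}|e_{\mathcal{W}}\rangle$, summing over $\mathcal{W}$ with $\mathcal{V}_l\subset\mathcal{W}$, $\dim\mathcal{W}=m$, $\dim(\mathcal{W}\cap\mathcal{V}_k^c)=m-l$; $\mathsf{P}_{x|q}:=\frac{\dim\mathcal{V}_x}{|G|}\sum_{g\in G}\chi_x(g)\varphi(g)$; and $p(x\mid n,m,k,l\mid q):=\langle\Xi_{n,m|k,l|q}|\mathsf{P}_{x|q}|\Xi_{n,m|k,l|q}\rangle$. Notation: $(a;q)_r=(1-a)(1-aq)\cdots(1-aq^{r-1})$, $[n]_q=1+q+\dots+q^{n-1}$, $\begin{bmatrix}n\\ m\end{bmatrix}_q=\frac{(q;q)_n}{(q;q)_m(q;q)_{n-m}}$, and ${}_4\phi_3\!\left(\begin{matrix}a_1,\dots,a_4\\ b_1,b_2,b_3\end{matrix};q,z\right)=\sum_{r\ge0}\frac{(a_1,\dots,a_4;q)_r}{(b_1,b_2,b_3,q;q)_r}z^r$. *)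

theory Defs
  imports Complex_Main
begin

text \<open>Vectors of V = F_q^n are functions nat => F_q vanishing at indices >= n;
  the standard basis vector v_(i+1) is the indicator of index i.\<close>

type_synonym 'a vec = "nat \<Rightarrow> 'a"

definition Vsp :: "nat \<Rightarrow> ('a::field) vec set" where
  "Vsp n = {v. \<forall>i\<ge>n. v i = 0}"

definition Vflag :: "nat \<Rightarrow> nat \<Rightarrow> ('a::field) vec set" where
  "Vflag n i = {v \<in> Vsp n. \<forall>j\<ge>i. v j = 0}"

definition Vcompl :: "nat \<Rightarrow> nat \<Rightarrow> ('a::field) vec set" where
  "Vcompl n k = {v \<in> Vsp n. \<forall>j<k. v j = 0}"

definition lin_comb :: "(nat \<Rightarrow> 'a::field) \<Rightarrow> 'a vec list \<Rightarrow> 'a vec" where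
  "lin_comb c vs = (\<lambda>i. \<Sum>j<length vs. c j * (vs ! j) i)"

definition lin_span :: "('a::field) vec list \<Rightarrow> 'a vec set" where
  "lin_span vs = range (\<lambda>c. lin_comb c vs)"

definition lin_indep :: "('a::field) vec list \<Rightarrow> bool" where
  "lin_indep vs = (\<forall>c. lin_comb c vs = (\<lambda>_. 0) \<longrightarrow> (\<forall>j<length vs. c j = 0))"

definition subspaces_dim :: "nat \<Rightarrow> nat \<Rightarrow> ('a::field) vec set set" where
  "subspaces_dim n d = {W. \<exists>vs. length vs = d \<and> set vs \<subseteq> Vsp n \<and> lin_indep vs \<and> lin_span vs = W}"

definition lines :: "nat \<Rightarrow> ('a::field) vec set set" where
  "lines n = subspaces_dim n 1"

definition GLn :: "nat \<Rightarrow> (('a::field) vec \<Rightarrow> 'a vec) set" where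
  "GLn n = {g. bij_betw g (Vsp n) (Vsp n)
     \<and> (\<forall>u\<in>Vsp n. \<forall>w\<in>Vsp n. g (\<lambda>i. u i + w i) = (\<lambda>i. g u i + g w i))
     \<and> (\<forall>c. \<forall>u\<in>Vsp n. g (\<lambda>i. c * u i) = (\<lambda>i. c * g u i))
     \<and> (\<forall>v. v \<notin> Vsp n \<longrightarrow> g v = v)}"

text \<open>Permutation character of G on d-dimensional subspaces (= Ind from the
  stabiliser of a d-subspace of the trivial character).\<close>
definition perm_char :: "nat \<Rightarrow> nat \<Rightarrow> (('a::field) vec \<Rightarrow> 'a vec) \<Rightarrow> int" where
  "perm_char n d g = int (card {W \<in> subspaces_dim n d. g ` W = W})"

text \<open>chi_x, the unipotent character with characteristic s_(n-x,x)
  = h_(n-x) h_x - h_(n-x+1) h_(x-1) (Jacobi-Trudi), i.e. pi_x - pi_(x-1).\<close>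
definition chi :: "nat \<Rightarrow> nat \<Rightarrow> (('a::field) vec \<Rightarrow> 'a vec) \<Rightarrow> int" where
  "chi n x g = (if x = 0 then perm_char n 0 g else perm_char n x g - perm_char n (x - 1) g)"

definition qpoch :: "real \<Rightarrow> real \<Rightarrow> nat \<Rightarrow> real" where
  "qpoch a q r = (\<Prod>i<r. (1 - a * q ^ i))"

definition qint :: "real \<Rightarrow> nat \<Rightarrow> real" where
  "qint q n = (\<Sum>i<n. q ^ i)"

definition qbinom :: "real \<Rightarrow> nat \<Rightarrow> nat \<Rightarrow> real" where
  "qbinom q n m = qpoch q q n / (qpoch q q m * qpoch q q (n - m))"

definition phi43 :: "real \<Rightarrow> real \<Rightarrow> real \<Rightarrow> real \<Rightarrow> real \<Rightarrow> real \<Rightarrow> real \<Rightarrow> real \<Rightarrow> real \<Rightarrow> real" where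
  "phi43 a1 a2 a3 a4 b1 b2 b3 q z =
     (\<Sum>r. (qpoch a1 q r * qpoch a2 q r * qpoch a3 q r * qpoch a4 q r)
          / (qpoch b1 q r * qpoch b2 q r * qpoch b3 q r * qpoch q q r) * z ^ r)"

definition dimV :: "real \<Rightarrow> nat \<Rightarrow> nat \<Rightarrow> real" where
  "dimV q n x = q ^ x * qint q (n - 2 * x + 1) / qint q (n - x + 1) * qbinom q n x"

text \<open>Elements of T = (C^2)^(tensor P^1(V)) as coefficient functions on the
  product basis, indexed by the set S of lines carrying the factor |1>.\<close>
type_synonym 'a tens = "'a vec set set \<Rightarrow> complex"

definition eW :: "nat \<Rightarrow> ('a::field) vec set \<Rightarrow> 'a tens" where
  "eW n W = (\<lambda>S. if S = {L \<in> lines n. L \<subseteq> W} then 1 else 0)"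

definition Xi_set :: "nat \<Rightarrow> nat \<Rightarrow> nat \<Rightarrow> nat \<Rightarrow> ('a::field) vec set set" where
  "Xi_set n m k l = {W \<in> subspaces_dim n m. Vflag n l \<subseteq> W
       \<and> W \<inter> Vcompl n k \<in> subspaces_dim n (m - l)}"

definition Xi :: "nat \<Rightarrow> nat \<Rightarrow> nat \<Rightarrow> nat \<Rightarrow> ('a::{field,finite}) tens" where
  "Xi n m k l = (\<lambda>S. complex_of_real (qbinom (real (card (UNIV :: 'a set))) (n - k) (m - l) powr (-1/2))
       * (\<Sum>W\<in>(Xi_set n m k l :: 'a vec set set). eW n W S))"

text \<open>phi(g) |S> = |g S>\<close>
definition phi :: "nat \<Rightarrow> (('a::field) vec \<Rightarrow> 'a vec) \<Rightarrow> 'a tens \<Rightarrow> 'a tens" where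
  "phi n g u = (\<lambda>S. u {L \<in> lines n. g ` L \<in> S})"

definition Pproj :: "nat \<Rightarrow> nat \<Rightarrow> ('a::{field,finite}) tens \<Rightarrow> 'a tens" where
  "Pproj n x u = (\<lambda>S. complex_of_real (dimV (real (card (UNIV :: 'a set))) n x / real (card (GLn n :: ('a vec \<Rightarrow> 'a vec) set)))
       * (\<Sum>g\<in>(GLn n :: ('a vec \<Rightarrow> 'a vec) set). of_int (chi n x g) * phi n g u S))"

definition tinner :: "nat \<Rightarrow> ('a::field) tens \<Rightarrow> 'a tens \<Rightarrow> complex" where
  "tinner n u v = (\<Sum>S\<in>Pow (lines n :: 'a vec set set). cnj (u S) * v S)"

definition prob :: "('a::{field,finite}) itself \<Rightarrow> nat \<Rightarrow> nat \<Rightarrow> nat \<Rightarrow> nat \<Rightarrow> nat \<Rightarrow> complex" where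
  "prob (_ :: 'a itself) x n m k l =
     tinner n (Xi n m k l :: 'a tens) (Pproj n x (Xi n m k l :: 'a tens))"

end

theory Submission
  imports Defs "HOL-Library.Function_Algebras" "HOL-Library.FuncSet"
begin

text \<open>For \<open>W, W'\<close> of dimension \<open>m\<close> put \<open>K W W' = (\<Sum>g | g W' = W. \<chi>\<^sub>x g)\<close>; up to a constant the probability is
  the sum of \<open>K\<close> over pairs of subspaces occurring in \<open>\<Xi>\<close>. Representation theory is avoided as
  follows. The number of \<open>g\<close> mapping a pair \<open>(U', W')\<close> to \<open>(U, W)\<close> depends, as a function of \<open>(U, W)\<close>, only
  on \<open>dim (U \<inter> W)\<close>, and on such functions the Laplacians of the two Grassmann graphs (in \<open>U\<close> and in \<open>W\<close>)
  coincide. So the Laplacian of \<open>K\<close> in \<open>W\<close> can be computed on the fixed points \<open>U\<close> counted by \<open>\<chi>\<^sub>x\<close>,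
  where counting pairs \<open>H \<subseteq> U \<inter> g U\<close> links the levels \<open>x - 1\<close> and \<open>x\<close> and makes \<open>K\<close> an eigenfunction with
  eigenvalue \<open>-[x][n - x + 1]\<close>. Burnside's lemma gives the diagonal of \<open>K\<close>, and the resulting three-term
  recurrence in the distance \<open>r = m - dim (W \<inter> W')\<close> identifies \<open>K\<close> with a 3phi2, expanded in the functions
  \<open>(q^-r; q)\<^sub>s\<close>. The pairs in \<open>\<Xi>\<close> are distributed like pairs of \<open>(m - l)\<close>-subspaces of \<open>V\<^sub>k\<^sup>c\<close>, and
  since the Laplacian of that smaller Grassmann graph sums to zero, the sums of \<open>(q^-r; q)\<^sub>s\<close> satisfy a
  first-order recurrence in \<open>s\<close>, which turns the 3phi2 into the 4phi3.\<close>

section \<open>The 3phi2 as a Laplacian eigenfunction\<close>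

text \<open>The obstacle is that a fixed point \<open>U\<close> is at once source and target of
  \<open>g\<close>. With the source pair \<open>(U, W')\<close> frozen, the count becomes a function
  of two independent targets; carrying the Laplacian from \<open>W\<close> to the target copy of
  \<open>U\<close> then turns "\<open>g\<close> fixes \<open>U\<close>" into "\<open>g\<close> moves
  \<open>U\<close> to a neighbour". The functions \<open>(q^-r; q)_s\<close> serve as a basis
  because the Laplacians are bidiagonal on them, sending index \<open>s\<close> to \<open>s\<close>
  and \<open>s - 1\<close>, so eigenfunctions and averages both obey first-order recurrences. This
  is the origin of the 4phi3 parameters: \<open>q^-x\<close> and \<open>q^(x-n-1)\<close> come from
  factoring the difference of diagonal entry and eigenvalue, \<open>q^-m\<close> and
  \<open>q^(m-n)\<close> from the lowering term, and \<open>q^-M\<close>, \<open>q^-N\<close> over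
  \<open>q^(-M-N)\<close> from the mean of \<open>(q^-r; q)_s\<close> over the
  \<open>M\<close>-subspaces of an \<open>(M+N)\<close>-space. The hypothesis
  \<open>m \<le> n - m\<close> ensures that every distance from 0 to \<open>m\<close> occurs and
  that the outward coefficients are non-zero below \<open>m\<close>, so the recurrence determines
  the kernel.\<close>

lemma qpoch_Suc: "qpoch a q (Suc s) = qpoch a q s * (1 - a * q ^ s)"
  by (simp add: qpoch_def)

lemma qpoch_Suc_shift: "qpoch a q (Suc s) = (1 - a) * qpoch (a * q) q s"
  unfolding qpoch_def by (subst prod.lessThan_Suc_shift) (simp add: mult.assoc)

lemma qpoch_0 [simp]: "qpoch a q 0 = 1"
  by (simp add: qpoch_def)

lemma qpoch_inverse_power_eq_0:
  fixes q :: real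
  assumes "q > 0" "r < s"
  shows "qpoch (1 / q ^ r) q s = 0"
  unfolding qpoch_def using assms by (simp add: prod_zero_iff) auto

lemma qpoch_neq_0:
  fixes q :: real
  assumes "\<And>i. i < s \<Longrightarrow> a * q ^ i \<noteq> 1"
  shows "qpoch a q s \<noteq> 0"
  unfolding qpoch_def using assms by (auto simp: prod_zero_iff)

text \<open>The left-hand side is the Laplacian of the Grassmann graph of \<open>m\<close>-subspaces of an \<open>n\<close>-space, applied
  to a function of the distance \<open>r\<close>. For \<open>r = 0\<close> the junk term \<open>r - 1\<close> has coefficient 0.\<close>

lemma laplacian_qpoch:
  fixes q :: real
  assumes q: "q > 1"
  shows "((q ^ r - 1) / (q - 1)) * ((q ^ r - 1) / (q - 1))
        * (qpoch (1 / q ^ (r - 1)) q s - qpoch (1 / q ^ r) q s)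
      + q ^ Suc (r + r) * ((q ^ m / q ^ r - 1) / (q - 1)) * ((q ^ n / (q ^ m * q ^ r) - 1) / (q - 1))
        * (qpoch (1 / q ^ Suc r) q s - qpoch (1 / q ^ r) q s)
    = (q ^ s - 1) / (q - 1) ^ 2 *
      ((1 - q * q ^ n / q ^ s) * qpoch (1 / q ^ r) q s
        + q ^ s / q * (1 - q ^ m * q / q ^ s) * (1 - q ^ n * q / (q ^ m * q ^ s)) * qpoch (1 / q ^ r) q (s - 1))"
proof (cases s)
  case 0
  then show ?thesis by simp
next
  case (Suc t)
  define u where "u = qpoch (1 / q ^ r) q t"
  define R S Y Z where "R = q ^ r" and "S = q ^ t" and "Y = q ^ m" and "Z = q ^ n"
  have pos: "R > 0" "S > 0" "Y > 0" "Z > 0" "q > 0" "q \<noteq> 1" using q by (auto simp: R_def S_def Y_def Z_def)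
  have us: "qpoch (1 / q ^ r) q s = u * (1 - S / R)"
    by (simp add: Suc qpoch_Suc u_def R_def S_def)
  have up: "qpoch (1 / q ^ Suc r) q s = (1 - 1 / (q * R)) * u"
    using pos by (simp add: Suc qpoch_Suc_shift u_def R_def)
  \<comment> \<open>One of the two factors \<open>R - 1\<close> of the Laplacian is spent on
    clearing the denominator that arises when \<open>qpoch (1 / q ^ (r - 1)) q t\<close> is
    expressed through \<open>u\<close>. This also covers \<open>r = 0\<close>, where both sides
    vanish: \<open>u\<close> then contains the factor \<open>1 - 1\<close>, unless
    \<open>t = 0\<close> and hence \<open>S = 1\<close>.\<close>
  have down: "(R - 1) * (qpoch (1 / q ^ (r - 1)) q s - qpoch (1 / q ^ r) q s) = u * (R - S) * (1 - q * S) / R"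
  proof (cases r)
    case 0
    then have "R = 1" by (simp add: R_def)
    moreover have "u * (1 - S) = 0"
    proof (cases t)
      case (Suc t')
      then show ?thesis using 0 by (simp add: u_def qpoch_Suc_shift)
    qed (simp add: S_def)
    ultimately show ?thesis by simp
  next
    case (Suc r')
    define v where "v = qpoch (1 / q ^ r') q t"
    have R: "R = q * q ^ r'" by (simp add: R_def Suc)
    have "qpoch (1 / q ^ (r - 1)) q s = v * (1 - q * S / R)"
      using pos by (simp add: \<open>s = Suc t\<close> Suc qpoch_Suc v_def S_def R)
    moreover have "qpoch (1 / q ^ r) q s = (1 - 1 / R) * v"
      using pos by (simp add: \<open>s = Suc t\<close> Suc qpoch_Suc_shift v_def R)
    moreover from this us have "(R - 1) * v = u * (R - S)"
      using pos by (simp add: field_simps)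
    moreover have "(R - 1) * (v * (1 - q * S / R) - (1 - 1 / R) * v) = ((R - 1) * v) * (1 - q * S) / R"
      using pos by (simp add: field_simps)
    ultimately show ?thesis by simp
  qed
  have "((R - 1) / (q - 1)) * ((R - 1) / (q - 1)) * (qpoch (1 / q ^ (r - 1)) q s - qpoch (1 / q ^ r) q s)
      = (R - 1) * ((R - 1) * (qpoch (1 / q ^ (r - 1)) q s - qpoch (1 / q ^ r) q s)) / (q - 1) ^ 2"
    by (simp add: power2_eq_square)
  also have "\<dots> = (R - 1) * (u * (R - S) * (1 - q * S) / R) / (q - 1) ^ 2" unfolding down ..
  finally have D: "((R - 1) / (q - 1)) * ((R - 1) / (q - 1)) * (qpoch (1 / q ^ (r - 1)) q s - qpoch (1 / q ^ r) q s)
      = (R - 1) * (u * (R - S) * (1 - q * S) / R) / (q - 1) ^ 2" .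
  have U: "q ^ Suc (r + r) * ((Y / R - 1) / (q - 1)) * ((Z / (Y * R) - 1) / (q - 1))
        * (qpoch (1 / q ^ Suc r) q s - qpoch (1 / q ^ r) q s)
      = (q * R * R * (Y / R - 1) * (Z / (Y * R) - 1) * ((1 - 1 / (q * R)) * u - u * (1 - S / R))) / (q - 1) ^ 2"
    unfolding us up by (simp add: R_def power_add power2_eq_square)
  have "(R - 1) * (u * (R - S) * (1 - q * S) / R)
      + q * R * R * (Y / R - 1) * (Z / (Y * R) - 1) * ((1 - 1 / (q * R)) * u - u * (1 - S / R))
    = (q * S - 1) * ((1 - Z / S) * (u * (1 - S / R)) + S * (1 - Y / S) * (1 - Z / (Y * S)) * u)"
    using pos by (simp add: field_simps)
  then have "((R - 1) * (u * (R - S) * (1 - q * S) / R)) / (q - 1) ^ 2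
      + (q * R * R * (Y / R - 1) * (Z / (Y * R) - 1) * ((1 - 1 / (q * R)) * u - u * (1 - S / R))) / (q - 1) ^ 2
    = (q * S - 1) / (q - 1) ^ 2 * ((1 - Z / S) * (u * (1 - S / R)) + S * (1 - Y / S) * (1 - Z / (Y * S)) * u)"
    unfolding add_divide_distrib[symmetric] by simp
  moreover have "((q ^ r - 1) / (q - 1)) * ((q ^ r - 1) / (q - 1))
        * (qpoch (1 / q ^ (r - 1)) q s - qpoch (1 / q ^ r) q s)
      + q ^ Suc (r + r) * ((q ^ m / q ^ r - 1) / (q - 1)) * ((q ^ n / (q ^ m * q ^ r) - 1) / (q - 1))
        * (qpoch (1 / q ^ Suc r) q s - qpoch (1 / q ^ r) q s)
    = ((R - 1) * (u * (R - S) * (1 - q * S) / R)) / (q - 1) ^ 2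
      + (q * R * R * (Y / R - 1) * (Z / (Y * R) - 1) * ((1 - 1 / (q * R)) * u - u * (1 - S / R))) / (q - 1) ^ 2"
    unfolding R_def S_def Y_def Z_def D[unfolded R_def S_def Y_def Z_def] U[unfolded R_def S_def Y_def Z_def]
    by (rule refl)
  moreover have "q * q ^ n / q ^ s = Z / S" "q ^ s / q = S" "q ^ m * q / q ^ s = Y / S"
      "q ^ n * q / (q ^ m * q ^ s) = Z / (Y * S)" "qpoch (1 / q ^ r) q (s - 1) = u" "q ^ s = q * S"
    using pos by (simp_all add: Suc S_def Y_def Z_def u_def)
  ultimately show ?thesis by (simp only: us)
qed

text \<open>Coefficients of the q-Hahn polynomial of degree \<open>x\<close> in \<open>q^-r\<close>,
  the 3phi2 with upper parameters \<open>q^-x\<close>, \<open>q^(x-n-1)\<close>, \<open>q^-r\<close>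
  and lower parameters \<open>q^-m\<close>, \<open>q^(m-n)\<close>. The factor
  \<open>(q^-r; q)_s\<close> is kept apart as the expansion basis.\<close>

definition omega_coeff :: "real \<Rightarrow> nat \<Rightarrow> nat \<Rightarrow> nat \<Rightarrow> nat \<Rightarrow> real" where
  "omega_coeff q n m x s = qpoch (1 / q ^ x) q s * qpoch (q ^ x / q ^ Suc n) q s
     / (qpoch (1 / q ^ m) q s * qpoch (q ^ m / q ^ n) q s * qpoch q q s) * q ^ s"

definition omega :: "real \<Rightarrow> nat \<Rightarrow> nat \<Rightarrow> nat \<Rightarrow> nat \<Rightarrow> real" where
  "omega q n m x r = (\<Sum>s\<le>x. omega_coeff q n m x s * qpoch (1 / q ^ r) q s)"

text \<open>Comparison of coefficients at \<open>(q^-r; q)_s\<close> in the eigenvalue equation: the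
  lowering term coming from \<open>s + 1\<close> has to cancel the diagonal entry minus the
  eigenvalue.\<close>

lemma omega_coeff_step:
  fixes q :: real
  assumes q: "q > 1" and "x \<le> m" "m \<le> n - m" "m \<le> n" "s \<le> x"
  shows "omega_coeff q n m x (Suc s) * ((q ^ Suc s - 1) * (q ^ s * (1 - q ^ m / q ^ s) * (1 - q ^ n / (q ^ m * q ^ s))))
    = - omega_coeff q n m x s * ((q ^ s - 1) * (1 - q * q ^ n / q ^ s) + (q ^ x - 1) * (q * q ^ n / q ^ x - 1))"
proof -
  define X S Y Z where "X = q ^ x" and "S = q ^ s" and "Y = q ^ m" and "Z = q ^ n"
  have pos: "X > 0" "S > 0" "Y > 0" "Z > 0" "q > 0" "q \<noteq> 1" using q by (auto simp: X_def S_def Y_def Z_def)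
  \<comment> \<open>Up to \<open>(q - 1)^2\<close>, the diagonal entry minus the eigenvalue. It
    vanishes at \<open>q^s = q^x\<close> and \<open>q^s = q^(n+1-x)\<close>, and its factors are
    those gained by \<open>(q^-x; q)_s\<close> and \<open>(q^(x-n-1); q)_s\<close> from
    \<open>s\<close> to \<open>s + 1\<close>.\<close>
  have fac: "(S - 1) * (1 - q * Z / S) + (X - 1) * (q * Z / X - 1)
      = (1 - S / X) * (1 - X / (q * Z) * S) * (q * Z / S)"
    using pos by (simp add: field_simps)
  show ?thesis
  \<comment> \<open>At \<open>s = x\<close> both sides are 0. If also \<open>x = m\<close>, the
    denominator factor \<open>1 - q^s / q^m\<close> vanishes there, so the quotient of consecutive
    coefficients is formed only below \<open>x\<close>.\<close>
  proof (cases "s = x")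
    case True
    then have "omega_coeff q n m x (Suc s) = 0"
      using q by (simp add: omega_coeff_def qpoch_inverse_power_eq_0)
    moreover have "S = X" using True by (simp add: S_def X_def)
    ultimately show ?thesis
      using fac pos unfolding X_def[symmetric] S_def[symmetric] Z_def[symmetric] by simp
  next
    case False
    then have "s < m" "s < n - m" using assms by auto
    then have lt: "S < Y" "S * Y < Z"
      using q by (auto simp: S_def Y_def Z_def simp flip: power_add intro!: power_strict_increasing)
    have ne: "1 - 1 / Y * S \<noteq> 0" "1 - Y / Z * S \<noteq> 0" "1 - q * S \<noteq> 0"
    proof -
      show "1 - 1 / Y * S \<noteq> 0" "1 - Y / Z * S \<noteq> 0"
        using lt pos by (auto simp: field_simps)
      have "q * S > 1" using q one_less_power[of q "Suc s"] by (simp add: S_def)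
      then show "1 - q * S \<noteq> 0" by simp
    qed
    have "omega_coeff q n m x (Suc s) = omega_coeff q n m x s *
        ((1 - 1 / X * S) * (1 - X / (q * Z) * S) * q / ((1 - 1 / Y * S) * (1 - Y / Z * S) * (1 - q * S)))"
      by (simp add: omega_coeff_def qpoch_Suc X_def S_def Y_def Z_def mult_ac)
    moreover have "((1 - 1 / X * S) * (1 - X / (q * Z) * S) * q / ((1 - 1 / Y * S) * (1 - Y / Z * S) * (1 - q * S)))
        * ((q * S - 1) * (S * (1 - Y / S) * (1 - Z / (Y * S))))
      = - ((1 - S / X) * (1 - X / (q * Z) * S) * (q * Z / S))"
    proof -
      define P where "P = (1 - 1 / Y * S) * (1 - Y / Z * S) * (1 - q * S)"
      have "P \<noteq> 0" using ne by (simp only: P_def mult_eq_0_iff) simp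
      moreover have "(q * S - 1) * (S * (1 - Y / S) * (1 - Z / (Y * S))) = - P * (Z / S)"
        using pos by (simp add: P_def field_simps)
      ultimately show ?thesis unfolding P_def[symmetric] by (simp add: mult_ac)
    qed
    ultimately show ?thesis
      unfolding X_def[symmetric] S_def[symmetric] Y_def[symmetric] Z_def[symmetric] power_Suc fac
      by (simp only: mult.assoc[of "omega_coeff q n m x s"] mult_minus_left mult_minus_right)
  qed
qed

lemma omega_eigenfunction:
  fixes q :: real
  assumes q: "q > 1" and "x \<le> m" "m \<le> n - m" "m \<le> n"
  shows "((q ^ r - 1) / (q - 1)) * ((q ^ r - 1) / (q - 1)) * (omega q n m x (r - 1) - omega q n m x r)
      + q ^ Suc (r + r) * ((q ^ m / q ^ r - 1) / (q - 1)) * ((q ^ n / (q ^ m * q ^ r) - 1) / (q - 1))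
        * (omega q n m x (Suc r) - omega q n m x r)
    = - ((q ^ x - 1) / (q - 1) * ((q * q ^ n / q ^ x - 1) / (q - 1))) * omega q n m x r"
proof -
  define a where "a = omega_coeff q n m x"
  define u where "u = (\<lambda>r s. qpoch (1 / q ^ r) q s)"
  define c b where "c = ((q ^ r - 1) / (q - 1)) * ((q ^ r - 1) / (q - 1))"
    and "b = q ^ Suc (r + r) * ((q ^ m / q ^ r - 1) / (q - 1)) * ((q ^ n / (q ^ m * q ^ r) - 1) / (q - 1))"
  define \<kappa> where "\<kappa> = (\<lambda>s. (q ^ s - 1) / (q - 1) ^ 2)"
  define \<beta> where "\<beta> = (\<lambda>s. q ^ s / q * (1 - q ^ m * q / q ^ s) * (1 - q ^ n * q / (q ^ m * q ^ s)))"
  have om: "omega q n m x r = (\<Sum>s\<le>x. a s * u r s)" for r by (simp add: omega_def a_def u_def)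
  have "c * (omega q n m x (r - 1) - omega q n m x r) + b * (omega q n m x (Suc r) - omega q n m x r)
      = (\<Sum>s\<le>x. a s * (c * (u (r - 1) s - u r s) + b * (u (Suc r) s - u r s)))"
    by (simp add: om sum_subtractf sum.distrib sum_distrib_left algebra_simps)
  also have "\<dots> = (\<Sum>s\<le>x. a s * (\<kappa> s * ((1 - q * q ^ n / q ^ s) * u r s + \<beta> s * u r (s - 1))))"
    unfolding c_def b_def u_def \<kappa>_def \<beta>_def by (simp only: laplacian_qpoch[OF q])
  also have "\<dots> = (\<Sum>s\<le>x. a s * \<kappa> s * (1 - q * q ^ n / q ^ s) * u r s)
      + (\<Sum>s\<le>x. a s * \<kappa> s * \<beta> s * u r (s - 1))"
    unfolding sum.distrib[symmetric] by (intro sum.cong refl) (simp add: algebra_simps)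
  \<comment> \<open>Index shift that collects the lowering terms at \<open>(q^-r; q)_s\<close>: the
    bottom term disappears by \<open>\<kappa> 0 = 0\<close>, the new top term by
    \<open>a (Suc x) = 0\<close>.\<close>
  also have "(\<Sum>s\<le>x. a s * \<kappa> s * \<beta> s * u r (s - 1)) = (\<Sum>s\<le>x. a (Suc s) * \<kappa> (Suc s) * \<beta> (Suc s) * u r s)"
  proof -
    have "a (Suc x) = 0" using q by (simp add: a_def omega_coeff_def qpoch_inverse_power_eq_0)
    then have "(\<Sum>s\<le>x. a (Suc s) * \<kappa> (Suc s) * \<beta> (Suc s) * u r s)
        = (\<Sum>s<x. a (Suc s) * \<kappa> (Suc s) * \<beta> (Suc s) * u r s)"
      by (simp add: lessThan_Suc_atMost[symmetric])
    moreover have "\<kappa> 0 = 0" by (simp add: \<kappa>_def)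
    ultimately show ?thesis by (simp add: sum.atMost_shift)
  qed
  also have "(\<Sum>s\<le>x. a s * \<kappa> s * (1 - q * q ^ n / q ^ s) * u r s)
      + (\<Sum>s\<le>x. a (Suc s) * \<kappa> (Suc s) * \<beta> (Suc s) * u r s)
    = (\<Sum>s\<le>x. - ((q ^ x - 1) * (q * q ^ n / q ^ x - 1) / (q - 1) ^ 2) * (a s * u r s))"
    unfolding sum.distrib[symmetric]
  proof (intro sum.cong refl)
    fix s assume "s \<in> {..x}"
    then have s: "s \<le> x" by simp
    have be: "\<beta> (Suc s) = q ^ s * (1 - q ^ m / q ^ s) * (1 - q ^ n / (q ^ m * q ^ s))"
      using q by (simp add: \<beta>_def)
    have "a s * \<kappa> s * (1 - q * q ^ n / q ^ s) + a (Suc s) * \<kappa> (Suc s) * \<beta> (Suc s)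
      = (a s * ((q ^ s - 1) * (1 - q * q ^ n / q ^ s)) + a (Suc s) * ((q ^ Suc s - 1) *
          (q ^ s * (1 - q ^ m / q ^ s) * (1 - q ^ n / (q ^ m * q ^ s))))) / (q - 1) ^ 2"
      by (simp add: \<kappa>_def be add_divide_distrib mult.assoc)
    also have "\<dots> = - ((q ^ x - 1) * (q * q ^ n / q ^ x - 1) / (q - 1) ^ 2) * a s"
      unfolding a_def omega_coeff_step[OF assms s] by (simp add: distrib_left)
    finally have eq: "a s * \<kappa> s * (1 - q * q ^ n / q ^ s) + a (Suc s) * \<kappa> (Suc s) * \<beta> (Suc s)
      = - ((q ^ x - 1) * (q * q ^ n / q ^ x - 1) / (q - 1) ^ 2) * a s" .
    show "a s * \<kappa> s * (1 - q * q ^ n / q ^ s) * u r s + a (Suc s) * \<kappa> (Suc s) * \<beta> (Suc s) * u r s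
      = - ((q ^ x - 1) * (q * q ^ n / q ^ x - 1) / (q - 1) ^ 2) * (a s * u r s)"
      unfolding distrib_right[symmetric] eq by simp
  qed
  also have "\<dots> = - ((q ^ x - 1) / (q - 1) * ((q * q ^ n / q ^ x - 1) / (q - 1))) * omega q n m x r"
    by (simp add: om sum_distrib_left power2_eq_square)
  finally show ?thesis unfolding c_def b_def .
qed

lemma omega_0:
  shows "omega q n m x 0 = 1"
proof -
  have "omega q n m x 0 = (\<Sum>s\<le>x. if s = 0 then 1 else 0)"
    unfolding omega_def
  proof (intro sum.cong refl)
    fix s
    show "omega_coeff q n m x s * qpoch (1 / q ^ 0) q s = (if s = 0 then 1 else 0)"
      by (cases s) (simp_all add: omega_coeff_def qpoch_Suc_shift)
  qed
  then show ?thesis by simp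
qed

section \<open>Counting subspaces\<close>

text \<open>The vector type may be infinite-dimensional (here functions on all of
  \<open>nat\<close>), so the ambient space is always an explicit finite subspace, and dimensions
  are compared through cardinalities \<open>qn ^ dim\<close>.\<close>

locale finite_field_space = vector_space scale
  for scale :: "'f::{field,finite} \<Rightarrow> 'v::ab_group_add \<Rightarrow> 'v" (infixr "*s" 75) +
  fixes qn :: nat
  assumes qn_eq: "qn = card (UNIV :: 'f set)"
begin

text \<open>As a simp rule it would turn \<open>dim (span (insert v H))\<close> into
  \<open>dim (insert v H)\<close>, where the formula for one added vector no longer matches.\<close>

declare dim_span [simp del]

lemma span_subspace_eq [simp]: "subspace H \<Longrightarrow> span H = H"
  by simp

lemma qn_gt1: "1 < qn"
proof -
  have "card {0, 1 :: 'f} \<le> qn" unfolding qn_eq by (intro card_mono) auto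
  then show ?thesis by simp
qed

lemma span_insert_eq_image:
  assumes "subspace H"
  shows "span (insert v H) = (\<lambda>(h, c). h + c *s v) ` (H \<times> UNIV)"
proof -
  have "x \<in> span (insert v H) \<longleftrightarrow> (\<exists>c. x - c *s v \<in> H)" for x
    by (simp add: span_breakdown_eq assms)
  moreover have "(\<exists>c. x - c *s v \<in> H) \<longleftrightarrow> x \<in> (\<lambda>(h, c). h + c *s v) ` (H \<times> UNIV)" for x
  proof
    assume "\<exists>c. x - c *s v \<in> H"
    then obtain c where "x - c *s v \<in> H" ..
    then show "x \<in> (\<lambda>(h, c). h + c *s v) ` (H \<times> UNIV)"
      by (intro image_eqI[of _ _ "(x - c *s v, c)"]) auto
  next
    assume "x \<in> (\<lambda>(h, c). h + c *s v) ` (H \<times> UNIV)"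
    then obtain h c where "x = h + c *s v" "h \<in> H" by auto
    then have "x - c *s v \<in> H" by simp
    then show "\<exists>c. x - c *s v \<in> H" ..
  qed
  ultimately show ?thesis by blast
qed

lemma finite_span_insert:
  assumes "subspace H" "finite H"
  shows "finite (span (insert v H))"
  using assms by (simp add: span_insert_eq_image)

lemma card_span_insert:
  assumes H: "subspace H" "v \<notin> H"
  shows "card (span (insert v H)) = qn * card H"
proof -
  have "inj_on (\<lambda>(h, c). h + c *s v) (H \<times> UNIV)"
  proof (rule inj_onI, clarify)
    fix h c h' c' assume h: "h \<in> H" "h' \<in> H" and eq: "h + c *s v = h' + c' *s v"
    have c: "c = c'"
    proof (rule ccontr)
      assume "c \<noteq> c'"
      from eq have "(c - c') *s v = h' - h" by (simp add: scale_left_diff_distrib) (metis add_diff_cancel_left' add_diff_eq diff_diff_eq2 add.commute)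
      then have "(c - c') *s v \<in> H" using h H by (simp add: subspace_diff)
      then have "inverse (c - c') *s (c - c') *s v \<in> H" by (rule subspace_scale[OF H(1)])
      then show False using \<open>c \<noteq> c'\<close> H by simp
    qed
    with eq show "h = h' \<and> c = c'" by simp
  qed
  then show ?thesis
    using H by (simp add: span_insert_eq_image card_image card_cartesian_product qn_eq)
qed

lemma card_span_independent:
  assumes "finite B" "independent B"
  shows "finite (span B) \<and> card (span B) = qn ^ card B"
  using assms
proof (induction B rule: finite_induct)
  case (insert b B)
  then have ind: "independent B" and b: "b \<notin> span B"
    by (auto simp: independent_insert)
  have eq: "span (insert b B) = span (insert b (span B))"
    unfolding span_insert[of b] by (simp add: span_span)
  show ?case
    using insert ind b card_span_insert[of "span B" b] finite_span_insert[of "span B" b]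
    unfolding eq by simp
qed auto

lemma finite_subspace_basis:
  assumes "subspace W" "finite W"
  obtains B where "B \<subseteq> W" "independent B" "span B = W" "finite B" "card B = dim W"
proof -
  obtain B where B: "B \<subseteq> W" "independent B" "W \<subseteq> span B" "card B = dim W"
    using basis_exists by blast
  moreover have "span B = W" using B assms by (simp add: span_subspace)
  moreover have "finite B" using B assms finite_subset by blast
  ultimately show ?thesis using that by blast
qed

lemma card_eq_power_dim:
  assumes "subspace W" "finite W"
  shows "card W = qn ^ dim W"
  using finite_subspace_basis[OF assms] card_span_independent by metis

lemma dim_eq_iff_card:
  assumes "subspace W" "finite W"
  shows "dim W = d \<longleftrightarrow> card W = qn ^ d"
  using card_eq_power_dim[OF assms] qn_gt1 by (metis power_inject_exp)

lemma dim_le_iff_card: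
  assumes "subspace A" "finite A" "subspace B" "finite B"
  shows "dim A \<le> dim B \<longleftrightarrow> card A \<le> card B"
  using card_eq_power_dim assms qn_gt1 by (metis power_increasing_iff)

lemma dim_mono_sub:
  assumes "subspace A" "subspace B" "finite B" "A \<subseteq> B"
  shows "dim A \<le> dim B"
  using assms dim_le_iff_card[of A B] card_mono[of B A] finite_subset[of A B] by blast

lemma sub_eq_of_dim:
  assumes "subspace A" "subspace B" "finite B" "A \<subseteq> B" "dim B \<le> dim A"
  shows "A = B"
  using assms dim_le_iff_card[of B A] card_seteq[of B A] finite_subset[of A B] by blast

lemma dim_span_insert:
  assumes "subspace H" "finite H" "v \<notin> H"
  shows "dim (span (insert v H)) = Suc (dim H)"
proof -
  have "card (span (insert v H)) = qn ^ Suc (dim H)"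
    using assms by (simp add: card_span_insert card_eq_power_dim)
  then show ?thesis using dim_eq_iff_card[OF subspace_span finite_span_insert] assms by blast
qed

definition ssum :: "'v set \<Rightarrow> 'v set \<Rightarrow> 'v set" (infixl "+s" 65) where
  "A +s B = span (A \<union> B)"

lemma ssum_eq:
  assumes "subspace A" "subspace B"
  shows "A +s B = (\<lambda>(a, b). a + b) ` (A \<times> B)"
proof -
  have "span A = A" "span B = B" using assms by (auto intro: span_subspace_eq)
  then show ?thesis unfolding ssum_def span_Un by auto
qed

lemma ssum_least: "A \<subseteq> C \<Longrightarrow> B \<subseteq> C \<Longrightarrow> subspace C \<Longrightarrow> A +s B \<subseteq> C"
  unfolding ssum_def by (simp add: span_minimal)

lemma ssum_upper: "A \<subseteq> A +s B" "B \<subseteq> A +s B"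
  unfolding ssum_def using span_superset by blast+

lemma subspace_ssum [simp]: "subspace (A +s B)"
  unfolding ssum_def by simp

lemma finite_ssum: "subspace A \<Longrightarrow> subspace B \<Longrightarrow> finite A \<Longrightarrow> finite B \<Longrightarrow> finite (A +s B)"
  by (simp add: ssum_eq)

text \<open>Every fibre of the addition map from \<open>A \<times> B\<close> onto the sum is in
  bijection with \<open>A \<inter> B\<close>; comparing cardinalities gives the dimensions.\<close>

lemma dim_ssum:
  assumes "subspace A" "subspace B" "finite A" "finite B"
  shows "dim (A +s B) + dim (A \<inter> B) = dim A + dim B"
proof -
  let ?f = "\<lambda>(a, b). a + b :: 'v"
  have AB: "subspace (A \<inter> B)" using assms by (simp add: subspace_inter)
  have fib: "card {p \<in> A \<times> B. ?f p = z} = card (A \<inter> B)" if "z \<in> ?f ` (A \<times> B)" for z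
  proof -
    from that obtain a b where ab: "a \<in> A" "b \<in> B" "z = a + b" by auto
    have "bij_betw (\<lambda>t. (a + t, b - t)) (A \<inter> B) {p \<in> A \<times> B. ?f p = z}"
    proof (rule bij_betw_imageI)
      show "inj_on (\<lambda>t. (a + t, b - t)) (A \<inter> B)" by (auto intro: inj_onI)
      show "(\<lambda>t. (a + t, b - t)) ` (A \<inter> B) = {p \<in> A \<times> B. ?f p = z}"
      proof (intro equalityI subsetI)
        fix p assume "p \<in> {p \<in> A \<times> B. ?f p = z}"
        then obtain a' b' where p: "p = (a', b')" "a' \<in> A" "b' \<in> B" "a' + b' = a + b"
          using ab by auto
        have "a' - a = b - b'" using p(4) by (simp add: algebra_simps)
        moreover have "a' - a \<in> A" "b - b' \<in> B" using p ab assms by (simp_all add: subspace_diff)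
        ultimately have "a' - a \<in> A \<inter> B" by simp
        moreover have "p = (a + (a' - a), b - (a' - a))"
          using p \<open>a' - a = b - b'\<close> by (metis add_diff_cancel_left' diff_add_cancel add.commute diff_diff_eq2)
        ultimately show "p \<in> (\<lambda>t. (a + t, b - t)) ` (A \<inter> B)" by blast
      qed (use ab assms in \<open>auto simp: subspace_add subspace_diff\<close>)
    qed
    then show ?thesis using bij_betw_same_card by force
  qed
  have "card (A \<times> B) = (\<Sum>z\<in>?f ` (A \<times> B). card {p \<in> A \<times> B. ?f p = z})"
    using sum.image_gen[of "A \<times> B" "\<lambda>_. 1 :: nat" ?f] assms by simp
  also have "\<dots> = (\<Sum>z\<in>?f ` (A \<times> B). card (A \<inter> B))" by (intro sum.cong fib refl)
  also have "\<dots> = card (A +s B) * card (A \<inter> B)"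
    using assms by (simp add: ssum_eq)
  finally have "card A * card B = card (A +s B) * card (A \<inter> B)"
    by (simp add: card_cartesian_product)
  then have "qn ^ (dim A + dim B) = qn ^ (dim (A +s B) + dim (A \<inter> B))"
    using assms AB finite_ssum[OF assms] by (simp add: card_eq_power_dim power_add)
  then show ?thesis using qn_gt1 by simp
qed

definition Gr :: "'v set \<Rightarrow> nat \<Rightarrow> 'v set set" where
  "Gr E d = {W. subspace W \<and> W \<subseteq> E \<and> dim W = d}"

definition between :: "'v set \<Rightarrow> 'v set \<Rightarrow> nat \<Rightarrow> 'v set set" where
  "between A B d = {X. subspace X \<and> A \<subseteq> X \<and> X \<subseteq> B \<and> dim X = d}"

lemma finite_Gr: "finite E \<Longrightarrow> finite (Gr E d)"
  by (rule finite_subset[of _ "Pow E"]) (auto simp: Gr_def)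

lemma finite_between: "finite E \<Longrightarrow> finite (between A E d)"
  by (rule finite_subset[of _ "Pow E"]) (auto simp: between_def)

abbreviation qi :: "nat \<Rightarrow> real" where "qi \<equiv> qint (real qn)"

lemma qi_eq: "qi n * (real qn - 1) = real qn ^ n - 1"
  using power_diff_1_eq[of "real qn" n] by (simp add: qint_def mult.commute)

lemma card_diff_real: "finite B \<Longrightarrow> A \<subseteq> B \<Longrightarrow> real (card (B - A)) = real (card B) - real (card A)"
  by (simp add: card_Diff_subset finite_subset card_mono of_nat_diff)

text \<open>Each vector of \<open>B - H\<close> lies in exactly one such \<open>X\<close>, namely
  the span of it and \<open>H\<close>, and each \<open>X\<close> accounts for
  \<open>(q - 1) q^(dim H)\<close> vectors.\<close>

lemma card_up:
  assumes "subspace H" "subspace B" "finite B" "H \<subseteq> B"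
  shows "real (card (between H B (Suc (dim H)))) = qi (dim B - dim H)"
proof -
  let ?N = "between H B (Suc (dim H))"
  have fH: "finite H" using assms finite_subset by blast
  have finN: "finite ?N" using assms by (simp add: finite_between)
  have U: "B - H = (\<Union>X\<in>?N. X - H)"
  proof (intro equalityI subsetI)
    fix v assume v: "v \<in> B - H"
    then have "span (insert v H) \<subseteq> B" using assms by (intro span_minimal) auto
    then have "span (insert v H) \<in> ?N"
      using v assms fH span_superset[of "insert v H"] by (auto simp: between_def dim_span_insert)
    moreover have "v \<in> span (insert v H)" by (simp add: span_base)
    ultimately show "v \<in> (\<Union>X\<in>?N. X - H)" using v by blast
  qed (auto simp: between_def)
  have eqX: "X = span (insert v H)" if "X \<in> ?N" "v \<in> X - H" for X v
  proof -
    have X: "subspace X" "finite X" "dim X = Suc (dim H)" "H \<subseteq> X"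
      using that assms by (auto simp: between_def intro: finite_subset)
    have "span (insert v H) \<subseteq> X" using that X by (intro span_minimal) auto
    then show ?thesis using sub_eq_of_dim[of "span (insert v H)" X] X that assms fH
      by (simp add: dim_span_insert)
  qed
  have "card (B - H) = (\<Sum>X\<in>?N. card (X - H))"
    unfolding U
  proof (rule card_UN_disjoint[OF finN])
    show "\<forall>X\<in>?N. finite (X - H)"
      using assms by (auto simp: between_def intro: finite_subset)
    show "\<forall>X\<in>?N. \<forall>Y\<in>?N. X \<noteq> Y \<longrightarrow> (X - H) \<inter> (Y - H) = {}"
      using eqX by blast
  qed
  then have "real (card (B - H)) = (\<Sum>X\<in>?N. real (card (X - H)))" by simp
  also have "\<dots> = (\<Sum>X\<in>?N. (real qn - 1) * real qn ^ dim H)"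
  proof (intro sum.cong refl)
    fix X assume "X \<in> ?N"
    then have X: "subspace X" "finite X" "dim X = Suc (dim H)" "H \<subseteq> X"
      using assms by (auto simp: between_def intro: finite_subset)
    show "real (card (X - H)) = (real qn - 1) * real qn ^ dim H"
      using X assms fH by (simp add: card_diff_real card_eq_power_dim algebra_simps)
  qed
  finally have "real qn ^ dim B - real qn ^ dim H = real (card ?N) * ((real qn - 1) * real qn ^ dim H)"
    using assms fH by (simp add: card_diff_real card_eq_power_dim)
  moreover have "real qn ^ dim B = real qn ^ (dim B - dim H) * real qn ^ dim H"
    using dim_mono_sub[of H B] assms by (simp flip: power_add)
  ultimately have "(real qn ^ (dim B - dim H) - 1) * real qn ^ dim H
      = (real (card ?N) * (real qn - 1)) * real qn ^ dim H" by (simp add: algebra_simps)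
  then have "real (card ?N) * (real qn - 1) = qi (dim B - dim H) * (real qn - 1)"
    using qn_gt1 by (simp add: qi_eq)
  then show ?thesis using qn_gt1 by simp
qed

text \<open>The condition \<open>H \<noteq> W\<close> matters for \<open>dim W = 0\<close>, where
  the truncated \<open>dim W - 1\<close> would admit \<open>W\<close> itself. Instead of duality the
  proof counts non-incident pairs of a vector and a hyperplane, with induction on the codimension of
  \<open>A\<close>: hyperplanes through \<open>A\<close> and one more vector are covered by the
  hypothesis.\<close>

lemma card_hyperplanes:
  assumes "subspace A" "subspace W" "finite W" "A \<subseteq> W" "dim W = dim A + r"
  shows "real (card {H. H \<in> between A W (dim W - 1) \<and> H \<noteq> W}) = qi r"
  using assms
proof (induction r arbitrary: A)
  case 0
  then have "A = W" by (intro sub_eq_of_dim) auto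
  then have "{H. H \<in> between A W (dim W - 1) \<and> H \<noteq> W} = {}" by (auto simp: between_def)
  then show ?case by (simp only: card.empty) (simp add: qint_def)
next
  case (Suc r)
  let ?Hs = "between A W (dim W - 1)"
  have fA: "finite A" using Suc.prems finite_subset by blast
  have neW: "H \<noteq> W" if "H \<in> ?Hs" for H
    using that Suc.prems by (auto simp: between_def)
  have simpHs: "{H. H \<in> ?Hs \<and> H \<noteq> W} = ?Hs" using neW by blast
  have finHs: "finite ?Hs" using Suc.prems by (simp add: finite_between)
  show ?case
  \<comment> \<open>In codimension 1 the double count below degenerates to \<open>0 = 0\<close>,
    because its coefficient is \<open>Q ^ r - 1\<close>.\<close>
  proof (cases r)
    case 0
    have "?Hs = {A}"
    proof (intro equalityI subsetI)
      fix H assume "H \<in> ?Hs"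
      then have H: "subspace H" "A \<subseteq> H" "H \<subseteq> W" "dim H = dim A" using Suc.prems 0 by (auto simp: between_def)
      moreover have "finite H" using H(3) Suc.prems finite_subset by blast
      ultimately have "A = H" using Suc.prems by (intro sub_eq_of_dim) auto
      then show "H \<in> {A}" by simp
    qed (use Suc.prems 0 in \<open>auto simp: between_def\<close>)
    then show ?thesis using 0 simpHs by (simp add: qint_def)
  next
    case (Suc r')
    have count: "real (card {H \<in> ?Hs. v \<in> H}) = qi r" if v: "v \<in> W - A" for v
    proof -
      let ?A = "span (insert v A)"
      have A': "?A \<subseteq> W" "subspace ?A" "dim ?A = Suc (dim A)"
        using v Suc.prems fA by (simp_all add: dim_span_insert span_minimal)
      have "{H \<in> ?Hs. v \<in> H} = {H. H \<in> between ?A W (dim W - 1) \<and> H \<noteq> W}"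
      proof (intro equalityI subsetI)
        fix H assume "H \<in> {H \<in> ?Hs. v \<in> H}"
        moreover from this have "?A \<subseteq> H" by (intro span_minimal) (auto simp: between_def)
        ultimately show "H \<in> {H. H \<in> between ?A W (dim W - 1) \<and> H \<noteq> W}"
          using neW by (auto simp: between_def)
      next
        fix H assume "H \<in> {H. H \<in> between ?A W (dim W - 1) \<and> H \<noteq> W}"
        then show "H \<in> {H \<in> ?Hs. v \<in> H}"
          using span_superset[of "insert v A"] by (auto simp: between_def)
      qed
      then show ?thesis
        using Suc.IH[of ?A] A' Suc.prems by simp
    qed
    \<comment> \<open>Pairs with \<open>v \<notin> H\<close> are easier than incident ones: since
      \<open>A \<subseteq> H\<close>, the vectors of \<open>W - A\<close> outside \<open>H\<close>
      are exactly \<open>W - H\<close>.\<close>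
    have "(\<Sum>H\<in>?Hs. card {v \<in> W - A. v \<notin> H}) = (\<Sum>v\<in>W - A. card {H \<in> ?Hs. v \<notin> H})"
      by (rule sum_multicount_gen) (use finHs Suc.prems in auto)
    then have "(\<Sum>H\<in>?Hs. real (card {v \<in> W - A. v \<notin> H})) = (\<Sum>v\<in>W - A. real (card {H \<in> ?Hs. v \<notin> H}))"
      by (metis (mono_tags, lifting) of_nat_sum sum.cong)
    also have "(\<Sum>v\<in>W - A. real (card {H \<in> ?Hs. v \<notin> H})) = (\<Sum>v\<in>W - A. real (card ?Hs) - qi r)"
    proof (intro sum.cong refl)
      fix v assume v: "v \<in> W - A"
      have "{H \<in> ?Hs. v \<notin> H} = ?Hs - {H \<in> ?Hs. v \<in> H}" by auto
      then show "real (card {H \<in> ?Hs. v \<notin> H}) = real (card ?Hs) - qi r"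
        using card_diff_real[OF finHs, of "{H \<in> ?Hs. v \<in> H}"] count[OF v] by simp
    qed
    also have "(\<Sum>H\<in>?Hs. real (card {v \<in> W - A. v \<notin> H})) = (\<Sum>H\<in>?Hs. real qn ^ dim W - real qn ^ (dim W - 1))"
    proof (intro sum.cong refl)
      fix H assume "H \<in> ?Hs"
      then have H: "subspace H" "A \<subseteq> H" "H \<subseteq> W" "dim H = dim W - 1" "finite H"
        using Suc.prems by (auto simp: between_def intro: finite_subset)
      then have "{v \<in> W - A. v \<notin> H} = W - H" by auto
      then show "real (card {v \<in> W - A. v \<notin> H}) = real qn ^ dim W - real qn ^ (dim W - 1)"
        using H Suc.prems by (simp add: card_diff_real card_eq_power_dim)
    qed
    finally have eq: "real (card ?Hs) * (real qn ^ dim W - real qn ^ (dim W - 1))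
        = (real qn ^ dim W - real qn ^ dim A) * (real (card ?Hs) - qi r)"
      using Suc.prems fA by (simp add: card_diff_real card_eq_power_dim)
    define h a Q where "h = real (card ?Hs)" and "a = real qn ^ dim A" and "Q = real qn"
    have Q: "Q > 1" "a > 0" using qn_gt1 by (auto simp: Q_def a_def)
    have "real qn ^ dim W = a * Q * Q ^ r" "real qn ^ (dim W - 1) = a * Q ^ r"
      using Suc.prems by (simp_all add: a_def Q_def power_add)
    with eq have "a * (h * (Q * Q ^ r - Q ^ r)) = a * ((Q * Q ^ r - 1) * (h - qi r))"
      unfolding h_def[symmetric] a_def[symmetric] by (simp add: algebra_simps)
    then have "h * (Q * Q ^ r - Q ^ r) = (Q * Q ^ r - 1) * (h - qi r)" using Q by simp
    then have "h * (Q ^ r - 1) = (Q * Q ^ r - 1) * qi r" by (simp add: algebra_simps)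
    also have "Q * Q ^ r - 1 = qi (Suc r) * (Q - 1)" by (simp add: Q_def qi_eq)
    also have "qi (Suc r) * (Q - 1) * qi r = qi (Suc r) * (Q ^ r - 1)"
      unfolding Q_def qi_eq[of r, symmetric] by (simp only: mult_ac)
    finally have "h * (Q ^ r - 1) = qi (Suc r) * (Q ^ r - 1)" .
    moreover have "Q ^ r - 1 \<noteq> 0" using Q Suc one_less_power[of Q r] by simp
    ultimately have "h = qi (Suc r)" by simp
    then show ?thesis unfolding simpHs h_def .
  qed
qed

end

section \<open>The Grassmann graph and its Laplacian\<close>

context finite_field_space
begin

text \<open>Written with \<open>Suc\<close> rather than a truncated \<open>dim W - 1\<close>, so
  that the zero space has no hyperplanes; \<open>nbr\<close> likewise gives it no
  neighbours.\<close>

definition hyps :: "'v set \<Rightarrow> 'v set set" where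
  "hyps W = {H. subspace H \<and> H \<subseteq> W \<and> Suc (dim H) = dim W}"

definition nbr :: "'v set \<Rightarrow> 'v set \<Rightarrow> 'v set set" where
  "nbr E U = {U' \<in> Gr E (dim U). Suc (dim (U \<inter> U')) = dim U}"

lemma finite_hyps: "finite W \<Longrightarrow> finite (hyps W)"
  by (rule finite_subset[of _ "Pow W"]) (auto simp: hyps_def)

lemma finite_nbr: "finite E \<Longrightarrow> finite (nbr E U)"
  by (simp add: nbr_def finite_Gr)

lemma card_hyps:
  assumes "subspace A" "subspace W" "finite W" "A \<subseteq> W"
  shows "real (card {H \<in> hyps W. A \<subseteq> H}) = qi (dim W - dim A)"
proof -
  have le: "dim A \<le> dim W" using assms by (simp add: dim_mono_sub)
  have "{H \<in> hyps W. A \<subseteq> H} = {H. H \<in> between A W (dim W - 1) \<and> H \<noteq> W}"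
  proof (intro equalityI subsetI)
    fix H assume "H \<in> {H. H \<in> between A W (dim W - 1) \<and> H \<noteq> W}"
    then have H: "subspace H" "A \<subseteq> H" "H \<subseteq> W" "dim H = dim W - 1" "H \<noteq> W"
      by (auto simp: between_def)
    have "dim W \<noteq> 0"
      using H sub_eq_of_dim[of H W] assms by auto
    then show "H \<in> {H \<in> hyps W. A \<subseteq> H}" using H by (simp add: hyps_def)
  qed (auto simp: hyps_def between_def)
  then show ?thesis using card_hyperplanes[of A W "dim W - dim A"] assms le by simp
qed

lemma dim_zero_space [simp]: "dim {0} = 0"
  using dim_eq_iff_card[of "{0}" 0] by simp

lemma card_all_hyps:
  assumes "subspace W" "finite W"
  shows "real (card (hyps W)) = qi (dim W)"
proof -
  have "{H \<in> hyps W. {0} \<subseteq> H} = hyps W" by (auto simp: hyps_def subspace_0)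
  moreover have "real (card {H \<in> hyps W. {0} \<subseteq> H}) = qi (dim W - dim {0})"
    using assms by (intro card_hyps) (simp_all add: subspace_0)
  ultimately show ?thesis by simp
qed

lemma sum_if_const:
  fixes a b :: real
  assumes "finite S"
  shows "(\<Sum>x\<in>S. if P x then a else b)
    = real (card {x \<in> S. P x}) * a + (real (card S) - real (card {x \<in> S. P x})) * b"
proof -
  have "S \<inter> - {x. P x} = S - {x \<in> S. P x}" "S \<inter> {x. P x} = {x \<in> S. P x}" by auto
  then show ?thesis using assms card_diff_real[OF assms, of "{x \<in> S. P x}"]
    by (simp add: sum.If_cases)
qed

lemma qi_0 [simp]: "qi 0 = 0" by (simp add: qint_def)

lemma qi_1 [simp]: "qi (Suc 0) = 1" by (simp add: qint_def)

lemma qi_pos: "0 < n \<Longrightarrow> 0 < qi n"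
  unfolding qint_def using qn_gt1 by (intro sum_pos) auto

lemma qi_add: "qi (a + b) = qi a + real qn ^ a * qi b"
proof -
  have "(qi a + real qn ^ a * qi b) * (real qn - 1)
      = qi a * (real qn - 1) + real qn ^ a * (qi b * (real qn - 1))" by (simp only: distrib_right mult.assoc)
  also have "\<dots> = qi (a + b) * (real qn - 1)" unfolding qi_eq by (simp add: power_add right_diff_distrib)
  finally show ?thesis using qn_gt1 by simp
qed

text \<open>By the dimension formula, the step from \<open>H\<close> to \<open>U\<close> enlarges
  either the intersection with \<open>W\<close> or the sum with \<open>W\<close>, never
  both.\<close>

lemma dim_Int_step:
  assumes "subspace H" "subspace U" "subspace W" "finite U" "finite W" "H \<subseteq> U" "dim U = Suc (dim H)"
  shows "dim (U \<inter> W) = (if U \<subseteq> H +s W then Suc (dim (H \<inter> W)) else dim (H \<inter> W))"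
proof (cases "U \<subseteq> H +s W")
  case True
  have fH: "finite H" using assms finite_subset by blast
  have "U +s W = H +s W"
  proof (rule equalityI)
    show "U +s W \<subseteq> H +s W" by (rule ssum_least[OF True ssum_upper(2) subspace_ssum])
    have "H \<subseteq> U +s W" using assms(6) ssum_upper(1)[of U W] by (rule subset_trans)
    then show "H +s W \<subseteq> U +s W" by (rule ssum_least[OF _ ssum_upper(2) subspace_ssum])
  qed
  then show ?thesis
    using dim_ssum[of U W] dim_ssum[of H W] True assms fH by simp
next
  case False
  have fH: "finite H" using assms finite_subset by blast
  have "U \<inter> W \<subseteq> H"
  proof
    fix x assume x: "x \<in> U \<inter> W"
    show "x \<in> H"
    proof (rule ccontr)
      assume nx: "x \<notin> H"
      have "span (insert x H) \<subseteq> U" using x assms by (intro span_minimal) auto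
      then have "span (insert x H) = U"
        using sub_eq_of_dim[of "span (insert x H)" U] assms nx fH by (simp add: dim_span_insert)
      moreover have "span (insert x H) \<subseteq> H +s W"
        using x ssum_upper[of H W] ssum_upper[of W H] by (intro span_minimal) auto
      ultimately show False using False by simp
    qed
  qed
  then have "U \<inter> W = H \<inter> W" using assms by blast
  then show ?thesis using False by simp
qed

text \<open>A neighbour \<open>U'\<close> arises from exactly one hyperplane,
  \<open>H = U \<inter> U'\<close>. Neighbours can therefore be enumerated by a step down to
  \<open>H\<close> and a step up from \<open>H\<close>.\<close>

lemma nbr_sum:
  fixes f :: "'v set \<Rightarrow> real"
  assumes "subspace U" "U \<subseteq> E" "finite E"
  shows "(\<Sum>U'\<in>nbr E U. f U') = (\<Sum>H\<in>hyps U. \<Sum>U'\<in>between H E (dim U) - {U}. f U')"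
proof -
  have fU: "finite U" using assms finite_subset by blast
  have key: "H = U \<inter> U'" if "H \<in> hyps U" "U' \<in> between H E (dim U) - {U}" for H U'
  proof -
    have H: "subspace H" "H \<subseteq> U" "Suc (dim H) = dim U" "subspace U'" "H \<subseteq> U'" "dim U' = dim U" "U' \<noteq> U"
      "finite U'"
      using that assms by (auto simp: hyps_def between_def intro: finite_subset)
    have s: "subspace (U \<inter> U')" using H assms by (simp add: subspace_inter)
    have "dim (U \<inter> U') \<noteq> dim U"
    proof
      assume e: "dim (U \<inter> U') = dim U"
      have "U \<inter> U' = U" by (rule sub_eq_of_dim[OF s assms(1) fU]) (simp_all add: e)
      moreover have "U \<inter> U' = U'" by (rule sub_eq_of_dim[OF s H(4,8)]) (simp_all add: e H(6))
      ultimately show False using H(7) by blast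
    qed
    moreover have "dim (U \<inter> U') \<le> dim U" using dim_mono_sub[OF s assms(1) fU] by simp
    ultimately have "dim (U \<inter> U') \<le> dim H" using H(3) by simp
    then show ?thesis using H(2,5) fU by (intro sub_eq_of_dim[OF H(1) s]) auto
  qed
  have "nbr E U = (\<Union>H\<in>hyps U. between H E (dim U) - {U})"
  proof (intro equalityI subsetI)
    fix U' assume "U' \<in> nbr E U"
    then have U': "subspace U'" "U' \<subseteq> E" "dim U' = dim U" "Suc (dim (U \<inter> U')) = dim U"
      by (auto simp: nbr_def Gr_def)
    then have "U' \<in> between (U \<inter> U') E (dim U) - {U}" "U \<inter> U' \<in> hyps U"
      using assms by (auto simp: between_def hyps_def subspace_inter)
    then show "U' \<in> (\<Union>H\<in>hyps U. between H E (dim U) - {U})" by blast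
  next
    fix U' assume "U' \<in> (\<Union>H\<in>hyps U. between H E (dim U) - {U})"
    then obtain H where H: "H \<in> hyps U" "U' \<in> between H E (dim U) - {U}" by blast
    have "U \<inter> U' = H" using key[OF H] by (rule sym)
    then show "U' \<in> nbr E U" using H unfolding nbr_def Gr_def hyps_def between_def by simp
  qed
  moreover have "\<forall>H\<in>hyps U. \<forall>H'\<in>hyps U. H \<noteq> H' \<longrightarrow>
      (between H E (dim U) - {U}) \<inter> (between H' E (dim U) - {U}) = {}"
  proof (intro ballI impI equals0I)
    fix H H' U' assume HH: "H \<in> hyps U" "H' \<in> hyps U" "H \<noteq> H'"
      and "U' \<in> (between H E (dim U) - {U}) \<inter> (between H' E (dim U) - {U})"
    then have U': "U' \<in> between H E (dim U) - {U}" "U' \<in> between H' E (dim U) - {U}" by blast+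
    show False using HH(3) trans[OF key[OF HH(1) U'(1)] sym[OF key[OF HH(2) U'(2)]]] by contradiction
  qed
  moreover have "\<forall>H\<in>hyps U. finite (between H E (dim U) - {U})"
    using assms by (simp add: finite_between)
  ultimately show ?thesis
    by (simp only: sum.UNION_disjoint[OF finite_hyps[OF fU]])
qed

lemma card_nbr:
  assumes "subspace U" "U \<subseteq> E" "finite E" "subspace E"
  shows "real (card (nbr E U)) = qi (dim U) * (qi (Suc (dim E - dim U)) - 1)"
proof -
  have fU: "finite U" using assms finite_subset by blast
  have "real (card (nbr E U)) = (\<Sum>H\<in>hyps U. \<Sum>U'\<in>between H E (dim U) - {U}. 1)"
    using nbr_sum[of U E "\<lambda>_. 1"] assms by simp
  also have "\<dots> = (\<Sum>H\<in>hyps U. qi (Suc (dim E - dim U)) - 1)"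
  proof (intro sum.cong refl)
    fix H assume "H \<in> hyps U"
    then have H: "subspace H" "H \<subseteq> U" "Suc (dim H) = dim U" by (auto simp: hyps_def)
    have "U \<in> between H E (dim U)" using H assms by (auto simp: between_def)
    moreover have "Suc (dim E - dim U) = dim E - dim H"
      using H dim_mono_sub[of U E] assms by simp
    ultimately show "(\<Sum>U'\<in>between H E (dim U) - {U}. 1) = qi (Suc (dim E - dim U)) - 1"
      using card_diff_real[of "between H E (dim U)" "{U}"] card_up[of H E] H assms
      by (auto simp: finite_between)
  qed
  also have "\<dots> = qi (dim U) * (qi (Suc (dim E - dim U)) - 1)"
    by (simp add: card_all_hyps[OF assms(1) fU])
  finally show ?thesis .
qed

text \<open>The step down decides the direction. If \<open>H\<close> contains
  \<open>U \<inter> W\<close>, the intersection can afterwards only grow or return to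
  \<open>j\<close> (contribution \<open>A\<close>); otherwise it has already dropped to
  \<open>j - 1\<close> and can only stay there or return (contribution \<open>B\<close>). For
  \<open>j = 0\<close> the truncated \<open>j - 1\<close> is multiplied by
  \<open>qi 0 = 0\<close>.\<close>

lemma laplacian_dim_Int:
  fixes f :: "nat \<Rightarrow> real"
  assumes E: "subspace E" "finite E" and U: "subspace U" "U \<subseteq> E" and W: "subspace W" "W \<subseteq> E"
    and d: "dim U = d" and m: "dim W = m" and j: "dim (U \<inter> W) = j"
  shows "(\<Sum>U'\<in>nbr E U. f (dim (U' \<inter> W)) - f j)
    = qi (d - j) * qi (m - j) * (f (Suc j) - f j)
      + real qn ^ Suc (d - j + (m - j)) * qi j * qi (dim E + j - (d + m)) * (f (j - 1) - f j)"
proof -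
  have fin: "finite U" "finite W" using assms finite_subset by blast+
  have UW: "subspace (U \<inter> W)" "finite (U \<inter> W)" using U W fin by (auto simp: subspace_inter)
  have jd: "j \<le> d" and jm: "j \<le> m" using d m j UW fin U W dim_mono_sub[of "U \<inter> W"] by auto
  have dE: "d \<le> dim E" using d U E dim_mono_sub by blast
  have dmj: "d + m \<le> dim E + j"
  proof -
    have "dim (U +s W) \<le> dim E" using U W E by (intro dim_mono_sub ssum_least) auto
    then show ?thesis using dim_ssum[of U W] U W fin d m j by simp
  qed
  define A where "A = qi (m - j) * (f (Suc j) - f j)"
  define B where "B = (qi (Suc (dim E - d)) - qi (Suc (m - j))) * (f (j - 1) - f j)"
  have inner: "(\<Sum>U'\<in>between H E d - {U}. f (dim (U' \<inter> W)) - f j) = (if U \<inter> W \<subseteq> H then A else B)"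
    if "H \<in> hyps U" for H
  proof -
    have H: "subspace H" "H \<subseteq> U" "Suc (dim H) = d" "finite H"
      using that d fin by (auto simp: hyps_def intro: finite_subset)
    have HW: "subspace (H \<inter> W)" "finite (H \<inter> W)" using H W by (auto simp: subspace_inter)
    define i where "i = dim (H \<inter> W)"
    have step: "dim (U' \<inter> W) = (if U' \<subseteq> H +s W then Suc i else i)" if "U' \<in> between H E d" for U'
    proof -
      have "subspace U'" "H \<subseteq> U'" "dim U' = Suc (dim H)" "finite U'"
        using that H E by (auto simp: between_def intro: finite_subset)
      then show ?thesis unfolding i_def using dim_Int_step[of H U' W] H(1) W(1) fin(2) by blast
    qed
    have Ub: "U \<in> between H E d" using H U d by (auto simp: between_def)
    have sub: "between H (H +s W) d = {U' \<in> between H E d. U' \<subseteq> H +s W}"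
    proof -
      have "H +s W \<subseteq> E" using H U W E by (intro ssum_least) auto
      then show ?thesis by (auto simp: between_def)
    qed
    have "(\<Sum>U'\<in>between H E d - {U}. f (dim (U' \<inter> W)) - f j)
        = (\<Sum>U'\<in>between H E d. f (dim (U' \<inter> W)) - f j)"
      using Ub j E by (simp add: sum.remove finite_between)
    also have "\<dots> = (\<Sum>U'\<in>between H E d. if U' \<subseteq> H +s W then f (Suc i) - f j else f i - f j)"
      by (intro sum.cong refl) (auto simp: step)
    also have "\<dots> = real (card (between H (H +s W) d)) * (f (Suc i) - f j)
        + (real (card (between H E d)) - real (card (between H (H +s W) d))) * (f i - f j)"
      unfolding sub by (rule sum_if_const[OF finite_between[OF E(2)]])
    also have "real (card (between H E d)) = qi (Suc (dim E - d))"
    proof -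
      have "dim E - dim H = Suc (dim E - d)" using H dE by linarith
      then show ?thesis using card_up[of H E] H U E by simp
    qed
    also have "real (card (between H (H +s W) d)) = qi (m - i)"
    proof -
      have "dim (H +s W) + i = dim H + m" using dim_ssum[of H W] H W fin m i_def by simp
      then have "dim (H +s W) - dim H = m - i" by simp
      then show ?thesis using card_up[of H "H +s W"] H W fin ssum_upper[of H W] by (simp add: finite_ssum)
    qed
    finally have eq: "(\<Sum>U'\<in>between H E d - {U}. f (dim (U' \<inter> W)) - f j)
      = qi (m - i) * (f (Suc i) - f j) + (qi (Suc (dim E - d)) - qi (m - i)) * (f i - f j)" .
    show ?thesis
    proof (cases "U \<inter> W \<subseteq> H")
      case True
      then have "H \<inter> W = U \<inter> W" using H by blast
      then have "i = j" using i_def j by simp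
      then show ?thesis using eq True by (simp add: A_def)
    next
      case False
      have "i \<noteq> j"
      proof
        assume "i = j"
        then have "H \<inter> W = U \<inter> W"
          using H HW UW i_def j by (intro sub_eq_of_dim) auto
        then show False using False by blast
      qed
      then have "j = Suc i" using step[OF Ub] j by (simp split: if_splits)
      then show ?thesis using eq False jm by (simp add: B_def Suc_diff_Suc)
    qed
  qed
  have fh: "finite (hyps U)" using fin by (simp add: finite_hyps)
  have cardA: "real (card {H \<in> hyps U. U \<inter> W \<subseteq> H}) = qi (d - j)"
    using card_hyps[of "U \<inter> W" U] UW U fin d j by simp
  have cardAll: "real (card (hyps U)) = qi d"
    using card_all_hyps[OF U(1) fin(1)] d by simp
  have "(\<Sum>U'\<in>nbr E U. f (dim (U' \<inter> W)) - f j) = (\<Sum>H\<in>hyps U. if U \<inter> W \<subseteq> H then A else B)"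
    unfolding nbr_sum[OF U E(2)] d by (intro sum.cong refl inner)
  also have "\<dots> = qi (d - j) * A + (qi d - qi (d - j)) * B"
    using fh cardA cardAll by (simp add: sum_if_const)
  also have "qi d - qi (d - j) = real qn ^ (d - j) * qi j"
    using qi_add[of "d - j" j] jd by simp
  also have "B = real qn ^ Suc (m - j) * qi (dim E + j - (d + m)) * (f (j - 1) - f j)"
    using qi_add[of "Suc (m - j)" "dim E + j - (d + m)"] dmj jm dE by (simp add: B_def)
  finally show ?thesis by (simp only: A_def power_add power_Suc mult.assoc mult.left_commute)
qed

end

section \<open>The general linear group\<close>

lemma bij_betw_extend_finite:
  assumes "finite B" "finite B'" "A \<subseteq> B" "A' \<subseteq> B'" "card B = card B'" "bij_betw f A A'"
  obtains h where "bij_betw h B B'" "\<And>x. x \<in> A \<Longrightarrow> h x = f x"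
proof -
  have fin: "finite A" "finite A'" using assms(1-4) finite_subset by blast+
  have "card (B - A) = card (B' - A')"
    using assms(3-5) bij_betw_same_card[OF assms(6)] fin by (simp add: card_Diff_subset)
  then obtain g where g: "bij_betw g (B - A) (B' - A')"
    using finite_same_card_bij assms(1,2) by (metis finite_Diff)
  have "bij_betw (\<lambda>x. if x \<in> A then f x else g x) (A \<union> (B - A)) (A' \<union> (B' - A'))"
    by (rule bij_betw_disjoint_Un[OF assms(6) g]) auto
  moreover have "A \<union> (B - A) = B" "A' \<union> (B' - A') = B'" using assms(3,4) by auto
  ultimately show ?thesis using that[of "\<lambda>x. if x \<in> A then f x else g x"] by simp
qed

context finite_field_space
begin

text \<open>Being the identity outside \<open>E\<close> makes every element a permutation of the
  whole type, so \<open>inv\<close> and the image laws apply directly, and it keeps the group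
  finite.\<close>

definition GL :: "'v set \<Rightarrow> ('v \<Rightarrow> 'v) set" where
  "GL E = {g. bij_betw g E E
     \<and> (\<forall>u\<in>E. \<forall>w\<in>E. g (u + w) = g u + g w)
     \<and> (\<forall>c. \<forall>u\<in>E. g (c *s u) = c *s g u)
     \<and> (\<forall>v. v \<notin> E \<longrightarrow> g v = v)}"

lemma GL_bij: "g \<in> GL E \<Longrightarrow> bij g"
proof -
  assume g: "g \<in> GL E"
  have "bij_betw (\<lambda>x. if x \<in> E then g x else x) (E \<union> - E) (E \<union> - E)"
    by (rule bij_betw_disjoint_Un) (use g in \<open>auto simp: GL_def bij_betw_def\<close>)
  moreover have "(\<lambda>x. if x \<in> E then g x else x) = g" using g by (auto simp: GL_def)
  ultimately show ?thesis by simp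
qed

lemma GL_comp:
  assumes "g \<in> GL E" "h \<in> GL E"
  shows "g \<circ> h \<in> GL E"
proof -
  have g: "bij_betw g E E" "\<And>u w. u \<in> E \<Longrightarrow> w \<in> E \<Longrightarrow> g (u + w) = g u + g w"
    "\<And>c u. u \<in> E \<Longrightarrow> g (c *s u) = c *s g u" "\<And>v. v \<notin> E \<Longrightarrow> g v = v"
    using assms(1) by (auto simp: GL_def)
  have h: "bij_betw h E E" "\<And>u w. u \<in> E \<Longrightarrow> w \<in> E \<Longrightarrow> h (u + w) = h u + h w"
    "\<And>c u. u \<in> E \<Longrightarrow> h (c *s u) = c *s h u" "\<And>v. v \<notin> E \<Longrightarrow> h v = v"
    using assms(2) by (auto simp: GL_def)
  have hE: "\<And>u. u \<in> E \<Longrightarrow> h u \<in> E" using h(1) bij_betw_apply by metis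
  show ?thesis unfolding GL_def using bij_betw_trans[OF h(1) g(1)] g h hE by simp
qed

lemma GL_inv:
  assumes "subspace E" "g \<in> GL E"
  shows "inv g \<in> GL E"
proof -
  have g: "bij_betw g E E" "\<And>u w. u \<in> E \<Longrightarrow> w \<in> E \<Longrightarrow> g (u + w) = g u + g w"
    "\<And>c u. u \<in> E \<Longrightarrow> g (c *s u) = c *s g u" "\<And>v. v \<notin> E \<Longrightarrow> g v = v"
    using assms(2) by (auto simp: GL_def)
  have b: "bij g" using assms by (rule_tac GL_bij)
  have gi: "g (inv g x) = x" "inv g (g x) = x" for x
    using b by (simp_all add: bij_is_surj surj_f_inv_f bij_is_inj)
  have gE: "g x \<in> E \<longleftrightarrow> x \<in> E" for x
    using g(1,4) bij_betw_apply by metis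
  have iE: "inv g x \<in> E \<longleftrightarrow> x \<in> E" for x using gE[of "inv g x"] gi by simp
  have "bij_betw (inv g) E E"
    by (rule bij_betw_byWitness[of _ g]) (use gi gE iE in auto)
  moreover have "inv g (u + w) = inv g u + inv g w" if "u \<in> E" "w \<in> E" for u w
  proof -
    have "g (inv g u + inv g w) = u + w" using that iE g(2) gi by simp
    then show ?thesis using gi(2) by metis
  qed
  moreover have "inv g (c *s u) = c *s inv g u" if "u \<in> E" for u c
  proof -
    have "g (c *s inv g u) = c *s u" using that iE g(3) gi by simp
    then show ?thesis using gi(2) by metis
  qed
  moreover have "inv g v = v" if "v \<notin> E" for v using g(4)[OF that] gi(2) by metis
  ultimately show ?thesis by (simp add: GL_def)
qed

lemma finite_GL: "finite E \<Longrightarrow> finite (GL E)"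
proof -
  assume E: "finite E"
  have "inj_on (\<lambda>g. restrict g E) (GL E)"
  proof (rule inj_onI)
    fix g h assume gh: "g \<in> GL E" "h \<in> GL E" "restrict g E = restrict h E"
    show "g = h"
    proof
      fix v show "g v = h v"
      proof (cases "v \<in> E")
        case True
        then show ?thesis using fun_cong[OF gh(3), of v] by simp
      next
        case False
        then show ?thesis using gh(1,2) by (simp add: GL_def)
      qed
    qed
  qed
  moreover have "(\<lambda>g. restrict g E) ` GL E \<subseteq> E \<rightarrow>\<^sub>E E"
    by (auto simp: GL_def bij_betw_def)
  ultimately show ?thesis using E by (meson finite_PiE finite_imageD finite_subset)
qed

lemma id_GL: "id \<in> GL E"
  by (simp add: GL_def)

lemma GL_image_Int: "g \<in> GL E \<Longrightarrow> g ` (A \<inter> B) = g ` A \<inter> g ` B"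
  using GL_bij by (intro image_Int) (auto simp: bij_is_inj)

lemma GL_image_subspace:
  assumes "g \<in> GL E" "subspace U" "U \<subseteq> E" "subspace E" "finite E"
  shows "subspace (g ` U)" "g ` U \<subseteq> E" "dim (g ` U) = dim U"
proof -
  have g: "bij_betw g E E" "\<And>u w. u \<in> E \<Longrightarrow> w \<in> E \<Longrightarrow> g (u + w) = g u + g w"
    "\<And>c u. u \<in> E \<Longrightarrow> g (c *s u) = c *s g u"
    using assms(1) by (auto simp: GL_def)
  have "g (0 *s 0) = 0 *s g 0" using assms by (intro g(3) subspace_0)
  then have "g 0 = 0" by simp
  then have "0 \<in> g ` U" using assms(2) subspace_0 by (metis imageI)
  moreover have "g u + g w \<in> g ` U" if "u \<in> U" "w \<in> U" for u w
    using that assms g(2)[of u w, symmetric] subspace_add[OF assms(2)] by auto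
  moreover have "c *s g u \<in> g ` U" if "u \<in> U" for u c
    using that assms g(3)[of u c, symmetric] subspace_scale[OF assms(2)] by auto
  ultimately show sub: "subspace (g ` U)" by (auto intro!: subspaceI)
  show "g ` U \<subseteq> E" using assms g(1) by (auto simp: bij_betw_def)
  have fU: "finite U" using assms(3,5) finite_subset by blast
  have "card (g ` U) = card U"
    using g(1) assms(3) by (intro card_image) (auto simp: bij_betw_def intro: inj_on_subset)
  then have "card (g ` U) = qn ^ dim U" using card_eq_power_dim[OF assms(2) fU] by simp
  then show "dim (g ` U) = dim U" using dim_eq_iff_card[OF sub] fU by blast
qed

lemma GL_Gr_iff:
  assumes "g \<in> GL E" "subspace E" "finite E" "U \<in> Gr E d"
  shows "g ` U \<in> Gr E d"
  using GL_image_subspace[OF assms(1) _ _ assms(2,3)] assms(4) by (auto simp: Gr_def)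

lemma GL_bij_Gr:
  assumes "g \<in> GL E" "subspace E" "finite E"
  shows "bij_betw ((`) g) (Gr E d) (Gr E d)"
proof (rule bij_betw_byWitness[of _ "(`) (inv g)"])
  have b: "bij g" using assms by (rule_tac GL_bij)
  have inv: "inv g \<in> GL E" using GL_inv assms by blast
  show "\<forall>U\<in>Gr E d. inv g ` g ` U = U" using b by (simp add: image_inv_f_f bij_is_inj)
  show "\<forall>U\<in>Gr E d. g ` inv g ` U = U" using b by (simp add: image_f_inv_f bij_is_surj)
  show "(`) g ` Gr E d \<subseteq> Gr E d" using GL_Gr_iff[OF assms] by blast
  show "(`) (inv g) ` Gr E d \<subseteq> Gr E d" using GL_Gr_iff[OF inv assms(2,3)] by blast
qed

lemma independent_if_dim_eq_card:
  assumes "finite S" "dim S = card S"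
  shows "independent S"
proof -
  obtain T where T: "T \<subseteq> S" "independent T" "S \<subseteq> span T"
    using maximal_independent_subset by blast
  have "card T = dim S" by (rule basis_card_eq_dim[OF T(1,3,2)])
  then have "T = S" using assms T(1) by (intro card_subset_eq) auto
  then show ?thesis using T(2) by simp
qed

lemma basis_extend:
  assumes "independent S" "S \<subseteq> W" "subspace W" "finite W"
  obtains B where "S \<subseteq> B" "B \<subseteq> W" "independent B" "span B = W" "finite B" "card B = dim W"
proof -
  obtain B where B: "S \<subseteq> B" "B \<subseteq> W" "independent B" "W \<subseteq> span B"
    using maximal_independent_subset_extend[OF assms(2,1)] by blast
  have "span B = W" by (rule span_subspace[OF B(2,4) assms(3)])
  moreover have "finite B" using B(2) assms(4) finite_subset by blast
  moreover have "card B = dim W" by (rule basis_card_eq_dim[OF B(2,4,3)])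
  ultimately show ?thesis using that B by blast
qed

text \<open>Bases of \<open>A\<close> and \<open>B\<close> that extend a common basis of
  \<open>A \<inter> B\<close> have an independent union, because its size
  \<open>dim A + dim B - dim (A \<inter> B)\<close> is the dimension of the sum that it
  spans.\<close>

lemma pair_basis:
  assumes A: "subspace A" "A \<subseteq> E" and B: "subspace B" "B \<subseteq> E" and E: "subspace E" "finite E"
  obtains C0 CA CB CE where
    "finite CE" "independent CE" "span CE = E" "card CE = dim E"
    "CA \<subseteq> CE" "span CA = A" "card CA = dim A" "CB \<subseteq> CE" "span CB = B" "card CB = dim B"
    "C0 = CA \<inter> CB" "card C0 = dim (A \<inter> B)"
proof -
  have fin: "finite A" "finite B" using A B E finite_subset by blast+
  have AB: "subspace (A \<inter> B)" "finite (A \<inter> B)" using A B fin by (simp_all add: subspace_inter)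
  obtain C0 where C0: "C0 \<subseteq> A \<inter> B" "independent C0" "span C0 = A \<inter> B" "finite C0" "card C0 = dim (A \<inter> B)"
    using finite_subspace_basis[OF AB] by blast
  obtain CA where CA: "C0 \<subseteq> CA" "CA \<subseteq> A" "independent CA" "span CA = A" "finite CA" "card CA = dim A"
    using basis_extend[OF C0(2) _ A(1) fin(1)] C0(1) by blast
  obtain CB where CB: "C0 \<subseteq> CB" "CB \<subseteq> B" "independent CB" "span CB = B" "finite CB" "card CB = dim B"
    using basis_extend[OF C0(2) _ B(1) fin(2)] C0(1) by blast
  \<comment> \<open>An independent set inside \<open>span C0\<close> has at most
    \<open>card C0\<close> elements, so the two extensions share nothing beyond
    \<open>C0\<close>.\<close>
  have "independent (CA \<inter> CB)" using CA(3) independent_mono by blast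
  then have "card (CA \<inter> CB) \<le> card C0"
    using independent_span_bound[OF C0(4), of "CA \<inter> CB"] C0(3) CA(2) CB(2) by blast
  then have C0eq: "C0 = CA \<inter> CB"
    using CA(1,5) CB(1) by (intro card_seteq) auto
  have "card (CA \<union> CB) + card C0 = dim A + dim B"
    using card_Un_Int[OF CA(5) CB(5)] C0eq CA(6) CB(6) by simp
  then have "card (CA \<union> CB) = dim (A +s B)"
    using dim_ssum[OF A(1) B(1) fin] C0(5) by simp
  moreover have "A +s B = span (CA \<union> CB)"
  proof (rule equalityI)
    show "A +s B \<subseteq> span (CA \<union> CB)"
      using span_mono[of CA "CA \<union> CB"] span_mono[of CB "CA \<union> CB"] CA(4) CB(4)
      by (intro ssum_least) auto
    show "span (CA \<union> CB) \<subseteq> A +s B"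
      unfolding ssum_def using CA(2) CB(2) by (intro span_mono) auto
  qed
  ultimately have "independent (CA \<union> CB)"
    using CA(5) CB(5) by (intro independent_if_dim_eq_card) (auto simp: dim_span)
  moreover have "CA \<union> CB \<subseteq> E" using CA(2) CB(2) A B by blast
  ultimately obtain CE where "CA \<union> CB \<subseteq> CE" "independent CE" "span CE = E" "finite CE" "card CE = dim E"
    using basis_extend[OF _ _ E] by metis
  then show ?thesis using that CA(4,6) CB(4,6) C0eq C0(5) by blast
qed

text \<open>The linear extension \<open>h\<close> lives on the whole vector space; it maps the
  finite \<open>E\<close> onto itself, hence injectively, and is then replaced by the identity
  outside \<open>E\<close>.\<close>

lemma GL_of_bases:
  assumes E: "subspace E" "finite E"
    and B: "independent B" "span B = E" and B': "span B' = E" and f: "bij_betw f B B'"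
  obtains g where "g \<in> GL E" "\<And>S. S \<subseteq> B \<Longrightarrow> g ` span S = span (f ` S)"
proof -
  interpret p: vector_space_pair scale scale by unfold_locales
  obtain h where h: "Vector_Spaces.linear scale scale h" "\<forall>x\<in>B. h x = f x"
    using p.linear_independent_extend[OF B(1)] by blast
  interpret h: Vector_Spaces.linear scale scale h by (rule h(1))
  have img: "h ` span S = span (f ` S)" if "S \<subseteq> B" for S
  proof -
    have "h ` S = f ` S" using that h(2) by (intro image_cong) auto
    then show ?thesis using h.span_image[of S] by simp
  qed
  have hE: "h ` E = E" using img[of B] B B' f by (simp add: bij_betw_def)
  then have "inj_on h E" using E by (intro eq_card_imp_inj_on) simp_all
  then have bij: "bij_betw h E E" using hE by (simp add: bij_betw_def)
  define g where "g = (\<lambda>v. if v \<in> E then h v else v)"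
  have "bij_betw g E E" using bij by (simp add: g_def cong: bij_betw_cong)
  then have "g \<in> GL E"
    unfolding GL_def using E by (auto simp: g_def h.add h.scale subspace_add subspace_scale)
  moreover have "g ` span S = span (f ` S)" if "S \<subseteq> B" for S
  proof -
    have "span S \<subseteq> E" using span_mono[OF that] B by simp
    then have "g ` span S = h ` span S" by (intro image_cong) (auto simp: g_def)
    then show ?thesis using img[OF that] by simp
  qed
  ultimately show ?thesis using that by blast
qed

text \<open>The three dimensions, together with \<open>dim E\<close>, fix the sizes of all blocks of
  the adapted bases. A bijection respecting the blocks is built on \<open>C0\<close>, then on the
  rest of \<open>CA\<close>, of \<open>CB\<close> and of \<open>CE\<close>, and extended
  linearly.\<close>

lemma GL_transitive_pairs:
  assumes E: "subspace E" "finite E"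
    and A: "subspace A" "A \<subseteq> E" and B: "subspace B" "B \<subseteq> E"
    and A': "subspace A'" "A' \<subseteq> E" and B': "subspace B'" "B' \<subseteq> E"
    and d: "dim A = dim A'" "dim B = dim B'" "dim (A \<inter> B) = dim (A' \<inter> B')"
  obtains g where "g \<in> GL E" "g ` A = A'" "g ` B = B'"
proof -
  obtain C0 CA CB CE where C:
    "finite CE" "independent CE" "span CE = E" "card CE = dim E"
    "CA \<subseteq> CE" "span CA = A" "card CA = dim A" "CB \<subseteq> CE" "span CB = B" "card CB = dim B"
    "C0 = CA \<inter> CB" "card C0 = dim (A \<inter> B)"
    using pair_basis[OF A B E] by metis
  obtain C0' CA' CB' CE' where C':
    "finite CE'" "independent CE'" "span CE' = E" "card CE' = dim E"
    "CA' \<subseteq> CE'" "span CA' = A'" "card CA' = dim A'" "CB' \<subseteq> CE'" "span CB' = B'" "card CB' = dim B'"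
    "C0' = CA' \<inter> CB'" "card C0' = dim (A' \<inter> B')"
    using pair_basis[OF A' B' E] by metis
  have fin: "finite CA" "finite CB" "finite CA'" "finite CB'"
    using C(1,5,8) C'(1,5,8) finite_subset by blast+
  have fin0: "finite C0" "finite C0'" using fin C(11) C'(11) by simp_all
  have sub0: "C0 \<subseteq> CA" "C0 \<subseteq> CB" "C0' \<subseteq> CA'" "C0' \<subseteq> CB'" using C(11) C'(11) by auto
  have "card C0 = card C0'" using C(12) C'(12) d(3) by simp
  then obtain f0 where f0: "bij_betw f0 C0 C0'" using finite_same_card_bij[OF fin0] by blast
  have "card CA = card CA'" using C(7) C'(7) d(1) by simp
  then obtain fA where fA: "bij_betw fA CA CA'" "\<And>x. x \<in> C0 \<Longrightarrow> fA x = f0 x"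
    using bij_betw_extend_finite[OF fin(1,3) sub0(1,3) _ f0] by metis
  have cB: "card (CB - C0) = card (CB' - C0')"
    using C(10,12) C'(10,12) d sub0 fin0 by (simp add: card_Diff_subset)
  then obtain fB where fB: "bij_betw fB (CB - C0) (CB' - C0')"
    using finite_same_card_bij fin by (metis finite_Diff)
  define f1 where "f1 = (\<lambda>x. if x \<in> CA then fA x else fB x)"
  have f1: "bij_betw f1 (CA \<union> (CB - C0)) (CA' \<union> (CB' - C0'))"
    unfolding f1_def by (rule bij_betw_disjoint_Un[OF fA(1) fB]) (use C(11) C'(11) in auto)
  have un: "CA \<union> (CB - C0) \<subseteq> CE" "CA' \<union> (CB' - C0') \<subseteq> CE'" using C(5,8) C'(5,8) by auto
  have "card CE = card CE'" using C(4) C'(4) by simp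
  then obtain f where f: "bij_betw f CE CE'" "\<And>x. x \<in> CA \<union> (CB - C0) \<Longrightarrow> f x = f1 x"
    using bij_betw_extend_finite[OF C(1) C'(1) un _ f1] by metis
  have fCA: "f ` CA = CA'"
  proof -
    have "f ` CA = fA ` CA" using f(2) by (intro image_cong) (auto simp: f1_def)
    then show ?thesis using fA(1) by (simp add: bij_betw_def)
  qed
  have fCB: "f ` CB = CB'"
  proof -
    have "f ` C0 = f0 ` C0" using f(2) fA(2) sub0(1) by (intro image_cong) (auto simp: f1_def)
    moreover have "f ` (CB - C0) = fB ` (CB - C0)" using f(2) C(11) by (intro image_cong) (auto simp: f1_def)
    moreover have "CB = C0 \<union> (CB - C0)" "CB' = C0' \<union> (CB' - C0')" using sub0 by auto
    ultimately show ?thesis using f0 fB by (metis bij_betw_def image_Un)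
  qed
  obtain g where g: "g \<in> GL E" "\<And>S. S \<subseteq> CE \<Longrightarrow> g ` span S = span (f ` S)"
    using GL_of_bases[OF E C(2,3) C'(3) f(1)] by metis
  have "g ` A = A'" using g(2)[OF C(5)] fCA C(6) C'(6) by simp
  moreover have "g ` B = B'" using g(2)[OF C(8)] fCB C(9) C'(9) by simp
  ultimately show ?thesis using that g(1) by blast
qed

end

section \<open>Kernels of permutation characters under the Laplacian\<close>

context finite_field_space
begin

definition transporters :: "'v set \<Rightarrow> 'v set \<Rightarrow> 'v set \<Rightarrow> 'v set \<Rightarrow> 'v set \<Rightarrow> real" where
  "transporters E U W U' W' = real (card {g \<in> GL E. g ` U' = U \<and> g ` W' = W})"

definition fixed_count :: "'v set \<Rightarrow> nat \<Rightarrow> ('v \<Rightarrow> 'v) \<Rightarrow> real" where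
  "fixed_count E d g = real (card {U \<in> Gr E d. g ` U = U})"

text \<open>A twisted permutation character: the trace, on functions on \<open>Gr E d\<close>, of
  \<open>g\<close> combined with the adjacency operator of the Grassmann graph.\<close>

definition moved_count :: "'v set \<Rightarrow> nat \<Rightarrow> ('v \<Rightarrow> 'v) \<Rightarrow> real" where
  "moved_count E d g = real (card {U \<in> Gr E d. g ` U \<in> nbr E U})"

text \<open>For \<open>c\<close> the character, this is up to scale the matrix entry of the
  projector between the basis tensors of \<open>W\<close> and \<open>W'\<close>.\<close>

definition kern :: "'v set \<Rightarrow> (('v \<Rightarrow> 'v) \<Rightarrow> real) \<Rightarrow> 'v set \<Rightarrow> 'v set \<Rightarrow> real" where
  "kern E c W W' = (\<Sum>g | g \<in> GL E \<and> g ` W' = W. c g)"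

context
  fixes E :: "'v set"
  assumes E: "subspace E" "finite E"
begin

lemma GrD: "U \<in> Gr E d \<Longrightarrow> subspace U" "U \<in> Gr E d \<Longrightarrow> U \<subseteq> E" "U \<in> Gr E d \<Longrightarrow> dim U = d"
  by (auto simp: Gr_def)

lemma finGr [simp]: "finite (Gr E d)" using E by (simp add: finite_Gr)

lemma finnbr [simp]: "finite (nbr E d)" using E by (simp add: finite_nbr)

lemma finGL [simp]: "finite (GL E)" using E by (simp add: finite_GL)

lemma nbr_Gr: "U \<in> Gr E d \<Longrightarrow> U' \<in> nbr E U \<Longrightarrow> U' \<in> Gr E d"
  by (auto simp: nbr_def Gr_def)

lemma transporters_left:
  assumes "h \<in> GL E"
  shows "transporters E (h ` U) (h ` W) U' W' = transporters E U W U' W'"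
proof -
  have b: "bij h" using assms by (rule GL_bij)
  have i: "inv h \<in> GL E" using GL_inv[OF E(1)] assms by blast
  have hi: "inv h (h v) = v" "h (inv h v) = v" for v
    using b by (simp_all add: bij_is_inj bij_is_surj surj_f_inv_f)
  have hh: "inv h ` h ` X = X" for X by (simp add: image_image hi)
  have "bij_betw (\<lambda>g. h \<circ> g) {g \<in> GL E. g ` U' = U \<and> g ` W' = W} {g \<in> GL E. g ` U' = h ` U \<and> g ` W' = h ` W}"
  proof (rule bij_betw_byWitness[of _ "\<lambda>g. inv h \<circ> g"])
    show "\<forall>g\<in>{g \<in> GL E. g ` U' = U \<and> g ` W' = W}. inv h \<circ> (h \<circ> g) = g"
      by (simp add: fun_eq_iff hi)
    show "\<forall>g\<in>{g \<in> GL E. g ` U' = h ` U \<and> g ` W' = h ` W}. h \<circ> (inv h \<circ> g) = g"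
      by (simp add: fun_eq_iff hi)
    show "(\<circ>) h ` {g \<in> GL E. g ` U' = U \<and> g ` W' = W} \<subseteq> {g \<in> GL E. g ` U' = h ` U \<and> g ` W' = h ` W}"
    proof (rule image_subsetI)
      fix g assume "g \<in> {g \<in> GL E. g ` U' = U \<and> g ` W' = W}"
      then have g: "g \<in> GL E" "g ` U' = U" "g ` W' = W" by simp_all
      show "h \<circ> g \<in> {g \<in> GL E. g ` U' = h ` U \<and> g ` W' = h ` W}"
        unfolding mem_Collect_eq image_comp[symmetric] g(2,3) hh using GL_comp[OF assms g(1)] by simp
    qed
    show "(\<circ>) (inv h) ` {g \<in> GL E. g ` U' = h ` U \<and> g ` W' = h ` W} \<subseteq> {g \<in> GL E. g ` U' = U \<and> g ` W' = W}"
    proof (rule image_subsetI)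
      fix g assume "g \<in> {g \<in> GL E. g ` U' = h ` U \<and> g ` W' = h ` W}"
      then have g: "g \<in> GL E" "g ` U' = h ` U" "g ` W' = h ` W" by simp_all
      show "inv h \<circ> g \<in> {g \<in> GL E. g ` U' = U \<and> g ` W' = W}"
        unfolding mem_Collect_eq image_comp[symmetric] g(2,3) hh using GL_comp[OF i g(1)] by simp
    qed
  qed
  from bij_betw_same_card[OF this] show ?thesis unfolding transporters_def by (simp only:)
qed

lemma transporters_right:
  assumes "h \<in> GL E"
  shows "transporters E U W (h ` U') (h ` W') = transporters E U W U' W'"
proof -
  have b: "bij h" using assms by (rule GL_bij)
  have i: "inv h \<in> GL E" using GL_inv[OF E(1)] assms by blast
  have hi: "inv h (h v) = v" "h (inv h v) = v" for v
    using b by (simp_all add: bij_is_inj bij_is_surj surj_f_inv_f)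
  have hh: "inv h ` h ` X = X" for X by (simp add: image_image hi)
  have "bij_betw (\<lambda>g. g \<circ> h) {g \<in> GL E. g ` h ` U' = U \<and> g ` h ` W' = W} {g \<in> GL E. g ` U' = U \<and> g ` W' = W}"
  proof (rule bij_betw_byWitness[of _ "\<lambda>g. g \<circ> inv h"])
    show "\<forall>g\<in>{g \<in> GL E. g ` h ` U' = U \<and> g ` h ` W' = W}. g \<circ> h \<circ> inv h = g"
      by (simp add: fun_eq_iff hi)
    show "\<forall>g\<in>{g \<in> GL E. g ` U' = U \<and> g ` W' = W}. g \<circ> inv h \<circ> h = g"
      by (simp add: fun_eq_iff hi)
    show "(\<lambda>g. g \<circ> h) ` {g \<in> GL E. g ` h ` U' = U \<and> g ` h ` W' = W} \<subseteq> {g \<in> GL E. g ` U' = U \<and> g ` W' = W}"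
    proof (rule image_subsetI)
      fix g assume "g \<in> {g \<in> GL E. g ` h ` U' = U \<and> g ` h ` W' = W}"
      then have g: "g \<in> GL E" "g ` h ` U' = U" "g ` h ` W' = W" by simp_all
      show "g \<circ> h \<in> {g \<in> GL E. g ` U' = U \<and> g ` W' = W}"
        unfolding mem_Collect_eq image_comp[symmetric] g(2,3) hh using GL_comp[OF g(1) assms] by simp
    qed
    show "(\<lambda>g. g \<circ> inv h) ` {g \<in> GL E. g ` U' = U \<and> g ` W' = W} \<subseteq> {g \<in> GL E. g ` h ` U' = U \<and> g ` h ` W' = W}"
    proof (rule image_subsetI)
      fix g assume "g \<in> {g \<in> GL E. g ` U' = U \<and> g ` W' = W}"
      then have g: "g \<in> GL E" "g ` U' = U" "g ` W' = W" by simp_all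
      show "g \<circ> inv h \<in> {g \<in> GL E. g ` h ` U' = U \<and> g ` h ` W' = W}"
        unfolding mem_Collect_eq image_comp[symmetric] g(2,3) hh using GL_comp[OF g(1) i] by simp
    qed
  qed
  from bij_betw_same_card[OF this] show ?thesis unfolding transporters_def by (simp only:)
qed

text \<open>Pairs with equal intersection dimension lie in one orbit, so the description by
  \<open>THE\<close> is well defined; at dimensions that do not occur, \<open>f\<close> has an
  unspecified value.\<close>

lemma invariant_function_of_dim:
  fixes F :: "'v set \<Rightarrow> 'v set \<Rightarrow> real"
  assumes "\<And>h U W. h \<in> GL E \<Longrightarrow> U \<in> Gr E d \<Longrightarrow> W \<in> Gr E m \<Longrightarrow> F (h ` U) (h ` W) = F U W"
  obtains f where "\<And>U W. U \<in> Gr E d \<Longrightarrow> W \<in> Gr E m \<Longrightarrow> F U W = f (dim (U \<inter> W))"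
proof -
  define f where "f = (\<lambda>j. THE y. \<exists>U\<in>Gr E d. \<exists>W\<in>Gr E m. dim (U \<inter> W) = j \<and> y = F U W)"
  have "F U W = f (dim (U \<inter> W))" if UW: "U \<in> Gr E d" "W \<in> Gr E m" for U W
  proof -
    have "f (dim (U \<inter> W)) = F U W"
      unfolding f_def
    proof (rule the_equality)
      show "\<exists>U'\<in>Gr E d. \<exists>W'\<in>Gr E m. dim (U' \<inter> W') = dim (U \<inter> W) \<and> F U W = F U' W'"
        using UW by blast
      fix y assume "\<exists>U'\<in>Gr E d. \<exists>W'\<in>Gr E m. dim (U' \<inter> W') = dim (U \<inter> W) \<and> y = F U' W'"
      then obtain U' W' where U': "U' \<in> Gr E d" "W' \<in> Gr E m" "dim (U' \<inter> W') = dim (U \<inter> W)" "y = F U' W'"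
        by blast
      obtain h where "h \<in> GL E" "h ` U = U'" "h ` W = W'"
        using GL_transitive_pairs[OF E GrD(1,2)[OF UW(1)] GrD(1,2)[OF UW(2)] GrD(1,2)[OF U'(1)] GrD(1,2)[OF U'(2)]]
          GrD(3) UW U' by metis
      then show "y = F U W" using assms[of h U W] UW U'(4) by simp
    qed
    then show ?thesis by simp
  qed
  then show ?thesis using that by blast
qed

text \<open>The coefficients in \<open>laplacian_dim_Int\<close> are symmetric in \<open>(U, d)\<close> and \<open>(W, m)\<close>.\<close>

lemma laplacian_swap:
  fixes F :: "'v set \<Rightarrow> 'v set \<Rightarrow> real"
  assumes inv: "\<And>h U W. h \<in> GL E \<Longrightarrow> U \<in> Gr E d \<Longrightarrow> W \<in> Gr E m \<Longrightarrow> F (h ` U) (h ` W) = F U W"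
    and U: "U \<in> Gr E d" and W: "W \<in> Gr E m"
  shows "(\<Sum>U'\<in>nbr E U. F U' W - F U W) = (\<Sum>W'\<in>nbr E W. F U W' - F U W)"
proof -
  obtain f where f: "\<And>U W. U \<in> Gr E d \<Longrightarrow> W \<in> Gr E m \<Longrightarrow> F U W = f (dim (U \<inter> W))"
    using invariant_function_of_dim[of d m F] inv by blast
  define j where "j = dim (U \<inter> W)"
  have j': "dim (W \<inter> U) = j" by (simp add: j_def Int_commute)
  have "(\<Sum>U'\<in>nbr E U. F U' W - F U W) = (\<Sum>U'\<in>nbr E U. f (dim (U' \<inter> W)) - f j)"
    using f nbr_Gr[OF U] U W by (intro sum.cong refl) (simp add: j_def)
  also have "\<dots> = (\<Sum>W'\<in>nbr E W. f (dim (W' \<inter> U)) - f j)"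
    unfolding laplacian_dim_Int[OF E GrD(1,2)[OF U] GrD(1,2)[OF W] GrD(3)[OF U] GrD(3)[OF W] j_def[symmetric]]
      laplacian_dim_Int[OF E GrD(1,2)[OF W] GrD(1,2)[OF U] GrD(3)[OF W] GrD(3)[OF U] j']
    by (simp add: add.commute mult.commute)
  also have "\<dots> = (\<Sum>W'\<in>nbr E W. F U W' - F U W)"
    using f nbr_Gr[OF W] U W by (intro sum.cong refl) (simp add: j_def Int_commute)
  finally show ?thesis .
qed

text \<open>Double counting of pairs of a group element and a fixed subspace. It exposes
  \<open>W\<close> as a target next to the target \<open>U\<close>, which is the form required by
  \<open>laplacian_swap\<close>.\<close>

lemma kern_fixed_count:
  "kern E (fixed_count E d) W W' = (\<Sum>U\<in>Gr E d. transporters E U W U W')"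
proof -
  let ?S = "{g \<in> GL E. g ` W' = W}"
  have "kern E (fixed_count E d) W W' = real (\<Sum>g\<in>?S. card {U \<in> Gr E d. g ` U = U})"
    by (simp add: kern_def fixed_count_def)
  also have "(\<Sum>g\<in>?S. card {U \<in> Gr E d. g ` U = U}) = (\<Sum>U\<in>Gr E d. card {g \<in> ?S. g ` U = U})"
    by (rule sum_multicount_gen) auto
  finally show ?thesis by (simp add: transporters_def conj_ac)
qed

lemma kern_moved_count:
  "kern E (moved_count E d) W W' = (\<Sum>U\<in>Gr E d. \<Sum>U'\<in>nbr E U. transporters E U' W U W')"
proof -
  let ?S = "{g \<in> GL E. g ` W' = W}"
  have "kern E (moved_count E d) W W' = real (\<Sum>g\<in>?S. card {U \<in> Gr E d. g ` U \<in> nbr E U})"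
    by (simp add: kern_def moved_count_def)
  also have "(\<Sum>g\<in>?S. card {U \<in> Gr E d. g ` U \<in> nbr E U}) = (\<Sum>U\<in>Gr E d. card {g \<in> ?S. g ` U \<in> nbr E U})"
    by (rule sum_multicount_gen) auto
  also have "\<dots> = (\<Sum>U\<in>Gr E d. \<Sum>U'\<in>nbr E U. card {g \<in> ?S. g ` U = U'})"
  proof (intro sum.cong refl)
    fix U
    have eq: "{g \<in> ?S. g ` U \<in> nbr E U} = (\<Union>U'\<in>nbr E U. {g \<in> ?S. g ` U = U'})" by auto
    show "card {g \<in> ?S. g ` U \<in> nbr E U} = (\<Sum>U'\<in>nbr E U. card {g \<in> ?S. g ` U = U'})"
      unfolding eq by (rule card_UN_disjoint) auto
  qed
  finally show ?thesis by (simp add: transporters_def conj_ac)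
qed

text \<open>In \<open>transporters E U W U W'\<close> the source pair \<open>(U, W')\<close> is
  frozen, and \<open>laplacian_swap\<close> is applied to the target pair alone. Moving the target
  \<open>U\<close> to a neighbour \<open>U'\<close> while the source remains \<open>U\<close> yields
  the moved count; the subtracted term is the degree of the graph.\<close>

lemma laplacian_kern_fixed_count:
  assumes W: "W \<in> Gr E m"
  shows "(\<Sum>W''\<in>nbr E W. kern E (fixed_count E d) W'' W' - kern E (fixed_count E d) W W')
    = kern E (moved_count E d) W W'
      - qi d * (qi (Suc (dim E - d)) - 1) * kern E (fixed_count E d) W W'"
proof -
  have "(\<Sum>W''\<in>nbr E W. kern E (fixed_count E d) W'' W' - kern E (fixed_count E d) W W')
      = (\<Sum>W''\<in>nbr E W. \<Sum>U\<in>Gr E d. transporters E U W'' U W' - transporters E U W U W')"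
    by (simp add: kern_fixed_count sum_subtractf)
  also have "\<dots> = (\<Sum>U\<in>Gr E d. \<Sum>W''\<in>nbr E W. transporters E U W'' U W' - transporters E U W U W')"
    by (rule sum.swap)
  also have "\<dots> = (\<Sum>U\<in>Gr E d. \<Sum>U'\<in>nbr E U. transporters E U' W U W' - transporters E U W U W')"
  proof (rule sum.cong[OF refl])
    fix U assume U: "U \<in> Gr E d"
    show "(\<Sum>W''\<in>nbr E W. transporters E U W'' U W' - transporters E U W U W')
      = (\<Sum>U'\<in>nbr E U. transporters E U' W U W' - transporters E U W U W')"
      using laplacian_swap[of d m "\<lambda>A B. transporters E A B U W'", OF _ U W] transporters_left by simp
  qed
  also have "\<dots> = (\<Sum>U\<in>Gr E d. (\<Sum>U'\<in>nbr E U. transporters E U' W U W')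
      - qi d * (qi (Suc (dim E - d)) - 1) * transporters E U W U W')"
  proof (intro sum.cong refl)
    fix U assume U: "U \<in> Gr E d"
    have "real (card (nbr E U)) = qi d * (qi (Suc (dim E - d)) - 1)"
      using card_nbr[OF GrD(1,2)[OF U] E(2,1)] GrD(3)[OF U] by simp
    then show "(\<Sum>U'\<in>nbr E U. transporters E U' W U W' - transporters E U W U W')
      = (\<Sum>U'\<in>nbr E U. transporters E U' W U W') - qi d * (qi (Suc (dim E - d)) - 1) * transporters E U W U W'"
      by (simp add: sum_subtractf)
  qed
  also have "\<dots> = kern E (moved_count E d) W W'
      - qi d * (qi (Suc (dim E - d)) - 1) * kern E (fixed_count E d) W W'"
    by (simp add: sum_subtractf kern_fixed_count kern_moved_count sum_distrib_left)
  finally show ?thesis .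
qed

text \<open>Two distinct subspaces of dimension \<open>d + 1\<close> can share a
  \<open>d\<close>-subspace only if it is their intersection, which is precisely adjacency.\<close>

lemma card_common_hyperplanes:
  assumes "U \<in> Gr E (Suc d)" "V \<in> Gr E (Suc d)"
  shows "real (card {H \<in> Gr E d. H \<subseteq> U \<and> H \<subseteq> V})
    = (if V \<in> nbr E U then 1 else 0) + (if V = U then qi (Suc d) else 0)"
proof -
  note U = GrD(1)[OF assms(1)] GrD(2)[OF assms(1)] GrD(3)[OF assms(1)]
  note V = GrD(1)[OF assms(2)] GrD(2)[OF assms(2)] GrD(3)[OF assms(2)]
  note fU = finite_subset[OF U(2) E(2)] finite_subset[OF V(2) E(2)]
  have UV: "subspace (U \<inter> V)" "finite (U \<inter> V)"
    using subspace_inter[OF U(1) V(1)] fU(1) by simp_all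
  consider "V = U" | "V \<noteq> U" "V \<in> nbr E U" | "V \<noteq> U" "V \<notin> nbr E U" by blast
  then show ?thesis
  proof cases
    case 1
    have "{H \<in> Gr E d. H \<subseteq> U \<and> H \<subseteq> V} = hyps U"
      unfolding 1 Gr_def hyps_def U(3) using U(2) by auto
    moreover have "V \<notin> nbr E U" using 1 by (simp add: nbr_def)
    ultimately show ?thesis using card_all_hyps[OF U(1) fU(1)] U(3) 1 by simp
  next
    case 2
    then have i: "dim (U \<inter> V) = d" using U(3) by (simp add: nbr_def)
    have "{H \<in> Gr E d. H \<subseteq> U \<and> H \<subseteq> V} = {U \<inter> V}"
    proof (intro equalityI subsetI)
      fix H assume "H \<in> {H \<in> Gr E d. H \<subseteq> U \<and> H \<subseteq> V}"
      then have H: "subspace H" "dim H = d" "H \<subseteq> U \<inter> V" by (auto simp: Gr_def)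
      have "H = U \<inter> V" by (rule sub_eq_of_dim[OF H(1) UV H(3)]) (simp add: i H(2))
      then show "H \<in> {U \<inter> V}" by simp
    next
      fix H assume "H \<in> {U \<inter> V}"
      then show "H \<in> {H \<in> Gr E d. H \<subseteq> U \<and> H \<subseteq> V}" using UV i U(2) by (auto simp: Gr_def)
    qed
    then show ?thesis using 2 by simp
  next
    case 3
    have "{H \<in> Gr E d. H \<subseteq> U \<and> H \<subseteq> V} = {}"
    proof (rule ccontr)
      assume "{H \<in> Gr E d. H \<subseteq> U \<and> H \<subseteq> V} \<noteq> {}"
      then obtain H where H: "subspace H" "dim H = d" "H \<subseteq> U \<inter> V" by (auto simp: Gr_def)
      have "d \<le> dim (U \<inter> V)" using dim_mono_sub[OF H(1) UV H(3)] H(2) by simp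
      moreover have "dim (U \<inter> V) \<noteq> Suc d"
      proof
        assume e: "dim (U \<inter> V) = Suc d"
        have "U \<inter> V = U" by (rule sub_eq_of_dim[OF UV(1) U(1) fU(1)]) (simp_all add: e U(3))
        moreover have "U \<inter> V = V" by (rule sub_eq_of_dim[OF UV(1) V(1) fU(2)]) (simp_all add: e V(3))
        ultimately show False using 3(1) by blast
      qed
      moreover have "dim (U \<inter> V) \<le> Suc d" using dim_mono_sub[OF UV(1) U(1) fU(1)] U(3) by simp
      ultimately have "Suc (dim (U \<inter> V)) = Suc d" by linarith
      then show False using 3(2) assms(2) U(3) by (simp add: nbr_def)
    qed
    then show ?thesis using 3 by simp
  qed
qed

text \<open>Dual to the common hyperplanes: for distinct \<open>H\<close> and \<open>K\<close> the
  only candidate is their sum, which has dimension \<open>d + 1\<close> exactly when they are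
  adjacent.\<close>

lemma card_common_extensions:
  assumes "H \<in> Gr E d" "K \<in> Gr E d"
  shows "real (card {U \<in> Gr E (Suc d). H \<subseteq> U \<and> K \<subseteq> U})
    = (if K \<in> nbr E H then 1 else 0) + (if K = H then qi (dim E - d) else 0)"
proof -
  note H = GrD(1)[OF assms(1)] GrD(2)[OF assms(1)] GrD(3)[OF assms(1)]
  note K = GrD(1)[OF assms(2)] GrD(2)[OF assms(2)] GrD(3)[OF assms(2)]
  note fin = finite_subset[OF H(2) E(2)] finite_subset[OF K(2) E(2)]
  have HK: "H +s K \<subseteq> E" by (rule ssum_least[OF H(2) K(2) E(1)])
  have ds: "dim (H +s K) + dim (H \<inter> K) = d + d" using dim_ssum[OF H(1) K(1) fin] H(3) K(3) by simp
  note HKi = subspace_inter[OF H(1) K(1)]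
  consider "K = H" | "K \<noteq> H" "K \<in> nbr E H" | "K \<noteq> H" "K \<notin> nbr E H" by blast
  then show ?thesis
  proof cases
    case 1
    have "{U \<in> Gr E (Suc d). H \<subseteq> U \<and> K \<subseteq> U} = between H E (Suc d)"
      unfolding 1 Gr_def between_def by auto
    moreover have "K \<notin> nbr E H" using 1 by (simp add: nbr_def)
    ultimately show ?thesis using card_up[OF H(1) E H(2)] H(3) 1 by simp
  next
    case 2
    then have "Suc (dim (H \<inter> K)) = d" using H(3) by (simp add: nbr_def)
    with ds have i: "dim (H +s K) = Suc d" by simp
    have "{U \<in> Gr E (Suc d). H \<subseteq> U \<and> K \<subseteq> U} = {H +s K}"
    proof (intro equalityI subsetI)
      fix U assume U: "U \<in> {U \<in> Gr E (Suc d). H \<subseteq> U \<and> K \<subseteq> U}"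
      then have U': "subspace U" "dim U = Suc d" "finite U" "H +s K \<subseteq> U"
        using finite_subset[OF _ E(2)] by (auto simp: Gr_def dest: ssum_least[THEN subsetD])
      have "H +s K = U" by (rule sub_eq_of_dim[OF subspace_ssum U'(1,3,4)]) (simp add: i U'(2))
      then show "U \<in> {H +s K}" by simp
    next
      fix U assume "U \<in> {H +s K}"
      then show "U \<in> {U \<in> Gr E (Suc d). H \<subseteq> U \<and> K \<subseteq> U}"
        using HK i ssum_upper[of H K] ssum_upper[of K H] by (simp add: Gr_def ssum_upper)
    qed
    then show ?thesis using 2 by simp
  next
    case 3
    have "{U \<in> Gr E (Suc d). H \<subseteq> U \<and> K \<subseteq> U} = {}"
    proof (rule ccontr)
      assume "{U \<in> Gr E (Suc d). H \<subseteq> U \<and> K \<subseteq> U} \<noteq> {}"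
      then obtain U where U: "subspace U" "dim U = Suc d" "U \<subseteq> E" "H \<subseteq> U" "K \<subseteq> U" by (auto simp: Gr_def)
      have fU: "finite U" using U(3) E(2) finite_subset by blast
      have "dim (H +s K) \<le> Suc d"
        using dim_mono_sub[OF subspace_ssum U(1) fU ssum_least[OF U(4,5,1)]] U(2) by simp
      moreover have "dim (H \<inter> K) \<noteq> d"
      proof
        assume e: "dim (H \<inter> K) = d"
        have "H \<inter> K = H" by (rule sub_eq_of_dim[OF HKi H(1) fin(1)]) (simp_all add: e H(3))
        moreover have "H \<inter> K = K" by (rule sub_eq_of_dim[OF HKi K(1) fin(2)]) (simp_all add: e K(3))
        ultimately show False using 3(1) by blast
      qed
      moreover have "dim (H \<inter> K) \<le> d" using dim_mono_sub[OF HKi H(1) fin(1)] H(3) by simp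
      ultimately have "Suc (dim (H \<inter> K)) = d" using ds by linarith
      then show False using 3(2) assms(2) H(3) by (simp add: nbr_def)
    qed
    then show ?thesis using 3 by simp
  qed
qed

text \<open>Both sides count the pairs \<open>K \<subseteq> U\<close> with \<open>g K \<subseteq> U\<close>, the left one through \<open>H = g K \<subseteq> U \<inter> g U\<close>.\<close>

lemma level_relation:
  assumes g: "g \<in> GL E"
  shows "moved_count E (Suc d) g + qi (Suc d) * fixed_count E (Suc d) g
    = moved_count E d g + qi (dim E - d) * fixed_count E d g"
proof -
  have inj: "inj g" using GL_bij[OF g] by (rule bij_is_inj)
  have gGr: "g ` U \<in> Gr E a" if "U \<in> Gr E a" for U a by (rule GL_Gr_iff[OF g E that])
  have cnt: "(\<Sum>U\<in>Gr E a. (if g ` U \<in> nbr E U then 1 else 0) + (if g ` U = U then c else 0))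
      = moved_count E a g + c * fixed_count E a g" for a and c :: real
    by (simp add: sum.distrib sum_if_const moved_count_def fixed_count_def)
  have "moved_count E (Suc d) g + qi (Suc d) * fixed_count E (Suc d) g
      = (\<Sum>U\<in>Gr E (Suc d). real (card {H \<in> Gr E d. H \<subseteq> U \<and> H \<subseteq> g ` U}))"
    unfolding cnt[symmetric] by (intro sum.cong refl) (simp add: card_common_hyperplanes gGr)
  also have "\<dots> = (\<Sum>U\<in>Gr E (Suc d). real (card {K \<in> Gr E d. K \<subseteq> U \<and> g ` K \<subseteq> U}))"
  proof (intro sum.cong refl arg_cong[where f = real])
    fix U assume "U \<in> Gr E (Suc d)"
    have eq: "{H \<in> Gr E d. H \<subseteq> U \<and> H \<subseteq> g ` U} = (`) g ` {K \<in> Gr E d. K \<subseteq> U \<and> g ` K \<subseteq> U}"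
    proof (intro equalityI subsetI)
      fix H assume H: "H \<in> {H \<in> Gr E d. H \<subseteq> U \<and> H \<subseteq> g ` U}"
      then have "H \<in> (`) g ` Gr E d"
        using bij_betw_imp_surj_on[OF GL_bij_Gr[OF g E, of d]] by simp
      then obtain K where K: "K \<in> Gr E d" "H = g ` K" by (rule imageE) simp
      then have "K \<subseteq> U" using H inj by (simp add: inj_image_subset_iff)
      then have "K \<in> {K \<in> Gr E d. K \<subseteq> U \<and> g ` K \<subseteq> U}" using K H by simp
      then show "H \<in> (`) g ` {K \<in> Gr E d. K \<subseteq> U \<and> g ` K \<subseteq> U}"
        unfolding K(2) by (rule imageI)
    next
      fix H assume "H \<in> (`) g ` {K \<in> Gr E d. K \<subseteq> U \<and> g ` K \<subseteq> U}"
      then obtain K where K: "K \<in> Gr E d" "K \<subseteq> U" "g ` K \<subseteq> U" "H = g ` K" by blast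
      show "H \<in> {H \<in> Gr E d. H \<subseteq> U \<and> H \<subseteq> g ` U}"
        using K gGr[OF K(1)] image_mono[OF K(2), of g] by simp
    qed
    show "card {H \<in> Gr E d. H \<subseteq> U \<and> H \<subseteq> g ` U} = card {K \<in> Gr E d. K \<subseteq> U \<and> g ` K \<subseteq> U}"
      unfolding eq by (rule card_image) (rule inj_onI, simp add: inj_image_eq_iff[OF inj])
  qed
  also have "\<dots> = real (\<Sum>U\<in>Gr E (Suc d). card {K \<in> Gr E d. K \<subseteq> U \<and> g ` K \<subseteq> U})" by simp
  also have "(\<Sum>U\<in>Gr E (Suc d). card {K \<in> Gr E d. K \<subseteq> U \<and> g ` K \<subseteq> U})
      = (\<Sum>K\<in>Gr E d. card {U \<in> Gr E (Suc d). K \<subseteq> U \<and> g ` K \<subseteq> U})"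
    by (rule sum_multicount_gen) auto
  also have "real \<dots> = (\<Sum>K\<in>Gr E d. real (card {U \<in> Gr E (Suc d). K \<subseteq> U \<and> g ` K \<subseteq> U}))" by simp
  also have "\<dots> = moved_count E d g + qi (dim E - d) * fixed_count E d g"
    unfolding cnt[symmetric] by (intro sum.cong refl) (simp add: card_common_extensions gGr)
  finally show ?thesis .
qed

definition chi_count :: "nat \<Rightarrow> ('v \<Rightarrow> 'v) \<Rightarrow> real" where
  "chi_count x g = (if x = 0 then fixed_count E 0 g else fixed_count E x g - fixed_count E (x - 1) g)"

lemma kern_diff: "kern E (\<lambda>g. a g - b g) W W' = kern E a W W' - kern E b W W'"
  by (simp add: kern_def sum_subtractf)

text \<open>At a single level the moved count remains in the Laplacian. Subtracting levels
  \<open>x - 1\<close> and \<open>x\<close> removes both moved counts by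
  \<open>level_relation\<close>, and since \<open>1 + q [d] = [d + 1]\<close>, what is left is a
  multiple of the difference of the two kernels.\<close>

lemma laplacian_kern_chi:
  assumes W: "W \<in> Gr E m" and x: "x \<le> dim E"
  shows "(\<Sum>W''\<in>nbr E W. kern E (chi_count x) W'' W' - kern E (chi_count x) W W')
    = - qi x * qi (Suc (dim E - x)) * kern E (chi_count x) W W'"
proof (cases x)
  case 0
  have m0: "moved_count E 0 g = 0" for g
  proof -
    have "{U \<in> Gr E 0. g ` U \<in> nbr E U} = {}" by (auto simp: nbr_def Gr_def)
    then show ?thesis unfolding moved_count_def by (simp only: card.empty of_nat_0)
  qed
  have chi0: "chi_count 0 = fixed_count E 0" by (rule ext) (simp add: chi_count_def)
  have kern0: "kern E (moved_count E 0) W W' = 0" by (simp add: kern_def m0)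
  show ?thesis
    unfolding 0 chi0 laplacian_kern_fixed_count[OF W] kern0 qi_0 by simp
next
  case (Suc d)
  have chi: "chi_count x = (\<lambda>g. fixed_count E (Suc d) g - fixed_count E d g)"
    by (simp add: chi_count_def Suc fun_eq_iff)
  define A B where "A = kern E (fixed_count E (Suc d)) W W'" and "B = kern E (fixed_count E d) W W'"
  have lev: "kern E (moved_count E (Suc d)) W W' + qi (Suc d) * A
      = kern E (moved_count E d) W W' + qi (dim E - d) * B"
    unfolding A_def B_def kern_def sum_distrib_left sum.distrib[symmetric]
    by (intro sum.cong refl level_relation) simp
  have "(\<Sum>W''\<in>nbr E W. kern E (chi_count x) W'' W' - kern E (chi_count x) W W')
      = (\<Sum>W''\<in>nbr E W. kern E (fixed_count E (Suc d)) W'' W' - A)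
        - (\<Sum>W''\<in>nbr E W. kern E (fixed_count E d) W'' W' - B)"
    by (simp add: chi kern_diff sum_subtractf A_def B_def right_diff_distrib)
  also have "\<dots> = (qi (dim E - d) * B - qi (Suc d) * A)
      - qi (Suc d) * (qi (Suc (dim E - Suc d)) - 1) * A + qi d * (qi (Suc (dim E - d)) - 1) * B"
    unfolding A_def B_def laplacian_kern_fixed_count[OF W] using lev by (simp add: A_def B_def)
  also have "Suc (dim E - Suc d) = dim E - d" using x Suc by simp
  also have "qi (Suc (dim E - d)) - 1 = real qn * qi (dim E - d)"
    using qi_add[of 1 "dim E - d"] by simp
  also have "(qi (dim E - d) * B - qi (Suc d) * A) - qi (Suc d) * (qi (dim E - d) - 1) * A
      + qi d * (real qn * qi (dim E - d)) * B
    = qi (dim E - d) * ((1 + real qn * qi d) * B - qi (Suc d) * A)" by (simp add: algebra_simps)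
  also have "1 + real qn * qi d = qi (Suc d)"
    using qi_add[of 1 d] by simp
  also have "qi (dim E - d) * (qi (Suc d) * B - qi (Suc d) * A) = - qi x * qi (Suc (dim E - x)) * (A - B)"
    using x Suc by (simp add: Suc_diff_Suc algebra_simps)
  finally show ?thesis by (simp add: chi kern_diff A_def B_def)
qed

end

end

section \<open>Identification of the kernel\<close>

text \<open>As \<open>b r\<close> is non-zero below \<open>m\<close>, each value determines the
  next. At \<open>r = 0\<close> the truncated \<open>r - 1\<close> makes the inward difference 0, so
  the value at 0 is the only free parameter.\<close>

lemma recurrence_unique:
  fixes \<psi> \<omega> b c :: "nat \<Rightarrow> real"
  assumes \<psi>: "\<And>r. r \<le> m \<Longrightarrow> c r * (\<psi> (r - 1) - \<psi> r) + b r * (\<psi> (Suc r) - \<psi> r) = l * \<psi> r"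
    and \<omega>: "\<And>r. r \<le> m \<Longrightarrow> c r * (\<omega> (r - 1) - \<omega> r) + b r * (\<omega> (Suc r) - \<omega> r) = l * \<omega> r"
    and b: "\<And>r. r < m \<Longrightarrow> b r \<noteq> 0" and \<omega>0: "\<omega> 0 = 1" and r: "r \<le> m"
  shows "\<psi> r = \<psi> 0 * \<omega> r"
  using r
proof (induction r rule: less_induct)
  case (less r)
  show ?case
  proof (cases r)
    case 0
    then show ?thesis by (simp add: \<omega>0)
  next
    case (Suc t)
    have t1: "t < m" "t < r" "t - 1 < r" "t \<le> m" "t - 1 \<le> m" using less.prems Suc by simp_all
    note t = t1(1) less.IH[OF t1(2,4)] less.IH[OF t1(3,5)]
    have "b t * (\<psi> (Suc t) - \<psi> t) = l * \<psi> t - c t * (\<psi> (t - 1) - \<psi> t)"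
      using \<psi>[OF less_imp_le[OF t(1)]] by linarith
    also have "\<dots> = \<psi> 0 * (l * \<omega> t - c t * (\<omega> (t - 1) - \<omega> t))"
      unfolding t(2,3) by (simp add: algebra_simps)
    also have "l * \<omega> t - c t * (\<omega> (t - 1) - \<omega> t) = b t * (\<omega> (Suc t) - \<omega> t)"
      using \<omega>[OF less_imp_le[OF t(1)]] by linarith
    finally have "b t * (\<psi> (Suc t) - \<psi> t) = b t * (\<psi> 0 * (\<omega> (Suc t) - \<omega> t))"
      by (simp only: mult.left_commute[of "b t" "\<psi> 0"])
    then have "\<psi> (Suc t) - \<psi> t = \<psi> 0 * (\<omega> (Suc t) - \<omega> t)" using b[OF t(1)] by simp
    then show ?thesis using t(2) Suc by (simp add: algebra_simps)
  qed
qed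

context finite_field_space
begin

lemma qi_diff:
  assumes "b \<le> a"
  shows "qi (a - b) = (real qn ^ a / real qn ^ b - 1) / (real qn - 1)"
proof -
  have "real qn ^ (a - b) = real qn ^ a / real qn ^ b"
    using assms qn_gt1 by (simp add: power_diff)
  moreover have "qi (a - b) = (real qn ^ (a - b) - 1) / (real qn - 1)"
    using qi_eq[of "a - b"] qn_gt1 by (simp add: eq_divide_eq)
  ultimately show ?thesis by (simp only:)
qed

lemma qi_closed: "qi a = (real qn ^ a - 1) / (real qn - 1)"
  using qi_diff[of 0 a] by simp

lemma exists_subspace_of_dim:
  assumes "subspace W" "finite W" "d \<le> dim W"
  obtains U where "subspace U" "U \<subseteq> W" "dim U = d"
proof -
  obtain B where B: "B \<subseteq> W" "independent B" "span B = W" "finite B" "card B = dim W"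
    using finite_subspace_basis[OF assms(1,2)] by blast
  obtain C where C: "C \<subseteq> B" "card C = d"
    using obtain_subset_with_card_n[of d B] assms(3) B(5) by metis
  have "independent C" using B(2) C(1) independent_mono by blast
  then have "dim (span C) = d" using dim_span_eq_card_independent C(2) by simp
  moreover have "span C \<subseteq> W" using span_mono[OF C(1)] B(3) by simp
  ultimately show ?thesis using that[of "span C"] by simp
qed

context
  fixes E :: "'v set"
  assumes E: "subspace E" "finite E"
begin

lemmas GrD' = GrD[OF E]

lemma kern_fixed_count_invariant:
  assumes h: "h \<in> GL E"
  shows "kern E (fixed_count E d) (h ` W) (h ` W') = kern E (fixed_count E d) W W'"
proof -
  have "(\<Sum>U\<in>Gr E d. transporters E U (h ` W) U (h ` W'))
      = (\<Sum>U\<in>Gr E d. transporters E (h ` U) (h ` W) (h ` U) (h ` W'))"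
    by (rule sum.reindex_bij_betw[OF GL_bij_Gr[OF h E], symmetric])
  then show ?thesis
    by (simp add: kern_fixed_count[OF E] transporters_left[OF E h] transporters_right[OF E h])
qed

lemma kern_chi_invariant:
  assumes h: "h \<in> GL E"
  shows "kern E (chi_count E x) (h ` W) (h ` W') = kern E (chi_count E x) W W'"
proof -
  have "kern E (chi_count E x) A B = (if x = 0 then kern E (fixed_count E 0) A B
      else kern E (fixed_count E x) A B - kern E (fixed_count E (x - 1)) A B)" for A B
    by (simp add: kern_def chi_count_def[OF E] sum_subtractf)
  then show ?thesis by (simp add: kern_fixed_count_invariant[OF h])
qed

text \<open>Existence is read off from the Laplacian. Starting with some
  \<open>U \<subseteq> W\<close>, the intersection is lowered one dimension at a time; the
  coefficient of this move in \<open>laplacian_dim_Int\<close> is positive because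
  \<open>d + m \<le> dim E\<close>.\<close>

lemma exists_Gr_dim_Int:
  assumes W: "W \<in> Gr E m" and "d \<le> m" "d + m \<le> dim E" "j \<le> d"
  obtains U where "U \<in> Gr E d" "dim (U \<inter> W) = j"
proof -
  have "\<exists>U\<in>Gr E d. dim (U \<inter> W) = d - i" if "i \<le> d" for i
    using that
  proof (induction i)
    case 0
    have fW: "finite W" by (rule finite_subset[OF GrD'(2)[OF W] E(2)])
    obtain U where U: "subspace U" "U \<subseteq> W" "dim U = d"
      using exists_subspace_of_dim[OF GrD'(1)[OF W] fW, of d] GrD'(3)[OF W] assms(2) by metis
    then have "U \<inter> W = U" by blast
    moreover have "U \<in> Gr E d" using U GrD'(2)[OF W] by (simp add: Gr_def)
    ultimately show ?case using U(3) by (intro bexI[of _ U]) simp_all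
  next
    case (Suc i)
    then obtain U where U: "U \<in> Gr E d" "dim (U \<inter> W) = d - i" by auto
    show ?case
    proof (rule ccontr)
      assume neg: "\<not> ?case"
      \<comment> \<open>The indicator of the intersection dimension supposed not to occur: by
        assumption its Laplacian at \<open>U\<close> is 0, whereas the formula gives a positive
        value.\<close>
      define f :: "nat \<Rightarrow> real" where "f = (\<lambda>j. if j = d - Suc i then 1 else 0)"
      have "(\<Sum>U'\<in>nbr E U. f (dim (U' \<inter> W)) - f (d - i)) = 0"
      proof (rule sum.neutral, rule ballI)
        fix U' assume "U' \<in> nbr E U"
        then have "U' \<in> Gr E d" by (rule nbr_Gr[OF E U(1)])
        then have "dim (U' \<inter> W) \<noteq> d - Suc i" using neg by blast
        moreover have "d - i \<noteq> d - Suc i" using Suc by simp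
        ultimately show "f (dim (U' \<inter> W)) - f (d - i) = 0" by (simp add: f_def)
      qed
      moreover have "(\<Sum>U'\<in>nbr E U. f (dim (U' \<inter> W)) - f (d - i))
          = real qn ^ Suc (d - (d - i) + (m - (d - i))) * qi (d - i) * qi (dim E + (d - i) - (d + m))"
      proof -
        have "f (Suc (d - i)) = 0" "f (d - i) = 0" "f (d - i - 1) = 1"
          using Suc by (simp_all add: f_def)
        then show ?thesis
          using laplacian_dim_Int[OF E GrD'(1,2)[OF U(1)] GrD'(1,2)[OF W] GrD'(3)[OF U(1)] GrD'(3)[OF W] U(2), of f]
          by simp
      qed
      moreover have "0 < qi (d - i)" using Suc by (intro qi_pos) simp
      moreover have "0 < qi (dim E + (d - i) - (d + m))" using Suc assms by (intro qi_pos) simp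
      ultimately show False using qn_gt1 by simp
    qed
  qed
  from this[of "d - j"] show ?thesis using assms(4) that by auto
qed

text \<open>The stabiliser of \<open>W\<close> is partitioned by the image of \<open>U\<close>,
  which always meets \<open>W\<close> in the same dimension as \<open>U\<close> does.\<close>

lemma stabiliser_orbit:
  assumes W: "W \<in> Gr E m" and U: "U \<in> Gr E d"
  shows "(\<Sum>U'\<in>{U' \<in> Gr E d. dim (U' \<inter> W) = dim (U \<inter> W)}. transporters E U' W U W)
    = real (card {g \<in> GL E. g ` W = W})"
proof -
  let ?S = "{U' \<in> Gr E d. dim (U' \<inter> W) = dim (U \<inter> W)}"
  have "g ` U \<in> ?S" if "g \<in> GL E" "g ` W = W" for g
  proof -
    have "g ` U \<in> Gr E d" by (rule GL_Gr_iff[OF that(1) E U])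
    moreover have "dim (g ` (U \<inter> W)) = dim (U \<inter> W)"
      using GL_image_subspace(3)[OF that(1) subspace_inter[OF GrD'(1)[OF U] GrD'(1)[OF W]] _ E]
        GrD'(2)[OF U] by blast
    ultimately show ?thesis using GL_image_Int[OF that(1), of U W] that(2) by simp
  qed
  then have eq: "{g \<in> GL E. g ` W = W} = (\<Union>U'\<in>?S. {g \<in> GL E. g ` U = U' \<and> g ` W = W})" by auto
  have "card {g \<in> GL E. g ` W = W} = (\<Sum>U'\<in>?S. card {g \<in> GL E. g ` U = U' \<and> g ` W = W})"
    unfolding eq by (rule card_UN_disjoint) (auto simp: finGr[OF E] finGL[OF E])
  then show ?thesis by (simp add: transporters_def)
qed

text \<open>Burnside: the stabiliser of \<open>W\<close> has one orbit on \<open>Gr E d\<close> for each value of \<open>dim (U \<inter> W)\<close>.\<close>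

lemma kern_fixed_count_diag:
  assumes W: "W \<in> Gr E m" and "d \<le> m" "d + m \<le> dim E"
  shows "kern E (fixed_count E d) W W = real (Suc d) * real (card {g \<in> GL E. g ` W = W})"
proof -
  have le: "dim (U \<inter> W) \<in> {..d}" if U: "U \<in> Gr E d" for U
  proof -
    have "dim (U \<inter> W) \<le> dim U"
      by (rule dim_mono_sub[OF subspace_inter[OF GrD'(1)[OF U] GrD'(1)[OF W]] GrD'(1)[OF U]
            finite_subset[OF GrD'(2)[OF U] E(2)]]) simp
    then show ?thesis using GrD'(3)[OF U] by simp
  qed
  have "kern E (fixed_count E d) W W = (\<Sum>U\<in>Gr E d. transporters E U W U W)"
    by (rule kern_fixed_count[OF E])
  also have "\<dots> = (\<Sum>j\<in>{..d}. \<Sum>U\<in>{U \<in> Gr E d. dim (U \<inter> W) = j}. transporters E U W U W)"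
    by (rule sum.group[symmetric]) (use le in \<open>auto simp: finGr[OF E]\<close>)
  also have "\<dots> = (\<Sum>j\<in>{..d}. real (card {g \<in> GL E. g ` W = W}))"
  proof (rule sum.cong[OF refl])
    fix j assume "j \<in> {..d}"
    then obtain U0 where U0: "U0 \<in> Gr E d" "dim (U0 \<inter> W) = j"
      using exists_Gr_dim_Int[OF W assms(2,3), of j] by auto
    have "transporters E U W U W = transporters E U W U0 W"
      if U: "U \<in> Gr E d" "dim (U \<inter> W) = j" for U
    proof -
      obtain h where h: "h \<in> GL E" "h ` U0 = U" "h ` W = W"
      proof (rule GL_transitive_pairs[OF E GrD'(1,2)[OF U0(1)] GrD'(1,2)[OF W] GrD'(1,2)[OF U(1)] GrD'(1,2)[OF W]])
        show "dim U0 = dim U" using GrD'(3)[OF U0(1)] GrD'(3)[OF U(1)] by simp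
        show "dim (U0 \<inter> W) = dim (U \<inter> W)" using U0(2) U(2) by simp
      qed simp_all
      show ?thesis using transporters_right[OF E h(1), of U W U0 W] unfolding h(2,3) .
    qed
    then have "(\<Sum>U\<in>{U \<in> Gr E d. dim (U \<inter> W) = j}. transporters E U W U W)
        = (\<Sum>U\<in>{U \<in> Gr E d. dim (U \<inter> W) = j}. transporters E U W U0 W)"
      by (intro sum.cong refl) simp
    then show "(\<Sum>U\<in>{U \<in> Gr E d. dim (U \<inter> W) = j}. transporters E U W U W)
        = real (card {g \<in> GL E. g ` W = W})"
      using stabiliser_orbit[OF W U0(1)] U0(2) by simp
  qed
  finally show ?thesis by simp
qed

lemma card_stabiliser:
  assumes W: "W \<in> Gr E m"
  shows "real (card {g \<in> GL E. g ` W = W}) * real (card (Gr E m)) = real (card (GL E))"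
proof -
  have eq: "GL E = (\<Union>W'\<in>Gr E m. {g \<in> GL E. g ` W = W'})"
    using GL_Gr_iff[OF _ E W] by auto
  have each: "card {g \<in> GL E. g ` W = W'} = card {g \<in> GL E. g ` W = W}" if W': "W' \<in> Gr E m" for W'
  proof -
    obtain h where h: "h \<in> GL E" "h ` W = W'"
    proof (rule GL_transitive_pairs[OF E GrD'(1,2)[OF W] GrD'(1,2)[OF W] GrD'(1,2)[OF W'] GrD'(1,2)[OF W']])
      show "dim W = dim W'" "dim W = dim W'" using GrD'(3)[OF W] GrD'(3)[OF W'] by simp_all
      then show "dim (W \<inter> W) = dim (W' \<inter> W')" by simp
    qed
    show ?thesis
      using transporters_left[OF E h(1), of W W W W] unfolding h(2) transporters_def by simp
  qed
  have "card (GL E) = (\<Sum>W'\<in>Gr E m. card {g \<in> GL E. g ` W = W'})"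
    by (subst eq, rule card_UN_disjoint) (auto simp: finGr[OF E] finGL[OF E])
  also have "\<dots> = (\<Sum>W'\<in>Gr E m. card {g \<in> GL E. g ` W = W})" by (rule sum.cong[OF refl each])
  finally show ?thesis by (simp add: mult.commute)
qed

text \<open>For \<open>x > 0\<close> the stabiliser has \<open>x + 1\<close> orbits on
  \<open>Gr E x\<close> and \<open>x\<close> on \<open>Gr E (x - 1)\<close>. The difference 1 is the
  multiplicity of the character in the permutation representation.\<close>

lemma kern_chi_diag:
  assumes W: "W \<in> Gr E m" and "x \<le> m" "x + m \<le> dim E"
  shows "kern E (chi_count E x) W W = real (card {g \<in> GL E. g ` W = W})"
proof (cases x)
  case 0
  then have "chi_count E x = fixed_count E 0" by (intro ext) (simp add: chi_count_def[OF E])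
  then show ?thesis using kern_fixed_count_diag[OF W, of 0] assms by simp
next
  case (Suc d)
  have "kern E (chi_count E x) W W = kern E (fixed_count E (Suc d)) W W - kern E (fixed_count E d) W W"
    by (simp add: kern_def chi_count_def[OF E] sum_subtractf Suc)
  moreover have "kern E (fixed_count E (Suc d)) W W = real (Suc (Suc d)) * real (card {g \<in> GL E. g ` W = W})"
    using assms Suc by (intro kern_fixed_count_diag[OF W]) simp_all
  moreover have "kern E (fixed_count E d) W W = real (Suc d) * real (card {g \<in> GL E. g ` W = W})"
    using assms Suc by (intro kern_fixed_count_diag[OF W]) simp_all
  ultimately show ?thesis by (simp add: algebra_simps)
qed

lemma laplacian_distance:
  fixes f :: "nat \<Rightarrow> real"
  assumes W: "W \<in> Gr E m" and W': "W' \<in> Gr E m"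
  defines "r \<equiv> m - dim (W \<inter> W')"
  shows "(\<Sum>W''\<in>nbr E W. f (m - dim (W'' \<inter> W')) - f r)
    = qi r * qi r * (f (r - 1) - f r)
      + real qn ^ Suc (r + r) * qi (m - r) * qi (dim E - (m + r)) * (f (Suc r) - f r)"
proof -
  define j where "j = dim (W \<inter> W')"
  have "j \<le> dim W" unfolding j_def
    by (rule dim_mono_sub[OF subspace_inter[OF GrD'(1)[OF W] GrD'(1)[OF W']] GrD'(1)[OF W]
            finite_subset[OF GrD'(2)[OF W] E(2)]]) simp
  then have jm: "j \<le> m" using GrD'(3)[OF W] by simp
  then have r: "r = m - j" "m - r = j" by (simp_all add: r_def j_def)
  have "(\<Sum>W''\<in>nbr E W. f (m - dim (W'' \<inter> W')) - f r)
    = qi r * qi r * (f (m - Suc j) - f r)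
      + real qn ^ Suc (r + r) * qi j * qi (dim E + j - (m + m)) * (f (m - (j - 1)) - f r)"
    unfolding r(1)
    by (rule laplacian_dim_Int[OF E GrD'(1,2)[OF W] GrD'(1,2)[OF W'] GrD'(3)[OF W] GrD'(3)[OF W'] j_def[symmetric],
          of "\<lambda>i. f (m - i)"])
  also have "m - Suc j = r - 1" unfolding r(1) by simp
  also have "dim E + j - (m + m) = dim E - (m + r)" unfolding r(1) using jm by simp
  also have "real qn ^ Suc (r + r) * qi j * qi (dim E - (m + r)) * (f (m - (j - 1)) - f r)
      = real qn ^ Suc (r + r) * qi j * qi (dim E - (m + r)) * (f (Suc r) - f r)"
  \<comment> \<open>For \<open>j = 0\<close> the truncated \<open>m - (j - 1)\<close> is
    \<open>m\<close> rather than \<open>Suc r\<close>, but the coefficient \<open>qi j\<close> is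
    then 0.\<close>
  proof (cases "j = 0")
    case False
    then have "m - (j - 1) = Suc r" unfolding r(1) using jm by simp
    then show ?thesis by (simp only:)
  qed simp
  finally show ?thesis unfolding r(2) .
qed

lemma kern_chi_eq_omega:
  assumes m: "m + m \<le> dim E" and x: "x \<le> m" and W: "W \<in> Gr E m" and W': "W' \<in> Gr E m"
  shows "kern E (chi_count E x) W W'
    = real (card (GL E)) / real (card (Gr E m)) * omega (real qn) (dim E) m x (m - dim (W \<inter> W'))"
proof -
  define Q n where "Q = real qn" and "n = dim E"
  have Q: "Q > 1" using qn_gt1 by (simp add: Q_def)
  obtain f where f: "\<And>U W. U \<in> Gr E m \<Longrightarrow> W \<in> Gr E m \<Longrightarrow> kern E (chi_count E x) U W = f (dim (U \<inter> W))"
    using invariant_function_of_dim[OF E, of m m "kern E (chi_count E x)"] kern_chi_invariant by blast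
  \<comment> \<open>The kernel as a function of distance. Only arguments up to \<open>m\<close> are
    meaningful; \<open>\<psi> (Suc m)\<close> enters the recurrence with the coefficient
    \<open>b m = 0\<close>.\<close>
  define \<psi> where "\<psi> = (\<lambda>r. f (m - r))"
  have le: "dim (A \<inter> B) \<le> m" if A: "A \<in> Gr E m" and B: "B \<in> Gr E m" for A B
  proof -
    have "dim (A \<inter> B) \<le> dim A"
      by (rule dim_mono_sub[OF subspace_inter[OF GrD'(1)[OF A] GrD'(1)[OF B]] GrD'(1)[OF A]
            finite_subset[OF GrD'(2)[OF A] E(2)]]) simp
    then show ?thesis using GrD'(3)[OF A] by simp
  qed
  have f\<psi>: "kern E (chi_count E x) A B = \<psi> (m - dim (A \<inter> B))" if "A \<in> Gr E m" "B \<in> Gr E m" for A B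
    using f[OF that] le[OF that] by (simp add: \<psi>_def)
  define c where "c = (\<lambda>r. ((Q ^ r - 1) / (Q - 1)) * ((Q ^ r - 1) / (Q - 1)))"
  define b where "b = (\<lambda>r. Q ^ Suc (r + r) * ((Q ^ m / Q ^ r - 1) / (Q - 1)) * ((Q ^ n / (Q ^ m * Q ^ r) - 1) / (Q - 1)))"
  define l where "l = - ((Q ^ x - 1) / (Q - 1) * ((Q * Q ^ n / Q ^ x - 1) / (Q - 1)))"
  have bq: "b r = Q ^ Suc (r + r) * qi (m - r) * qi (n - (m + r))" if "r \<le> m" for r
    using that m qi_diff[of r m] qi_diff[of "m + r" n] by (simp add: b_def Q_def n_def power_add)
  have cq: "c r = qi r * qi r" for r by (simp add: c_def qi_closed Q_def)
  have lq: "l = - (qi x * qi (Suc n - x))"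
  proof -
    have "x \<le> Suc n" using x m by (simp add: n_def)
    show ?thesis unfolding l_def Q_def qi_diff[OF \<open>x \<le> Suc n\<close>] qi_closed[of x] power_Suc
      by (rule refl)
  qed
  have rec: "c r * (\<psi> (r - 1) - \<psi> r) + b r * (\<psi> (Suc r) - \<psi> r) = l * \<psi> r" if r: "r \<le> m" for r
  proof -
    \<comment> \<open>The recurrence at \<open>r\<close> is the eigenvalue equation evaluated at a
      subspace of distance \<open>r\<close> from \<open>W\<close>, which exists since
      \<open>m + m \<le> dim E\<close>.\<close>
    obtain V where V: "V \<in> Gr E m" "dim (V \<inter> W) = m - r"
      using exists_Gr_dim_Int[OF W order_refl m, of "m - r"] by auto
    have "(\<Sum>V'\<in>nbr E V. kern E (chi_count E x) V' W - kern E (chi_count E x) V W)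
        = (\<Sum>V'\<in>nbr E V. \<psi> (m - dim (V' \<inter> W)) - \<psi> r)"
      by (intro sum.cong refl) (simp add: f\<psi>[OF nbr_Gr[OF E V(1)] W] f\<psi>[OF V(1) W] V(2) r)
    also have "\<dots> = c r * (\<psi> (r - 1) - \<psi> r) + b r * (\<psi> (Suc r) - \<psi> r)"
      using laplacian_distance[OF V(1) W, of \<psi>] r by (simp add: V(2) cq bq Q_def n_def)
    finally show ?thesis
      using laplacian_kern_chi[OF E V(1), of x W] x m f\<psi>[OF V(1) W] V(2) r
      by (simp add: lq n_def Suc_diff_le)
  qed
  have rec\<omega>: "c r * (omega Q n m x (r - 1) - omega Q n m x r) + b r * (omega Q n m x (Suc r) - omega Q n m x r)
      = l * omega Q n m x r" for r
    unfolding c_def b_def l_def using x m by (intro omega_eigenfunction[OF Q]) (simp_all add: n_def)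
  have b0: "b r \<noteq> 0" if r: "r < m" for r
  proof -
    have "0 < qi (m - r)" "0 < qi (n - (m + r))" using r m by (simp_all add: qi_pos n_def)
    then show ?thesis using bq[of r] r Q by simp
  qed
  have "\<psi> (m - dim (W \<inter> W')) = \<psi> 0 * omega Q n m x (m - dim (W \<inter> W'))"
    by (rule recurrence_unique[where b = b and c = c and l = l and m = m, OF rec rec\<omega> b0 omega_0 diff_le_self])
  moreover have "\<psi> 0 = real (card {g \<in> GL E. g ` W = W})"
    using kern_chi_diag[OF W x] x m f\<psi>[OF W W] GrD'(3)[OF W] by simp
  moreover have "real (card {g \<in> GL E. g ` W = W}) = real (card (GL E)) / real (card (Gr E m))"
  proof -
    have "card (Gr E m) \<noteq> 0" using W finGr[OF E, of m] by auto
    then show ?thesis using card_stabiliser[OF W] by (simp add: field_simps)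
  qed
  ultimately show ?thesis using f\<psi>[OF W W'] by (simp add: Q_def n_def)
qed

section \<open>Averages over a Grassmannian and its cardinality\<close>

lemma nbr_sym:
  assumes "A \<in> Gr E m" "B \<in> Gr E m"
  shows "B \<in> nbr E A \<longleftrightarrow> A \<in> nbr E B"
  using assms GrD'(3) by (simp add: nbr_def Int_commute)

text \<open>By symmetry of adjacency, each \<open>f B\<close> is added once for every neighbour of
  \<open>B\<close> and subtracted equally often.\<close>

lemma sum_laplacian_eq_0:
  fixes f :: "'v set \<Rightarrow> real"
  shows "(\<Sum>A\<in>Gr E m. \<Sum>B\<in>nbr E A. f B - f A) = 0"
proof -
  have nb: "nbr E A = {B \<in> Gr E m. B \<in> nbr E A}" if "A \<in> Gr E m" for A
    using nbr_Gr[OF E that] by auto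
  have "(\<Sum>A\<in>Gr E m. \<Sum>B\<in>nbr E A. f B) = (\<Sum>A\<in>Gr E m. \<Sum>B\<in>{B \<in> Gr E m. B \<in> nbr E A}. f B)"
    by (rule sum.cong[OF refl]) (simp add: nb[symmetric])
  also have "\<dots> = (\<Sum>B\<in>Gr E m. \<Sum>A\<in>{A \<in> Gr E m. B \<in> nbr E A}. f B)"
    by (rule sum.swap_restrict) (simp_all add: finGr[OF E])
  also have "\<dots> = (\<Sum>B\<in>Gr E m. \<Sum>A\<in>nbr E B. f B)"
  proof (rule sum.cong[OF refl])
    fix B assume B: "B \<in> Gr E m"
    have "{A \<in> Gr E m. B \<in> nbr E A} = nbr E B"
      using nbr_sym[OF _ B] nbr_Gr[OF E B] by auto
    then show "(\<Sum>A\<in>{A \<in> Gr E m. B \<in> nbr E A}. f B) = (\<Sum>A\<in>nbr E B. f B)" by simp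
  qed
  finally show ?thesis by (simp only: sum_subtractf)
qed

text \<open>A form of the \<open>q\<close>-Chu-Vandermonde sum, with denominators cleared so that it holds for all \<open>s\<close>.\<close>

lemma sum_qpoch_distance:
  assumes W: "W \<in> Gr E m" and m: "m \<le> dim E"
  defines "Q \<equiv> real qn"
  shows "(\<Sum>W'\<in>Gr E m. qpoch (1 / Q ^ (m - dim (W' \<inter> W))) Q s) * qpoch (1 / Q ^ dim E) Q s
    = real (card (Gr E m)) * qpoch (1 / Q ^ m) Q s * qpoch (1 / Q ^ (dim E - m)) Q s"
proof (induction s)
  case (Suc t)
  define n where "n = dim E"
  have Q: "Q > 1" using qn_gt1 by (simp add: Q_def)
  define u where "u = (\<lambda>s r. qpoch (1 / Q ^ r) Q s)"
  define T where "T = (\<lambda>s. \<Sum>W'\<in>Gr E m. u s (m - dim (W' \<inter> W)))"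
  define A B S Z where "A = Q ^ m" and "B = Q ^ (n - m)" and "S = Q ^ t" and "Z = Q ^ n"
  have pos: "A > 0" "B > 0" "S > 0" "Z > 0" "Q > 0" "Q \<noteq> 1" using Q by (auto simp: A_def B_def S_def Z_def)
  have Z: "Z = A * B" using m by (simp add: A_def B_def Z_def n_def flip: power_add)
  define \<kappa> where "\<kappa> = (Q * S - 1) / (Q - 1) ^ 2"
  have "0 = (\<Sum>W'\<in>Gr E m. \<Sum>W''\<in>nbr E W'. u (Suc t) (m - dim (W'' \<inter> W)) - u (Suc t) (m - dim (W' \<inter> W)))"
    by (rule sum_laplacian_eq_0[symmetric])
  also have "\<dots> = (\<Sum>W'\<in>Gr E m. \<kappa> * ((1 - Z / S) * u (Suc t) (m - dim (W' \<inter> W))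
      + S * (1 - A / S) * (1 - B / S) * u t (m - dim (W' \<inter> W))))"
  proof (rule sum.cong[OF refl])
    fix W' assume W': "W' \<in> Gr E m"
    define r where "r = m - dim (W' \<inter> W)"
    have rm: "r \<le> m" by (simp add: r_def)
    have rn: "m + r \<le> n"
    proof -
      have fin: "finite W'" "finite W"
        by (rule finite_subset[OF GrD'(2)[OF W'] E(2)], rule finite_subset[OF GrD'(2)[OF W] E(2)])
      have "dim (W' +s W) + dim (W' \<inter> W) = m + m"
        using dim_ssum[OF GrD'(1)[OF W'] GrD'(1)[OF W] fin] GrD'(3)[OF W'] GrD'(3)[OF W] by simp
      moreover have "dim (W' +s W) \<le> n" unfolding n_def
        by (rule dim_mono_sub[OF subspace_ssum E ssum_least[OF GrD'(2)[OF W'] GrD'(2)[OF W] E(1)]])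
      ultimately show ?thesis using m by (simp add: r_def n_def)
    qed
    have "(\<Sum>W''\<in>nbr E W'. u (Suc t) (m - dim (W'' \<inter> W)) - u (Suc t) r)
      = qi r * qi r * (u (Suc t) (r - 1) - u (Suc t) r)
      + Q ^ Suc (r + r) * qi (m - r) * qi (n - (m + r)) * (u (Suc t) (Suc r) - u (Suc t) r)"
      using laplacian_distance[OF W' W, of "u (Suc t)"] by (simp add: r_def Q_def n_def)
    also have "\<dots> = (Q ^ Suc t - 1) / (Q - 1) ^ 2 *
      ((1 - Q * Q ^ n / Q ^ Suc t) * u (Suc t) r
        + Q ^ Suc t / Q * (1 - Q ^ m * Q / Q ^ Suc t) * (1 - Q ^ n * Q / (Q ^ m * Q ^ Suc t)) * u (Suc t - 1) r)"
      unfolding u_def laplacian_qpoch[OF Q, symmetric]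
      using rm rn by (simp add: qi_closed[of r] qi_diff Q_def power_add)
    also have "\<dots> = \<kappa> * ((1 - Z / S) * u (Suc t) r + S * (1 - A / S) * (1 - B / S) * u t r)"
    proof -
      have "Q * Q ^ n / Q ^ Suc t = Z / S" "Q ^ Suc t / Q = S" "Q ^ m * Q / Q ^ Suc t = A / S"
        "Q ^ Suc t = Q * S" using pos by (simp_all add: Z_def S_def A_def)
      moreover have "Q ^ n * Q / (Q ^ m * Q ^ Suc t) = B / S"
        using pos Z unfolding A_def[symmetric] Z_def[symmetric] by (simp add: S_def)
      ultimately show ?thesis by (simp only: \<kappa>_def diff_Suc_1)
    qed
    finally show "(\<Sum>W''\<in>nbr E W'. u (Suc t) (m - dim (W'' \<inter> W)) - u (Suc t) (m - dim (W' \<inter> W)))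
      = \<kappa> * ((1 - Z / S) * u (Suc t) (m - dim (W' \<inter> W))
      + S * (1 - A / S) * (1 - B / S) * u t (m - dim (W' \<inter> W)))" unfolding r_def .
  qed
  also have "\<dots> = \<kappa> * ((1 - Z / S) * T (Suc t) + S * (1 - A / S) * (1 - B / S) * T t)"
    by (simp add: T_def sum_distrib_left[symmetric] sum.distrib)
  finally have "\<kappa> * ((1 - Z / S) * T (Suc t) + S * (1 - A / S) * (1 - B / S) * T t) = 0" by simp
  moreover have "\<kappa> \<noteq> 0"
  proof -
    have "Q * S > 1" using Q one_less_power[of Q "Suc t"] by (simp add: S_def)
    then show ?thesis using pos by (simp add: \<kappa>_def)
  qed
  ultimately have rec: "(1 - Z / S) * T (Suc t) = - (S * (1 - A / S) * (1 - B / S) * T t)" by simp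
  have IH: "T t * qpoch (1 / Z) Q t = real (card (Gr E m)) * qpoch (1 / A) Q t * qpoch (1 / B) Q t"
    using Suc.IH by (simp add: T_def u_def Z_def A_def B_def n_def)
  \<comment> \<open>The new factor is \<open>1 - S / Z = - (S / Z) * (1 - Z / S)\<close>, so
    \<open>rec\<close> applies without dividing by \<open>1 - Z / S\<close>, which is 0 for
    \<open>t = dim E\<close>.\<close>
  have "T (Suc t) * qpoch (1 / Z) Q (Suc t) = (- (S / Z)) * ((1 - Z / S) * T (Suc t)) * qpoch (1 / Z) Q t"
    using pos by (simp add: qpoch_Suc S_def[symmetric] field_simps)
  also have "\<dots> = (S / Z * (S * (1 - A / S) * (1 - B / S))) * (T t * qpoch (1 / Z) Q t)"
    unfolding rec by simp
  also have "S / Z * (S * (1 - A / S) * (1 - B / S)) = (1 - S / A) * (1 - S / B)"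
    unfolding Z using pos by (simp add: field_simps)
  also have "(1 - S / A) * (1 - S / B) * (T t * qpoch (1 / Z) Q t)
      = real (card (Gr E m)) * qpoch (1 / A) Q (Suc t) * qpoch (1 / B) Q (Suc t)"
    unfolding IH by (simp add: qpoch_Suc S_def[symmetric] mult_ac)
  finally show ?case by (simp add: T_def u_def Z_def A_def B_def n_def)
qed simp

text \<open>The level relation at the identity: every subspace is fixed, and none is moved to a
  neighbour since no subspace is its own neighbour.\<close>

lemma card_Gr_Suc:
  "qi (Suc d) * real (card (Gr E (Suc d))) = qi (dim E - d) * real (card (Gr E d))"
proof -
  have f: "fixed_count E a id = real (card (Gr E a))" for a by (simp add: fixed_count_def)
  have m: "moved_count E a id = 0" for a
  proof -
    have "{U \<in> Gr E a. id ` U \<in> nbr E U} = {}" by (auto simp: nbr_def)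
    then show ?thesis unfolding moved_count_def by (simp only: card.empty of_nat_0)
  qed
  show ?thesis using level_relation[OF E id_GL, of d] by (simp add: f m)
qed

lemma qpoch_self_neq_0: "qpoch (real qn) (real qn) a \<noteq> 0"
proof (rule qpoch_neq_0)
  fix i
  have "real qn ^ Suc i > 1" using qn_gt1 by (intro one_less_power) simp_all
  then show "real qn * real qn ^ i \<noteq> 1" by simp
qed

lemma card_Gr:
  assumes "d \<le> dim E"
  shows "real (card (Gr E d)) = qbinom (real qn) (dim E) d"
  using assms
proof (induction d)
  case 0
  have "Gr E 0 = {{0}}"
  proof (intro equalityI subsetI)
    fix U assume "U \<in> Gr E 0"
    note U = GrD'[OF this]
    have "{0} = U"
      by (rule sub_eq_of_dim[OF _ U(1) finite_subset[OF U(2) E(2)]])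
        (use U(1,3) in \<open>simp_all add: subspace_0\<close>)
    then show "U \<in> {{0}}" by simp
  next
    fix U assume "U \<in> {{0 :: 'v}}"
    then have "U = {0}" by simp
    then show "U \<in> Gr E 0" using subspace_0[OF E(1)] by (simp add: Gr_def)
  qed
  then show ?case using qpoch_self_neq_0[of "dim E"] by (simp add: qbinom_def)
next
  case (Suc d)
  define Q n where "Q = real qn" and "n = dim E"
  define P where "P = qpoch Q Q"
  have P0: "P a \<noteq> 0" for a unfolding P_def Q_def by (rule qpoch_self_neq_0)
  have PS: "P (Suc a) = - (Q - 1) * qi (Suc a) * P a" for a
  proof -
    have "1 - Q * Q ^ a = - (Q - 1) * qi (Suc a)"
      using qi_eq[of "Suc a"] by (simp add: Q_def algebra_simps)
    then show ?thesis by (simp add: P_def qpoch_Suc)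
  qed
  have nd: "n - d = Suc (n - Suc d)" using Suc.prems by (simp add: n_def)
  define c where "c = - (Q - 1)"
  have "P (n - d) = c * qi (n - d) * P (n - Suc d)" "P (Suc d) = c * qi (Suc d) * P d"
    unfolding nd c_def by (rule PS)+
  moreover have q0: "qi (Suc d) \<noteq> 0" using qi_pos[of "Suc d"] by simp
  moreover have "c \<noteq> 0" using qn_gt1 by (simp add: c_def Q_def)
  moreover have "qi (n - d) \<noteq> 0" using qi_pos[of "n - d"] nd by simp
  ultimately have "qi (n - d) * (P n / (P d * P (n - d))) / qi (Suc d) = P n / (P (Suc d) * P (n - Suc d))"
    by simp
  moreover have "real (card (Gr E (Suc d))) = qi (n - d) * real (card (Gr E d)) / qi (Suc d)"
    using card_Gr_Suc[of d] q0 by (simp add: n_def field_simps)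
  ultimately show ?case
    using Suc by (simp add: qbinom_def P_def Q_def n_def)
qed

end

end

section \<open>Coordinate subspaces and tensors\<close>

definition vscale :: "'a::field \<Rightarrow> 'a vec \<Rightarrow> 'a vec" where
  "vscale c v = (\<lambda>i. c * v i)"

interpretation V: finite_field_space "vscale :: 'a::{field,finite} \<Rightarrow> 'a vec \<Rightarrow> 'a vec" "card (UNIV :: 'a set)"
  by unfold_locales (simp_all add: vscale_def fun_eq_iff algebra_simps)

text \<open>A common form for \<open>Vsp\<close>, \<open>Vflag\<close> and \<open>Vcompl\<close>, so
  that one bijection with coordinate functions on \<open>I\<close> gives all their
  dimensions.\<close>

definition coord_space :: "nat set \<Rightarrow> ('a::field) vec set" where
  "coord_space I = {v. \<forall>i. i \<notin> I \<longrightarrow> v i = 0}"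

lemma Vsp_eq_coord: "Vsp n = coord_space {..<n}"
  by (auto simp: Vsp_def coord_space_def not_less)

lemma Vflag_eq_coord: "l \<le> n \<Longrightarrow> Vflag n l = coord_space {..<l}"
  by (auto simp: Vflag_def Vsp_def coord_space_def not_less)

lemma Vcompl_eq_coord: "Vcompl n k = coord_space {k..<n}"
proof -
  have "(\<forall>i\<ge>n. v i = 0) \<and> (\<forall>j<k. v j = 0) \<longleftrightarrow> (\<forall>i. i \<notin> {k..<n} \<longrightarrow> v i = 0)" for v :: "'a vec"
    using leI by auto
  then show ?thesis by (simp only: Vcompl_def Vsp_def coord_space_def mem_Collect_eq)
qed

lemma subspace_coord_space: "V.subspace (coord_space I)"
  by (rule V.subspaceI) (auto simp: coord_space_def vscale_def)

lemma card_coord_space: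
  assumes "finite I"
  shows "finite (coord_space I :: 'a::{field,finite} vec set)"
    "card (coord_space I :: 'a vec set) = card (UNIV :: 'a set) ^ card I"
proof -
  have "bij_betw (\<lambda>v. restrict v I) (coord_space I :: 'a vec set) (I \<rightarrow>\<^sub>E UNIV)"
  proof (rule bij_betw_byWitness[where f' = "\<lambda>f i. if i \<in> I then f i else 0"])
    show "\<forall>v\<in>coord_space I. (\<lambda>i. if i \<in> I then restrict v I i else 0) = (v :: 'a vec)"
      by (auto simp: coord_space_def fun_eq_iff)
    show "\<forall>f\<in>I \<rightarrow>\<^sub>E UNIV. restrict (\<lambda>i. if i \<in> I then f i else (0 :: 'a)) I = f"
      by (auto simp: fun_eq_iff PiE_def extensional_def)
  qed (auto simp: coord_space_def)
  moreover have "finite (I \<rightarrow>\<^sub>E (UNIV :: 'a set))" using assms by (intro finite_PiE) simp_all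
  moreover have "card (I \<rightarrow>\<^sub>E (UNIV :: 'a set)) = card (UNIV :: 'a set) ^ card I"
    using assms by (simp add: card_PiE)
  ultimately show "finite (coord_space I :: 'a vec set)"
      "card (coord_space I :: 'a vec set) = card (UNIV :: 'a set) ^ card I"
    by (simp_all add: bij_betw_finite bij_betw_same_card)
qed

lemma dim_coord_space:
  assumes "finite I"
  shows "V.dim (coord_space I :: 'a::{field,finite} vec set) = card I"
  using V.dim_eq_iff_card[OF subspace_coord_space card_coord_space(1)[OF assms]]
    card_coord_space(2)[OF assms, where 'a = 'a] by blast

lemma lin_comb_eq_sum: "lin_comb c vs = (\<Sum>j<length vs. vscale (c j) (vs ! j))"
proof -
  have "(\<Sum>j\<in>A. vscale (c j) (vs ! j)) i = (\<Sum>j\<in>A. c j * (vs ! j) i)" if "finite A" for A i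
    using that by (induction A rule: finite_induct) (simp_all add: vscale_def)
  then show ?thesis by (simp add: lin_comb_def fun_eq_iff)
qed

lemma lin_comb_in_lin_span: "lin_comb c vs \<in> lin_span vs"
  by (simp add: lin_span_def)

lemma subspace_lin_span: "V.subspace (lin_span vs)"
proof (rule V.subspaceI)
  have "lin_comb (\<lambda>_. 0) vs = 0" by (simp add: lin_comb_def fun_eq_iff)
  then show "0 \<in> lin_span vs" by (metis lin_comb_in_lin_span)
next
  fix x y assume "x \<in> lin_span vs" "y \<in> lin_span vs"
  then obtain c d where cd: "x = lin_comb c vs" "y = lin_comb d vs" by (auto simp: lin_span_def)
  have "x + y = lin_comb (\<lambda>j. c j + d j) vs"
    unfolding cd by (simp add: lin_comb_def fun_eq_iff sum.distrib distrib_right)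
  then show "x + y \<in> lin_span vs" by (simp only: lin_comb_in_lin_span)
next
  fix a x assume "x \<in> lin_span vs"
  then obtain c where c: "x = lin_comb c vs" by (auto simp: lin_span_def)
  have "vscale a x = lin_comb (\<lambda>j. a * c j) vs"
    unfolding c by (simp add: lin_comb_def vscale_def fun_eq_iff sum_distrib_left mult.assoc)
  then show "vscale a x \<in> lin_span vs" by (simp only: lin_comb_in_lin_span)
qed

lemma set_subset_lin_span: "set vs \<subseteq> lin_span vs"
proof
  fix v assume "v \<in> set vs"
  then obtain j where j: "j < length vs" "v = vs ! j" by (metis in_set_conv_nth)
  have "v = lin_comb (\<lambda>i. if i = j then 1 else 0) vs"
  proof
    fix i
    have "(\<Sum>k<length vs. (if k = j then 1 else 0) * (vs ! k) i) = (\<Sum>k<length vs. if k = j then (vs ! k) i else 0)"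
      by (rule sum.cong) simp_all
    also have "\<dots> = (vs ! j) i" using j by simp
    finally show "v i = lin_comb (\<lambda>i. if i = j then 1 else 0) vs i" by (simp add: lin_comb_def j(2))
  qed
  then show "v \<in> lin_span vs" by (simp only: lin_comb_in_lin_span)
qed

lemma lin_span_subset:
  assumes "V.subspace W" "set vs \<subseteq> W"
  shows "lin_span vs \<subseteq> W"
proof
  fix x assume "x \<in> lin_span vs"
  then obtain c where "x = lin_comb c vs" by (auto simp: lin_span_def)
  then show "x \<in> W"
    unfolding lin_comb_eq_sum using assms
    by (auto intro!: V.subspace_sum V.subspace_scale)
qed

lemma lin_span_eq_image: "lin_span vs = (\<lambda>c. lin_comb c vs) ` ({..<length vs} \<rightarrow>\<^sub>E UNIV)"
proof (intro equalityI subsetI)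
  fix x assume "x \<in> lin_span vs"
  then obtain c where c: "x = lin_comb c vs" by (auto simp: lin_span_def)
  have eq: "lin_comb c vs = lin_comb (restrict c {..<length vs}) vs"
    by (simp add: lin_comb_def)
  show "x \<in> (\<lambda>c. lin_comb c vs) ` ({..<length vs} \<rightarrow>\<^sub>E UNIV)"
    unfolding c by (subst eq, rule imageI) (rule restrict_PiE_iff[THEN iffD2], simp)
qed (auto simp: lin_span_def)

lemma lin_indep_iff_inj:
  "lin_indep vs \<longleftrightarrow> inj_on (\<lambda>c. lin_comb c vs) ({..<length vs} \<rightarrow>\<^sub>E UNIV)" (is "_ \<longleftrightarrow> inj_on ?L ?P")
proof
  assume li: "lin_indep vs"
  show "inj_on ?L ?P"
  proof (rule inj_onI)
    fix c d assume cd: "c \<in> ?P" "d \<in> ?P" "lin_comb c vs = lin_comb d vs"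
    have "lin_comb (\<lambda>j. c j - d j) vs = (\<lambda>_. 0)"
    proof
      fix i
      have "lin_comb (\<lambda>j. c j - d j) vs i = lin_comb c vs i - lin_comb d vs i"
        by (simp add: lin_comb_def sum_subtractf left_diff_distrib)
      then show "lin_comb (\<lambda>j. c j - d j) vs i = 0" using cd(3) by simp
    qed
    then have "\<forall>j<length vs. c j - d j = 0" using li unfolding lin_indep_def by blast
    then show "c = d" using cd(1,2) by (intro PiE_ext[OF cd(1,2)]) simp
  qed
next
  assume inj: "inj_on ?L ?P"
  show "lin_indep vs"
    unfolding lin_indep_def
  proof (intro allI impI)
    fix c j assume c: "lin_comb c vs = (\<lambda>_. 0)" and j: "j < length vs"
    have "lin_comb (restrict c {..<length vs}) vs = lin_comb (restrict (\<lambda>_. 0) {..<length vs}) vs"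
      using c by (simp add: lin_comb_def)
    then have "restrict c {..<length vs} = restrict (\<lambda>_. 0) {..<length vs}"
      by (rule inj_onD[OF inj]) simp_all
    from fun_cong[OF this, of j] show "c j = 0" using j by simp
  qed
qed

lemma finite_Vsp: "finite (Vsp n :: 'a::{field,finite} vec set)"
  unfolding Vsp_eq_coord by (rule card_coord_space) simp

lemma subspace_Vsp: "V.subspace (Vsp n)"
  unfolding Vsp_eq_coord by (rule subspace_coord_space)

lemma dim_Vsp: "V.dim (Vsp n :: 'a::{field,finite} vec set) = n"
  unfolding Vsp_eq_coord by (simp add: dim_coord_space)

text \<open>Both inclusions are counting arguments: a list of length \<open>d\<close> is independent
  iff its coefficient map is injective on a set of \<open>q^d\<close> coefficient families, that is,
  iff its span has \<open>q^d\<close> elements.\<close>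

lemma subspaces_dim_eq_Gr: "subspaces_dim n d = V.Gr (Vsp n :: 'a::{field,finite} vec set) d"
proof (intro equalityI subsetI)
  fix W :: "'a vec set" assume "W \<in> subspaces_dim n d"
  then obtain vs where vs: "length vs = d" "set vs \<subseteq> Vsp n" "lin_indep vs" "lin_span vs = W"
    by (auto simp: subspaces_dim_def)
  have sub: "V.subspace W" "W \<subseteq> Vsp n"
    using subspace_lin_span[of vs] lin_span_subset[OF subspace_Vsp vs(2)] vs(4) by simp_all
  have fin: "finite W" by (rule finite_subset[OF sub(2) finite_Vsp])
  have "card W = card ({..<length vs} \<rightarrow>\<^sub>E (UNIV :: 'a set))"
    using vs(3) unfolding lin_indep_iff_inj vs(4)[symmetric] lin_span_eq_image by (rule card_image)
  also have "\<dots> = card (UNIV :: 'a set) ^ d" using vs(1) by (simp add: card_PiE)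
  finally have "V.dim W = d" using V.dim_eq_iff_card[OF sub(1) fin] by blast
  then show "W \<in> V.Gr (Vsp n) d" using sub by (simp add: V.Gr_def)
next
  fix W :: "'a vec set" assume "W \<in> V.Gr (Vsp n) d"
  then have W: "V.subspace W" "W \<subseteq> Vsp n" "V.dim W = d" by (auto simp: V.Gr_def)
  have fin: "finite W" by (rule finite_subset[OF W(2) finite_Vsp])
  obtain B where B: "B \<subseteq> W" "V.span B = W" "finite B" "card B = V.dim W"
    using V.finite_subspace_basis[OF W(1) fin] by metis
  obtain vs where vs: "set vs = B" "distinct vs" using finite_distinct_list[OF B(3)] by blast
  have len: "length vs = d" using distinct_card[OF vs(2)] vs(1) B(4) W(3) by simp
  have "W \<subseteq> lin_span vs"
    unfolding B(2)[symmetric] vs(1)[symmetric] by (rule V.span_minimal[OF set_subset_lin_span subspace_lin_span])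
  moreover have "lin_span vs \<subseteq> W" using B(1) vs(1) by (intro lin_span_subset[OF W(1)]) simp
  ultimately have span: "lin_span vs = W" by blast
  have "card ((\<lambda>c. lin_comb c vs) ` ({..<length vs} \<rightarrow>\<^sub>E UNIV)) = card ({..<length vs} \<rightarrow>\<^sub>E (UNIV :: 'a set))"
    unfolding lin_span_eq_image[symmetric] span using V.card_eq_power_dim[OF W(1) fin] W(3) len
    by (simp add: card_PiE)
  then have "lin_indep vs"
    unfolding lin_indep_iff_inj by (intro eq_card_imp_inj_on finite_PiE) simp_all
  then show "W \<in> subspaces_dim n d"
    unfolding subspaces_dim_def using len vs(1) B(1) W(2) span by blast
qed

lemma GLn_eq_GL: "GLn n = V.GL (Vsp n)"
  unfolding GLn_def V.GL_def plus_fun_def vscale_def ..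

lemma perm_char_eq: "real_of_int (perm_char n d g) = V.fixed_count (Vsp n :: 'a::{field,finite} vec set) d g"
  by (simp add: perm_char_def V.fixed_count_def subspaces_dim_eq_Gr)

lemma chi_eq: "real_of_int (chi n x g) = V.chi_count (Vsp n :: 'a::{field,finite} vec set) x g"
  by (simp add: chi_def V.chi_count_def[OF subspace_Vsp finite_Vsp] perm_char_eq)

section \<open>From tensors indexed by sets of lines to kernels on subspaces\<close>

definition lines_in :: "nat \<Rightarrow> ('a::field) vec set \<Rightarrow> 'a vec set set" where
  "lines_in n W = {L \<in> lines n. L \<subseteq> W}"

text \<open>A subspace is recovered from its lines, as every non-zero vector spans one. Hence
  distinct subspaces label distinct basis tensors.\<close>

lemma lines_in_mono:
  assumes "W \<in> V.Gr (Vsp n) m" "W' \<in> V.Gr (Vsp n) m'" "lines_in n W \<subseteq> lines_in n W'"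
  shows "W \<subseteq> (W' :: 'a::{field,finite} vec set)"
proof
  fix v assume v: "v \<in> W"
  have W: "V.subspace W" "W \<subseteq> Vsp n" "V.subspace W'" using assms by (auto simp: V.Gr_def)
  show "v \<in> W'"
  proof (cases "v = 0")
    case True
    then show ?thesis using V.subspace_0[OF W(3)] by simp
  next
    case False
    have "V.span {v} \<subseteq> W" by (rule V.span_minimal) (use v W in auto)
    moreover have "V.dim (V.span {v}) = 1"
      using V.dim_span_insert[of "{0}" v] False by (simp add: insert_commute[of v 0])
    ultimately have "V.span {v} \<in> lines_in n W"
      unfolding lines_in_def lines_def subspaces_dim_eq_Gr using W(2) by (auto simp: V.Gr_def)
    then have "V.span {v} \<subseteq> W'" using assms(3) by (auto simp: lines_in_def)
    then show ?thesis using V.span_base[of v "{v}"] by auto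
  qed
qed

lemma lines_in_inj:
  assumes "W \<in> V.Gr (Vsp n) m" "W' \<in> V.Gr (Vsp n) m'"
  shows "lines_in n W = lines_in n W' \<longleftrightarrow> W = (W' :: 'a::{field,finite} vec set)"
  using lines_in_mono[OF assms] lines_in_mono[OF assms(2,1)] by blast

text \<open>\<open>phi\<close> acts on coefficient functions through preimages, and the lines that
  \<open>g\<close> sends into \<open>W\<close> are those of the preimage of \<open>W\<close> under
  \<open>g\<close>.\<close>

lemma lines_in_preimage:
  assumes g: "g \<in> V.GL (Vsp n)" and W: "W \<in> V.Gr (Vsp n) m" and W': "W' \<in> V.Gr (Vsp n) m"
  shows "{L \<in> lines n. g ` L \<in> lines_in n W} = lines_in n W' \<longleftrightarrow> g ` W' = (W :: 'a::{field,finite} vec set)"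
proof -
  have b: "bij g" by (rule V.GL_bij[OF g])
  have i: "inv g \<in> V.GL (Vsp n)" by (rule V.GL_inv[OF subspace_Vsp g])
  have gi: "g ` inv g ` X = X" "inv g ` g ` X = X" for X
    using b by (simp_all add: image_f_inv_f image_inv_f_f bij_is_inj bij_is_surj)
  have "g ` L \<in> lines n" if "L \<in> lines n" for L
    using V.GL_Gr_iff[OF g subspace_Vsp finite_Vsp] that unfolding lines_def subspaces_dim_eq_Gr by blast
  moreover have "g ` L \<subseteq> W \<longleftrightarrow> L \<subseteq> inv g ` W" for L
    using image_mono[of "g ` L" W "inv g"] image_mono[of L "inv g ` W" g] by (auto simp only: gi)
  ultimately have "{L \<in> lines n. g ` L \<in> lines_in n W} = lines_in n (inv g ` W)"
    unfolding lines_in_def by blast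
  moreover have "inv g ` W \<in> V.Gr (Vsp n) m" by (rule V.GL_Gr_iff[OF i subspace_Vsp finite_Vsp W])
  ultimately have "{L \<in> lines n. g ` L \<in> lines_in n W} = lines_in n W' \<longleftrightarrow> inv g ` W = W'"
    using lines_in_inj W' by metis
  moreover have "inv g ` W = W' \<longleftrightarrow> g ` W' = W" using gi by metis
  ultimately show ?thesis by simp
qed

lemma prob_eq_kern:
  fixes n m k l x :: nat
  defines "X \<equiv> Xi_set n m k l :: 'a::{field,finite} vec set set"
    and "q \<equiv> real (card (UNIV :: 'a set))"
  assumes B: "qbinom q (n - k) (m - l) > 0"
  shows "prob TYPE('a) x n m k l = complex_of_real
    (dimV q n x / (real (card (GLn n :: ('a vec \<Rightarrow> 'a vec) set)) * qbinom q (n - k) (m - l))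
      * (\<Sum>W\<in>X. \<Sum>W'\<in>X. V.kern (Vsp n) (V.chi_count (Vsp n) x) W W'))"
proof -
  define c where "c = qbinom q (n - k) (m - l) powr (-1/2)"
  define D where "D = dimV q n x / real (card (GLn n :: ('a vec \<Rightarrow> 'a vec) set))"
  define \<chi> where "\<chi> = V.chi_count (Vsp n :: 'a vec set) x"
  define F where "F = (\<lambda>S. D * (\<Sum>g\<in>GLn n. \<chi> g * (c * (\<Sum>W'\<in>X. if {L \<in> lines n. g ` L \<in> S} = lines_in n W' then 1 else 0))))"
  have finL: "finite (lines n :: 'a vec set set)"
    unfolding lines_def subspaces_dim_eq_Gr by (rule V.finite_Gr[OF finite_Vsp])
  have XGr: "W \<in> V.Gr (Vsp n) m" if "W \<in> X" for W
    using that by (simp add: X_def Xi_set_def subspaces_dim_eq_Gr)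
  have finX: "finite X"
    by (rule finite_subset[OF _ V.finite_Gr[OF finite_Vsp, of n m]]) (use XGr in blast)
  have Xi: "Xi n m k l S = complex_of_real (c * (\<Sum>W\<in>X. if S = lines_in n W then 1 else 0))" for S :: "'a vec set set"
  proof -
    have "(\<Sum>W\<in>X. if S = lines_in n W then 1 else 0) = complex_of_real (\<Sum>W\<in>X. if S = lines_in n W then 1 else 0)"
      unfolding of_real_sum by (rule sum.cong) simp_all
    then show ?thesis
      unfolding Xi_def eW_def lines_in_def[symmetric] X_def[symmetric] q_def[symmetric] c_def[symmetric] by simp
  qed
  have PX: "Pproj n x (Xi n m k l) S = complex_of_real (F S)" for S :: "'a vec set set"
    unfolding Pproj_def phi_def Xi F_def D_def q_def \<chi>_def chi_eq[symmetric] by simp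
  have "prob TYPE('a) x n m k l = (\<Sum>S\<in>Pow (lines n :: 'a vec set set).
      complex_of_real ((c * (\<Sum>W\<in>X. if S = lines_in n W then 1 else 0)) * F S))"
    unfolding prob_def tinner_def PX Xi by simp
  also have "\<dots> = complex_of_real (\<Sum>S\<in>Pow (lines n :: 'a vec set set).
      (c * (\<Sum>W\<in>X. if S = lines_in n W then 1 else 0)) * F S)" by simp
  also have "(\<Sum>S\<in>Pow (lines n :: 'a vec set set). (c * (\<Sum>W\<in>X. if S = lines_in n W then 1 else 0)) * F S)
      = (\<Sum>S\<in>Pow (lines n :: 'a vec set set). \<Sum>W\<in>X. if S = lines_in n W then c * F S else 0)"
    by (rule sum.cong[OF refl])
      (simp add: sum_distrib_left sum_distrib_right if_distrib if_distribR cong: if_cong)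
  also have "\<dots> = (\<Sum>W\<in>X. \<Sum>S\<in>Pow (lines n :: 'a vec set set). if S = lines_in n W then c * F S else 0)"
    by (rule sum.swap)
  also have "\<dots> = (\<Sum>W\<in>X. c * F (lines_in n W))"
  proof (rule sum.cong[OF refl])
    fix W :: "'a vec set"
    have "lines_in n W \<in> Pow (lines n)" by (auto simp: lines_in_def)
    then show "(\<Sum>S\<in>Pow (lines n). if S = lines_in n W then c * F S else 0) = c * F (lines_in n W)"
      using finL by (simp add: sum.delta)
  qed
  also have "\<dots> = (\<Sum>W\<in>X. c * (D * (c * (\<Sum>W'\<in>X. V.kern (Vsp n) \<chi> W W'))))"
  proof (rule sum.cong[OF refl])
    fix W assume W: "W \<in> X"
    have "(\<Sum>g\<in>GLn n. \<chi> g * (c * (\<Sum>W'\<in>X. if {L \<in> lines n. g ` L \<in> lines_in n W} = lines_in n W' then 1 else 0)))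
        = (\<Sum>g\<in>GLn n. c * (\<Sum>W'\<in>X. if g ` W' = W then \<chi> g else 0))"
    proof (rule sum.cong[OF refl])
      fix g :: "'a vec \<Rightarrow> 'a vec" assume "g \<in> GLn n"
      then have g: "g \<in> V.GL (Vsp n)" by (simp add: GLn_eq_GL)
      have "(\<Sum>W'\<in>X. if {L \<in> lines n. g ` L \<in> lines_in n W} = lines_in n W' then 1 else 0)
          = (\<Sum>W'\<in>X. if g ` W' = W then 1 else (0 :: real))"
        by (rule sum.cong[OF refl]) (simp add: lines_in_preimage[OF g XGr[OF W] XGr])
      moreover have "(\<Sum>W'\<in>X. if g ` W' = W then \<chi> g else 0)
          = \<chi> g * (\<Sum>W'\<in>X. if g ` W' = W then 1 else (0 :: real))"
        unfolding sum_distrib_left by (rule sum.cong) simp_all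
      ultimately show "\<chi> g * (c * (\<Sum>W'\<in>X. if {L \<in> lines n. g ` L \<in> lines_in n W} = lines_in n W' then 1 else 0))
          = c * (\<Sum>W'\<in>X. if g ` W' = W then \<chi> g else 0)"
        by (simp only: mult.left_commute)
    qed
    also have "\<dots> = c * (\<Sum>W'\<in>X. \<Sum>g\<in>GLn n. if g ` W' = W then \<chi> g else 0)"
      by (simp only: sum_distrib_left[symmetric]) (simp only: sum.swap[of _ X])
    also have "(\<Sum>W'\<in>X. \<Sum>g\<in>GLn n. if g ` W' = W then \<chi> g else 0) = (\<Sum>W'\<in>X. V.kern (Vsp n) \<chi> W W')"
      by (rule sum.cong[OF refl])
        (simp add: V.kern_def GLn_eq_GL sum.inter_filter[symmetric] V.finite_GL[OF finite_Vsp])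
    finally show "c * F (lines_in n W) = c * (D * (c * (\<Sum>W'\<in>X. V.kern (Vsp n) \<chi> W W')))"
      by (simp add: F_def)
  qed
  also have "\<dots> = (c * c) * D * (\<Sum>W\<in>X. \<Sum>W'\<in>X. V.kern (Vsp n) \<chi> W W')"
    by (simp add: sum_distrib_left mult_ac)
  also have "c * c = 1 / qbinom q (n - k) (m - l)"
  proof -
    have "c * c = qbinom q (n - k) (m - l) powr (- 1)"
      unfolding c_def powr_add[symmetric] by simp
    then show ?thesis using B by (simp add: powr_minus_divide)
  qed
  finally show ?thesis by (simp add: D_def \<chi>_def mult_ac)
qed

text \<open>Since \<open>l \<le> k\<close>, \<open>F\<close> and \<open>C\<close> meet only in 0,
  and each \<open>W\<close> is the direct sum of \<open>F\<close> and \<open>W \<inter> C\<close>.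
  Adding \<open>F\<close> raises intersections by exactly \<open>l\<close> dimensions, so distances
  agree with those in the Grassmann graph of \<open>C\<close>.\<close>

lemma Xi_set_bij:
  fixes n m k l :: nat
  assumes "m \<le> n" "k \<le> n" "l \<le> m" "l \<le> k"
  defines "F \<equiv> Vflag n l :: 'a::{field,finite} vec set" and "C \<equiv> Vcompl n k :: 'a vec set"
  shows "bij_betw (\<lambda>U. V.ssum F U) (V.Gr C (m - l)) (Xi_set n m k l)"
    and "\<And>U U'. U \<in> V.Gr C (m - l) \<Longrightarrow> U' \<in> V.Gr C (m - l) \<Longrightarrow>
      V.dim (V.ssum F U \<inter> V.ssum F U') = l + V.dim (U \<inter> U')"
proof -
  have Fc: "F = coord_space {..<l}" unfolding F_def by (rule Vflag_eq_coord) (use assms in simp)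
  have Cc: "C = coord_space {k..<n}" unfolding C_def by (rule Vcompl_eq_coord)
  have F: "V.subspace F" "finite F" "V.dim F = l"
    unfolding Fc using subspace_coord_space card_coord_space(1)[of "{..<l}"] dim_coord_space[of "{..<l}"] by simp_all
  have C: "V.subspace C" "finite C"
    unfolding Cc using subspace_coord_space card_coord_space(1)[of "{k..<n}"] by simp_all
  have FV: "F \<subseteq> Vsp n" "C \<subseteq> Vsp n"
    by (auto simp: F_def C_def Vflag_def Vcompl_def)
  have FC: "v = 0" if "v \<in> F" "v \<in> C" for v
  proof
    fix i
    show "v i = 0 i"
      using that assms(4) unfolding Fc Cc coord_space_def by (cases "i < l") auto
  qed
  have FU0: "F \<inter> U = {0}" if "V.subspace U" "U \<subseteq> C" for U
    using FC that V.subspace_0[OF that(1)] V.subspace_0[OF F(1)] by auto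
  have dsum: "V.dim (V.ssum F U) = l + V.dim U" if U: "V.subspace U" "U \<subseteq> C" for U
    using V.dim_ssum[OF F(1) U(1) F(2) finite_subset[OF U(2) C(2)]] by (simp add: FU0[OF U] F(3))
  have inC: "V.ssum F U \<inter> C = U" if U: "V.subspace U" "U \<subseteq> C" for U
  proof (intro equalityI subsetI)
    fix v assume v: "v \<in> V.ssum F U \<inter> C"
    then obtain f u where fu: "f \<in> F" "u \<in> U" "v = f + u"
      unfolding V.ssum_eq[OF F(1) U(1)] by auto
    have "v - u \<in> C" by (rule V.subspace_diff[OF C(1)]) (use v fu U in auto)
    then have "f \<in> C" using fu(3) by simp
    then have "f = 0" by (rule FC[OF fu(1)])
    then show "v \<in> U" using fu by simp
  next
    fix v assume "v \<in> U"
    then show "v \<in> V.ssum F U \<inter> C" using U(2) V.ssum_upper(2)[of U F] by auto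
  qed
  have GrC: "V.subspace U" "U \<subseteq> C" "V.dim U = m - l" if "U \<in> V.Gr C (m - l)" for U
    using that by (auto simp: V.Gr_def)
  have CE: "A \<in> V.Gr (Vsp n) (m - l)" if "A \<in> V.Gr C (m - l)" for A
    using that FV(2) by (auto simp: V.Gr_def)
  show "bij_betw (\<lambda>U. V.ssum F U) (V.Gr C (m - l)) (Xi_set n m k l)"
  proof (rule bij_betw_byWitness[where f' = "\<lambda>W. W \<inter> C"])
    show "\<forall>U\<in>V.Gr C (m - l). V.ssum F U \<inter> C = U" using inC GrC by blast
    show "(\<lambda>U. V.ssum F U) ` V.Gr C (m - l) \<subseteq> Xi_set n m k l"
    proof (rule image_subsetI)
      fix U assume UG: "U \<in> V.Gr C (m - l)"
      note U = GrC[OF UG]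
      have "V.ssum F U \<subseteq> Vsp n" by (rule V.ssum_least[OF FV(1) _ subspace_Vsp]) (use U(2) FV(2) in blast)
      then have "V.ssum F U \<in> V.Gr (Vsp n) m"
        using dsum[OF U(1,2)] U(3) assms(3) by (simp add: V.Gr_def)
      then show "V.ssum F U \<in> Xi_set n m k l"
        using V.ssum_upper(1)[of F U] inC[OF U(1,2)] CE[OF UG]
        by (simp add: Xi_set_def subspaces_dim_eq_Gr F_def C_def)
    qed
    show "(\<lambda>W. W \<inter> C) ` Xi_set n m k l \<subseteq> V.Gr C (m - l)"
      by (auto simp: Xi_set_def subspaces_dim_eq_Gr V.Gr_def C_def)
    show "\<forall>W\<in>Xi_set n m k l. V.ssum F (W \<inter> C) = W"
    proof
      fix W :: "'a vec set" assume "W \<in> Xi_set n m k l"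
      then have W: "V.subspace W" "W \<subseteq> Vsp n" "V.dim W = m" "F \<subseteq> W"
          "V.subspace (W \<inter> C)" "V.dim (W \<inter> C) = m - l"
        by (auto simp: Xi_set_def subspaces_dim_eq_Gr V.Gr_def F_def C_def)
      show "V.ssum F (W \<inter> C) = W"
      proof (rule V.sub_eq_of_dim[OF V.subspace_ssum W(1) finite_subset[OF W(2) finite_Vsp]])
        show "V.ssum F (W \<inter> C) \<subseteq> W" by (rule V.ssum_least[OF W(4) _ W(1)]) simp
        show "V.dim W \<le> V.dim (V.ssum F (W \<inter> C))"
          using dsum[OF W(5)] W(3,6) assms(3) by simp
      qed
    qed
  qed
  fix U U' :: "'a vec set" assume U: "U \<in> V.Gr C (m - l)" and U': "U' \<in> V.Gr C (m - l)"
  have "V.ssum F U \<inter> V.ssum F U' = V.ssum F (U \<inter> U')"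
  proof (rule equalityI)
    show "V.ssum F (U \<inter> U') \<subseteq> V.ssum F U \<inter> V.ssum F U'"
      unfolding V.ssum_def by (intro Int_greatest V.span_mono) auto
    show "V.ssum F U \<inter> V.ssum F U' \<subseteq> V.ssum F (U \<inter> U')"
    proof
      fix v assume v: "v \<in> V.ssum F U \<inter> V.ssum F U'"
      then obtain f u f' u' where fu: "f \<in> F" "u \<in> U" "v = f + u" "f' \<in> F" "u' \<in> U'" "v = f' + u'"
        unfolding V.ssum_eq[OF F(1) GrC(1)[OF U]] V.ssum_eq[OF F(1) GrC(1)[OF U']] by auto
      \<comment> \<open>The common difference lies in both \<open>F\<close> and \<open>C\<close> and
        is therefore 0, which puts the \<open>C\<close>-component into
        \<open>U \<inter> U'\<close>.\<close>
      have "f - f' = u' - u" using fu(3,6) by (simp add: algebra_simps)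
      moreover have "f - f' \<in> F" by (rule V.subspace_diff[OF F(1) fu(1,4)])
      moreover have "u' - u \<in> C"
        by (rule V.subspace_diff[OF C(1)]) (use fu GrC(2)[OF U] GrC(2)[OF U'] in auto)
      ultimately have "f - f' = 0" using FC by metis
      then have "u = u'" using \<open>f - f' = u' - u\<close> by simp
      then show "v \<in> V.ssum F (U \<inter> U')"
        unfolding V.ssum_eq[OF F(1) V.subspace_inter[OF GrC(1)[OF U] GrC(1)[OF U']]] using fu by auto
    qed
  qed
  then show "V.dim (V.ssum F U \<inter> V.ssum F U') = l + V.dim (U \<inter> U')"
    using dsum[OF V.subspace_inter[OF GrC(1)[OF U] GrC(1)[OF U']]] GrC(2)[OF U] by auto
qed

theorem theoremC4:
  fixes n m k l x :: nat
  assumes "m \<le> n" "k \<le> n" "m + k \<le> n + l" "l \<le> min m k" "m \<le> n - m" "x \<le> m"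
  shows "prob TYPE('a::{field,finite}) x n m k l =
    complex_of_real (
      (let q = real (card (UNIV :: 'a set)); M = m - l; N = n + l - m - k in
        qbinom q (n - k) M * (qbinom q n x / qbinom q n m) * q ^ x
        * (qint q (n - 2 * x + 1) / qint q (n - x + 1))
        * phi43 (q powi (- int x)) (q powi (int x - int n - 1)) (q powi (- int M)) (q powi (- int N))
                (q powi (- int m)) (q powi (int m - int n)) (q powi (- int M - int N)) q q))"
proof -
  define q where "q = real (card (UNIV :: 'a set))"
  define M N where "M = m - l" and "N = n + l - m - k"
  define C where "C = (Vcompl n k :: 'a vec set)"
  define F where "F = (Vflag n l :: 'a vec set)"
  define X where "X = (Xi_set n m k l :: 'a vec set set)"
  define B where "B = qbinom q (n - k) M"
  define u where "u = (\<lambda>s r. qpoch (1 / q ^ r) q s)"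
  define a where "a = omega_coeff q n m x"
  \<comment> \<open>The mean of \<open>(q^-r; q)_s\<close> over the \<open>M\<close>-subspaces of
    \<open>C\<close>, with \<open>r\<close> the distance from a fixed one; it does not depend on
    that choice.\<close>
  define \<rho> where "\<rho> = (\<lambda>s. u s M * u s N / u s (n - k))"
  have q: "q > 1" using V.qn_gt1[where 'a = 'a] by (simp add: q_def)
  have nk: "n - k = M + N" "M \<le> n - k" "N = n - k - M" using assms by (auto simp: M_def N_def)
  have Cc: "C = coord_space {k..<n}" unfolding C_def by (rule Vcompl_eq_coord)
  have C: "V.subspace C" "finite C" "V.dim C = n - k"
    unfolding Cc using subspace_coord_space card_coord_space(1)[of "{k..<n}"] dim_coord_space[of "{k..<n}"] by simp_all
  have cardC: "real (card (V.Gr C M)) = B"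
    using V.card_Gr[OF C(1,2), of M] nk(2) by (simp add: C(3) B_def q_def)
  have "V.Gr C M \<noteq> {}"
    using V.exists_subspace_of_dim[OF C(1,2), of M] nk(2) C(3) by (auto simp: V.Gr_def)
  then have B: "B > 0" using cardC V.finite_Gr[OF C(2), of M] by (metis card_gt_0_iff of_nat_0_less_iff)
  have lm: "l \<le> m" "l \<le> k" using assms by auto
  note bij = Xi_set_bij(1)[OF assms(1,2) lm, where 'a = 'a, folded F_def C_def M_def X_def]
  note dimXi = Xi_set_bij(2)[OF assms(1,2) lm, where 'a = 'a, folded F_def C_def M_def]
  have XGr: "W \<in> V.Gr (Vsp n) m" if "W \<in> X" for W
    using that by (simp add: X_def Xi_set_def subspaces_dim_eq_Gr)
  define G where "G = real (card (GLn n :: ('a vec \<Rightarrow> 'a vec) set))"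
  have G: "G \<noteq> 0"
  proof -
    have "V.GL (Vsp n :: 'a vec set) \<noteq> {}" using V.id_GL by blast
    then show ?thesis using V.finite_GL[OF finite_Vsp, of n, where 'a = 'a] by (simp add: G_def GLn_eq_GL)
  qed
  have cardm: "real (card (V.Gr (Vsp n :: 'a vec set) m)) = qbinom q n m"
    using V.card_Gr[OF subspace_Vsp finite_Vsp, of m n] assms(1) by (simp add: dim_Vsp q_def)
  have T: "(\<Sum>U'\<in>V.Gr C M. u s (M - V.dim (U \<inter> U'))) = B * \<rho> s" if U: "U \<in> V.Gr C M" for U s
  proof -
    define S where "S = (\<Sum>U'\<in>V.Gr C M. u s (M - V.dim (U \<inter> U')))"
    have SE: "S * u s (n - k) = B * u s M * u s N"
      using V.sum_qpoch_distance[OF C(1,2) U, of s] nk(2,3) cardC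
      by (simp add: S_def u_def C(3) q_def Int_commute)
    show ?thesis
    \<comment> \<open>For \<open>s > n - k\<close> the denominator of \<open>\<rho> s\<close> is 0,
      so \<open>\<rho> s = 0\<close> by HOL division. The sum is 0 as well, because all distances
      are at most \<open>M \<le> n - k < s\<close>.\<close>
    proof (cases "s \<le> n - k")
      case True
      have "u s (n - k) \<noteq> 0"
        unfolding u_def
      proof (rule qpoch_neq_0)
        fix i assume "i < s"
        then have "q ^ i < q ^ (n - k)" using True q by (intro power_strict_increasing) auto
        then show "1 / q ^ (n - k) * q ^ i \<noteq> 1" using q by (simp add: field_simps)
      qed
      then show ?thesis using SE by (simp add: S_def[symmetric] \<rho>_def field_simps)
    next
      case False
      have "u s (M - r) = 0" for r
        unfolding u_def using q False nk(2) by (intro qpoch_inverse_power_eq_0) simp_all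
      moreover have "u s M = 0"
        unfolding u_def using q False nk(2) by (intro qpoch_inverse_power_eq_0) simp_all
      ultimately show ?thesis by (simp add: \<rho>_def)
    qed
  qed
  have "(\<Sum>W\<in>X. \<Sum>W'\<in>X. V.kern (Vsp n) (V.chi_count (Vsp n) x) W W')
      = (\<Sum>W\<in>X. \<Sum>W'\<in>X. G / qbinom q n m * omega q n m x (m - V.dim (W \<inter> W')))"
  proof (intro sum.cong refl)
    fix W W' assume W: "W \<in> X" "W' \<in> X"
    show "V.kern (Vsp n) (V.chi_count (Vsp n) x) W W' = G / qbinom q n m * omega q n m x (m - V.dim (W \<inter> W'))"
      using V.kern_chi_eq_omega[OF subspace_Vsp finite_Vsp, of m n x W W'] assms(1,5,6) XGr W
      by (simp add: dim_Vsp cardm GLn_eq_GL[symmetric] G_def q_def)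
  qed
  also have "\<dots> = (\<Sum>U\<in>V.Gr C M. \<Sum>U'\<in>V.Gr C M.
      G / qbinom q n m * omega q n m x (m - V.dim (V.ssum F U \<inter> V.ssum F U')))"
    unfolding sum.reindex_bij_betw[OF bij, symmetric] ..
  also have "\<dots> = (\<Sum>U\<in>V.Gr C M. \<Sum>U'\<in>V.Gr C M.
      G / qbinom q n m * (\<Sum>s\<le>x. a s * u s (M - V.dim (U \<inter> U'))))"
    by (intro sum.cong refl) (simp add: dimXi omega_def a_def u_def M_def)
  also have "\<dots> = G / qbinom q n m * (\<Sum>U\<in>V.Gr C M. \<Sum>s\<le>x. a s * (\<Sum>U'\<in>V.Gr C M. u s (M - V.dim (U \<inter> U'))))"
    by (simp add: sum_distrib_left sum.swap[of _ "{..x}"])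
  also have "(\<Sum>U\<in>V.Gr C M. \<Sum>s\<le>x. a s * (\<Sum>U'\<in>V.Gr C M. u s (M - V.dim (U \<inter> U'))))
      = (\<Sum>U\<in>V.Gr C M. \<Sum>s\<le>x. a s * (B * \<rho> s))"
    by (rule sum.cong[OF refl]) (simp only: T)
  also have "\<dots> = B * (B * (\<Sum>s\<le>x. a s * \<rho> s))"
    by (simp add: cardC sum_distrib_left mult_ac)
  finally have kern: "(\<Sum>W\<in>X. \<Sum>W'\<in>X. V.kern (Vsp n) (V.chi_count (Vsp n) x) W W')
      = G / qbinom q n m * (B * (B * (\<Sum>s\<le>x. a s * \<rho> s)))" .
  \<comment> \<open>The factor \<open>(q^-x; q)_s\<close> ends the series at \<open>s = x\<close>.
    Up to there a denominator vanishes only for \<open>s > n - k\<close>, where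
    \<open>(q^-M; q)_s\<close> in the numerator is 0 too.\<close>
  have phi: "phi43 (q powi (- int x)) (q powi (int x - int n - 1)) (q powi (- int M)) (q powi (- int N))
      (q powi (- int m)) (q powi (int m - int n)) (q powi (- int M - int N)) q q = (\<Sum>s\<le>x. a s * \<rho> s)"
  proof -
    have pw: "q powi (- int i) = 1 / q ^ i" for i
      using q by (simp add: power_int_minus_divide)
    have p1: "q powi (int x - int n - 1) = q ^ x / q ^ Suc n"
    proof -
      have "int x - int n - 1 = int x - int (Suc n)" by simp
      moreover have "q powi (int x - int (Suc n)) = q powi int x / q powi int (Suc n)"
        using q by (intro power_int_diff) simp
      ultimately show ?thesis by (simp only: power_int_of_nat)
    qed
    have p2: "q powi (int m - int n) = q ^ m / q ^ n"
      using q power_int_diff[of q "int m" "int n"] by simp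
    have p3: "q powi (- int M - int N) = 1 / q ^ (n - k)"
      using pw[of "M + N"] nk(1) by (simp add: algebra_simps)
    have summand: "(qpoch (1 / q ^ x) q s * qpoch (q ^ x / q ^ Suc n) q s * qpoch (1 / q ^ M) q s * qpoch (1 / q ^ N) q s)
          / (qpoch (1 / q ^ m) q s * qpoch (q ^ m / q ^ n) q s * qpoch (1 / q ^ (n - k)) q s * qpoch q q s) * q ^ s
        = a s * \<rho> s" for s
      by (simp add: a_def omega_coeff_def \<rho>_def u_def mult_ac)
    have "a s * \<rho> s = 0" if "s \<notin> {..x}" for s
      using that q by (simp add: a_def omega_coeff_def qpoch_inverse_power_eq_0)
    then show ?thesis
      unfolding phi43_def pw p1 p2 p3 summand by (intro suminf_finite) auto
  qed
  \<comment> \<open>The two sums over \<open>M\<close>-subspaces contribute \<open>B\<close> each;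
    the normalisation of \<open>Xi\<close> cancels one, and the other is the leading binomial of the
    formula.\<close>
  have "dimV q n x / (G * B) * (G / qbinom q n m * (B * (B * (\<Sum>s\<le>x. a s * \<rho> s))))
      = B * (qbinom q n x / qbinom q n m) * q ^ x * (qint q (n - 2 * x + 1) / qint q (n - x + 1))
        * (\<Sum>s\<le>x. a s * \<rho> s)"
    using B G by (simp add: dimV_def mult_ac)
  then show ?thesis
    using prob_eq_kern[where 'a = 'a, of n k m l x] B
    unfolding Let_def q_def[symmetric] M_def[symmetric] N_def[symmetric] phi B_def[symmetric]
      X_def[symmetric] kern G_def[symmetric] by simp
qed

end
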